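(* Let $k\ge 4$ be an integer and $p$ a prime. The group $G=\mathrm{PSL}_k(\mathbb{F}_p)$, and therefore also the group $G=\mathrm{SL}_k(\mathbb{F}_p)$, has $\hat{\mathrm{C}}(G)$ of exponent divisible by $2^{\min(\mathrm{ord}_2(k),\,\mathrm{ord}_2(p-1))}$.
   Context: $\mathrm{ord}_2$ denotes the 2-adic valuation of a rational number. For a finite group $G$: $\mathrm{Char}_{\mathbb{Q}}(G)$ is the ring of $\mathbb{Q}$-valued virtual complex characters of $G$; $\mathrm{Perm}(G)\subseteq \mathrm{Char}_{\mathbb{Q}}(G)$ is the ring of characters of virtual permutation representations, i.e. the $\mathbb{Z}$-span of the characters of $\mathbb{Q}[G/H]$ for $H\le G$; and $\hat{\mathrm{C}}(G)=\mathrm{Char}_{\mathbb{Q}}(G)/\mathrm{Perm}(G)$, a finite abelian group. *)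

theory Defs
  imports
    "HOL-Algebra.Generated_Groups"
    "HOL-Algebra.Left_Coset"
    "HOL-Algebra.Multiplicative_Group"
    "Jordan_Normal_Form.Determinant"
    "Berlekamp_Zassenhaus.Finite_Field"
begin

definition GL :: "nat \<Rightarrow> 'a::comm_ring_1 mat monoid" where
  "GL n = units_of (ring_mat TYPE('a) n ())"

definition SL :: "nat \<Rightarrow> 'a::comm_ring_1 mat monoid" where
  "SL n = (GL n)\<lparr>carrier := {A \<in> carrier (GL n). det A = 1}\<rparr>"

definition PSL :: "nat \<Rightarrow> 'a::comm_ring_1 mat set monoid" where
  "PSL n = SL n Mod {A \<in> carrier (SL n). \<exists>c. A = c \<cdot>\<^sub>m 1\<^sub>m n}"

definition mat_trace :: "'a::comm_monoid_add mat \<Rightarrow> 'a" where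
  "mat_trace A = (\<Sum>i<dim_row A. A $$ (i, i))"

text \<open>
  Characters are extended by 0 outside the carrier, so that two characters of \<open>G\<close> are
  equal as HOL functions iff they agree on \<open>G\<close>.
\<close>

definition character :: "('g, 'b) monoid_scheme \<Rightarrow> ('g \<Rightarrow> complex mat) \<Rightarrow> 'g \<Rightarrow> complex" where
  "character G \<rho> = (\<lambda>g. if g \<in> carrier G then mat_trace (\<rho> g) else 0)"

definition characters :: "('g, 'b) monoid_scheme \<Rightarrow> ('g \<Rightarrow> complex) set" where
  "characters G = {character G \<rho> | \<rho> n. \<rho> \<in> hom G (GL n)}"

text \<open>
  The matrices of the permutation module of \<open>G\<close> on the left cosets of \<open>H\<close>, with respect to
  the basis of cosets listed in \<open>cs\<close>. Their entries are 0 and 1, so that they describe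
  \<open>\<rat>[G/H]\<close>, here after extension of scalars to the complex numbers.
\<close>

definition coset_rep :: "('g, 'b) monoid_scheme \<Rightarrow> 'g set list \<Rightarrow> 'g \<Rightarrow> complex mat" where
  "coset_rep G cs g =
     mat (length cs) (length cs) (\<lambda>(i, j). if cs ! i = g <#\<^bsub>G\<^esub> (cs ! j) then 1 else 0)"

definition perm_characters :: "('g, 'b) monoid_scheme \<Rightarrow> ('g \<Rightarrow> complex) set" where
  "perm_characters G =
     {character G (coset_rep G cs) | H cs.
        subgroup H G \<and> distinct cs \<and> set cs = lcosets\<^bsub>G\<^esub> H}"

definition fun_group :: "('g \<Rightarrow> complex) monoid" where
  "fun_group = \<lparr>carrier = UNIV, monoid.mult = (\<lambda>\<chi> \<psi> g. \<chi> g + \<psi> g), one = (\<lambda>g. 0)\<rparr>"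

text \<open>Since \<open>fun_group\<close> is written additively, \<open>generate fun_group S\<close> is the \<open>\<int>\<close>-span of \<open>S\<close>.\<close>

definition Char_Q :: "('g, 'b) monoid_scheme \<Rightarrow> ('g \<Rightarrow> complex) set" where
  "Char_Q G = {\<chi> \<in> generate fun_group (characters G). \<forall>g \<in> carrier G. \<chi> g \<in> \<rat>}"

definition Perm :: "('g, 'b) monoid_scheme \<Rightarrow> ('g \<Rightarrow> complex) set" where
  "Perm G = generate fun_group (perm_characters G)"

definition C_hat :: "('g, 'b) monoid_scheme \<Rightarrow> ('g \<Rightarrow> complex) set monoid" where
  "C_hat G = fun_group\<lparr>carrier := Char_Q G\<rparr> Mod Perm G"

text \<open>
  For a finite group this is the least positive \<open>n\<close> with \<open>x\<^sup>n = 1\<close> for all \<open>x\<close>; it is 0 if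
  the orders of the elements have no positive common multiple.
\<close>

definition group_exponent :: "('g, 'b) monoid_scheme \<Rightarrow> nat" where
  "group_exponent G = Lcm (group.ord G ` carrier G)"

end

theory Submission
  imports
    Defs
    "HOL-Algebra.Sylow"
    "HOL-Algebra.Group_Action"
    "HOL-Algebra.Algebraic_Closure_Type"
    "HOL-Number_Theory.Pocklington"
begin

text \<open>
  Let \<open>u\<close> have odd order, let \<open>P\<close> be a group of order divisible by \<open>2\<^sup>v\<close> that normalises the
  subgroup generated by \<open>u\<close>, and let the only involution \<open>z\<close> of \<open>P\<close> commute with \<open>u\<close>. For a
  permutation character \<open>\<chi>\<close>, the difference \<open>\<chi>(u) - \<chi>(u z)\<close> counts the points fixed by \<open>u\<close> and not
  by \<open>z\<close>. A Sylow 2-subgroup of \<open>P\<close> acts freely on these points, so \<open>2\<^sup>v\<close> divides the difference.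
  It remains to find a rational character for which the difference has a small 2-adic valuation.

  Put \<open>n = k - 2\<close> and let \<open>q\<close> be the odd part of \<open>p\<^bsup>n/2\<^esup> + 1\<close>. Take for \<open>u\<close> the block diagonal
  matrix of a unipotent 2 by 2 block and of the multiplication \<open>U\<close> by an element of order \<open>q\<close> of the
  field with \<open>p\<^sup>n\<close> elements, let \<open>z\<close> be \<open>-1\<close> on the second block, and take for \<open>P\<close> the centraliser of
  \<open>U\<close>. Let \<open>B\<close> be generated by the scalar matrices, the unipotent block, \<open>U\<close> and \<open>z\<close>. Sum the
  characters induced from the linear characters of \<open>B\<close> that are trivial on scalars, non-trivial on the
  unipotent block and on \<open>U\<close>, and \<open>-1\<close> at \<open>z\<close>. The sum is rational, and it remains a character after
  division by the number of summands that coincide because they are conjugate in \<open>G\<close>. Since the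
  characters are trivial on the scalars of \<open>B\<close>, the number of these scalars survives as the power of 2 in
  the claim.

  If \<open>q = 1\<close>, then \<open>k = 4\<close> and \<open>p\<close> is 3 modulo 4, so that only the exponent 1 is claimed. In this case
  \<open>u\<close> is unipotent, \<open>P\<close> is \<open>SL\<^sub>2\<close>, and \<open>U\<close> is replaced by an element of order 4 with square \<open>-1\<close>.
\<close>

text \<open>Powers of 2 that come from fusion have to cancel, and this dictates the choice of q. Up
  to sign and normalisation, the values at \<open>u\<close> and \<open>u * z\<close> count the
  elements of \<open>G\<close> that conjugate them into \<open>B\<close>, so they involve the whole
  normaliser of the group generated by \<open>U\<close>. The centraliser supplies the 2^v that also
  divides the differences of permutation characters. The quotient, a group of exponents g with U Q =
  Q U^g, supplies a further 2^e, which is won back by dividing the sum of induced characters by 2^e.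
  For this, every involution of the quotient must move every nontrivial character of
  \<open>U\<close>. With q the odd part of p^(n/2) + 1, the order of p modulo q is exactly n, the
  exponents are powers of p modulo q, and the only involution among those is -1, which fixes no
  nonzero residue of an odd modulus. Moreover q is coprime to p - 1, which gives det U = 1 and keeps
  scalars from mixing with \<open>U\<close>. The additive characters are fused as well, a factor p -
  1, with the help of a centralising element of nonsquare determinant.\<close>

section \<open>Group actions and orbit counting\<close>

lemma (in group) even_order_involution:
  assumes "finite (carrier G)" "even (Coset.order G)"
  shows "\<exists>x\<in>carrier G. x \<noteq> \<one> \<and> x \<otimes> x = \<one>"
proof -
  obtain m where "Coset.order G = 2 ^ 1 * m"
    using assms(2) by auto
  then obtain H where H: "subgroup H G" "card H = 2"
    using sylow_thm[of 2 G 1 m] assms(1) group_axioms by auto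
  have one: "\<one> \<in> H"
    using H(1) by (rule subgroup.one_closed)
  then obtain x where x: "H = {\<one>, x}" "x \<noteq> \<one>"
    using H(2) by (auto simp: card_2_iff)
  have xG: "x \<in> carrier G"
    using H(1) x(1) subgroup.subset by blast
  have "x \<otimes> x \<in> H"
    using subgroup.m_closed[OF H(1), of x x] x(1) by simp
  moreover have "x \<otimes> x \<noteq> x"
    using x(2) xG by simp
  ultimately show ?thesis
    using x xG by auto
qed

text \<open>Elements of \<open>BijGroup E\<close> are extensional, hence the restriction of
  \<open>f g\<close> to \<open>E\<close>.\<close>

lemma (in group) group_actionI:
  assumes closed: "\<And>g x. g \<in> carrier G \<Longrightarrow> x \<in> E \<Longrightarrow> f g x \<in> E"
    and mult: "\<And>g h x. g \<in> carrier G \<Longrightarrow> h \<in> carrier G \<Longrightarrow> x \<in> E \<Longrightarrow> f (g \<otimes> h) x = f g (f h x)"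
    and one: "\<And>x. x \<in> E \<Longrightarrow> f \<one> x = x"
  shows "group_action G E (\<lambda>g. \<lambda>x\<in>E. f g x)"
proof -
  have bij: "(\<lambda>x\<in>E. f g x) \<in> Bij E" if g: "g \<in> carrier G" for g
  proof -
    have "bij_betw (f g) E E"
    proof (rule bij_betw_byWitness[where f' = "f (inv g)"])
      show "\<forall>x\<in>E. f (inv g) (f g x) = x" "\<forall>x\<in>E. f g (f (inv g) x) = x"
        using g one mult[symmetric] by auto
    qed (use g closed in auto)
    then show ?thesis
      by (simp add: Bij_def bij_betw_restrict_eq)
  qed
  have "(\<lambda>g. \<lambda>x\<in>E. f g x) \<in> hom G (BijGroup E)"
  proof (rule homI)
    fix g h assume g: "g \<in> carrier G" and h: "h \<in> carrier G"
    show "(\<lambda>x\<in>E. f (g \<otimes> h) x) = (\<lambda>x\<in>E. f g x) \<otimes>\<^bsub>BijGroup E\<^esub> (\<lambda>x\<in>E. f h x)"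
      using bij[OF g] bij[OF h] g h closed mult
      by (auto simp: BijGroup_def compose_def fun_eq_iff restrict_def)
  qed (use bij in \<open>simp add: BijGroup_def\<close>)
  then show ?thesis
    unfolding group_action_def
    by (intro group_hom.intro group_axioms group_BijGroup) (simp add: group_hom_axioms_def)
qed

text \<open>A stabiliser of even order would contain an involution, so all stabilisers have odd
  order and each orbit absorbs the full power of 2 in the group order. Only involutions have to act
  without fixed points, which suits a group with a single involution.\<close>

lemma (in group) two_power_dvd_card_orbit:
  assumes fin: "finite (carrier G)" "finite E" and v: "2 ^ v dvd Coset.order G"
    and closed: "\<And>g x. g \<in> carrier G \<Longrightarrow> x \<in> E \<Longrightarrow> f g x \<in> E"
    and mult: "\<And>g h x. g \<in> carrier G \<Longrightarrow> h \<in> carrier G \<Longrightarrow> x \<in> E \<Longrightarrow> f (g \<otimes> h) x = f g (f h x)"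
    and one: "\<And>x. x \<in> E \<Longrightarrow> f \<one> x = x"
    and free: "\<And>g x. g \<in> carrier G \<Longrightarrow> g \<noteq> \<one> \<Longrightarrow> g \<otimes> g = \<one> \<Longrightarrow> x \<in> E \<Longrightarrow> f g x \<noteq> x"
    and x: "x \<in> E"
  shows "2 ^ v dvd card {f g x |g. g \<in> carrier G}"
proof -
  define \<phi> where "\<phi> = (\<lambda>g. \<lambda>x\<in>E. f g x)"
  interpret A: group_action G E \<phi>
    unfolding \<phi>_def by (rule group_actionI) (use closed mult one in auto)
  have orb: "orbit G \<phi> x = {f g x |g. g \<in> carrier G}"
    using x by (auto simp: orbit_def \<phi>_def)
  have sub: "subgroup (stabilizer G \<phi> x) G"
    using A.stabilizer_subgroup[OF x] .
  interpret S: group "G\<lparr>carrier := stabilizer G \<phi> x\<rparr>"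
    using sub by (rule subgroup.subgroup_is_group) (rule group_axioms)
  have "odd (card (stabilizer G \<phi> x))"
  proof
    assume "even (card (stabilizer G \<phi> x))"
    then have "\<exists>g\<in>stabilizer G \<phi> x. g \<noteq> \<one> \<and> g \<otimes> g = \<one>"
      using S.even_order_involution sub fin(1)
      by (simp add: Coset.order_def finite_subset[OF subgroup.subset])
    then show False
      using free x by (auto simp: stabilizer_def \<phi>_def)
  qed
  moreover have "card (orbit G \<phi> x) * card (stabilizer G \<phi> x) = Coset.order G"
    by (rule A.orbit_stabilizer_theorem[OF x])
  ultimately have "2 ^ v dvd card (orbit G \<phi> x)"
    using v by (metis coprime_dvd_mult_left_iff coprime_left_2_iff_odd coprime_power_left_iff)
  then show ?thesis
    by (simp add: orb)
qed

text \<open>The weight is arbitrary because there are two uses: weight 1 counts points, and later a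
  sum of induced characters is regrouped by orbits of their indices.\<close>

lemma (in group) orbits_partition:
  assumes fin: "finite E"
    and closed: "\<And>g x. g \<in> carrier G \<Longrightarrow> x \<in> E \<Longrightarrow> f g x \<in> E"
    and mult: "\<And>g h x. g \<in> carrier G \<Longrightarrow> h \<in> carrier G \<Longrightarrow> x \<in> E \<Longrightarrow> f (g \<otimes> h) x = f g (f h x)"
    and one: "\<And>x. x \<in> E \<Longrightarrow> f \<one> x = x"
  shows "sum w E = (\<Sum>C\<in>(\<lambda>x. {f g x |g. g \<in> carrier G}) ` E. sum w C)"
proof -
  define \<phi> where "\<phi> = (\<lambda>g. \<lambda>x\<in>E. f g x)"
  interpret A: group_action G E \<phi>
    unfolding \<phi>_def by (rule group_actionI) (use closed mult one in auto)
  have "orbit G \<phi> x = {f g x |g. g \<in> carrier G}" if "x \<in> E" for x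
    using that by (auto simp: orbit_def \<phi>_def)
  then have orbs: "orbits G E \<phi> = (\<lambda>x. {f g x |g. g \<in> carrier G}) ` E"
    by (auto simp: orbits_def image_def) 
  have part: "partition E (orbits G E \<phi>)"
    by (rule A.orbit_partition)
  then have U: "\<Union>(orbits G E \<phi>) = E" and disj: "\<And>A B. A \<in> orbits G E \<phi> \<Longrightarrow> B \<in> orbits G E \<phi> \<Longrightarrow> A \<noteq> B \<Longrightarrow> A \<inter> B = {}"
    by (auto simp: partition_def)
  have "sum w (\<Union>(orbits G E \<phi>)) = (\<Sum>C\<in>orbits G E \<phi>. sum w C)"
  proof -
    have "\<forall>A\<in>orbits G E \<phi>. finite A"
      using U fin by (auto intro: finite_subset)
    then show ?thesis
      using disj sum.Union_disjoint[of "orbits G E \<phi>" w] by simp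
  qed
  then show ?thesis
    unfolding U unfolding orbs .
qed

lemma (in group) two_power_dvd_card_free:
  assumes fin: "finite (carrier G)" "finite E" and v: "2 ^ v dvd Coset.order G"
    and closed: "\<And>g x. g \<in> carrier G \<Longrightarrow> x \<in> E \<Longrightarrow> f g x \<in> E"
    and mult: "\<And>g h x. g \<in> carrier G \<Longrightarrow> h \<in> carrier G \<Longrightarrow> x \<in> E \<Longrightarrow> f (g \<otimes> h) x = f g (f h x)"
    and one: "\<And>x. x \<in> E \<Longrightarrow> f \<one> x = x"
    and free: "\<And>g x. g \<in> carrier G \<Longrightarrow> g \<noteq> \<one> \<Longrightarrow> g \<otimes> g = \<one> \<Longrightarrow> x \<in> E \<Longrightarrow> f g x \<noteq> x"
  shows "2 ^ v dvd card E"
proof -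
  have "card E = (\<Sum>x\<in>E. 1)"
    by simp
  also have "\<dots> = (\<Sum>C\<in>(\<lambda>x. {f g x |g. g \<in> carrier G}) ` E. \<Sum>x\<in>C. 1)"
    by (rule orbits_partition) (use fin closed mult one in auto)
  also have "\<dots> = (\<Sum>C\<in>(\<lambda>x. {f g x |g. g \<in> carrier G}) ` E. card C)"
    by simp
  also have "2 ^ v dvd \<dots>"
  proof (rule dvd_sum)
    fix C assume "C \<in> (\<lambda>x. {f g x |g. g \<in> carrier G}) ` E"
    then obtain x where x: "x \<in> E" and C: "C = {f g x |g. g \<in> carrier G}"
      by blast
    show "2 ^ v dvd card C"
      unfolding C by (rule two_power_dvd_card_orbit[OF fin v closed mult one free x])
  qed
  finally show ?thesis .
qed

section \<open>Characters\<close>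

lemma carrier_GL: "carrier (GL n) = {A \<in> carrier_mat n n. \<exists>B\<in>carrier_mat n n. A * B = 1\<^sub>m n \<and> B * A = 1\<^sub>m n}"
  by (auto simp: GL_def units_of_def Units_def ring_mat_def)

lemma mult_GL [simp]: "A \<otimes>\<^bsub>GL n\<^esub> B = A * B"
  by (simp add: GL_def units_of_def ring_mat_def)

lemma one_GL [simp]: "\<one>\<^bsub>GL n\<^esub> = 1\<^sub>m n"
  by (simp add: GL_def units_of_def ring_mat_def)

lemma group_GL: "group (GL n :: 'a :: comm_ring_1 mat monoid)"
proof -
  interpret R: ring "ring_mat TYPE('a) n ()"
    by (rule ring_mat)
  show ?thesis
    unfolding GL_def by (rule R.units_group)
qed

lemma (in group) hom_GLI:
  assumes "\<And>g. g \<in> carrier G \<Longrightarrow> \<rho> g \<in> carrier_mat n n"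
    and "\<And>g h. g \<in> carrier G \<Longrightarrow> h \<in> carrier G \<Longrightarrow> \<rho> (g \<otimes> h) = \<rho> g * \<rho> h"
    and "\<rho> \<one> = 1\<^sub>m n"
  shows "\<rho> \<in> hom G (GL n)"
proof (rule homI)
  fix g assume g: "g \<in> carrier G"
  then have "\<rho> g * \<rho> (inv g) = 1\<^sub>m n" "\<rho> (inv g) * \<rho> g = 1\<^sub>m n"
    using assms(2)[of g "inv g"] assms(2)[of "inv g" g] assms(3) by auto
  then show "\<rho> g \<in> carrier (GL n)"
    using g assms(1) by (auto simp: carrier_GL)
qed (use assms in auto)

text \<open>Coset representations and induced representations have at most one nonzero entry in each
  column. The sum in a matrix product then collapses to the index \<open>k\<close> of that entry,
  and multiplicativity becomes a condition on entries.\<close>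

lemma (in group) hom_monomial:
  assumes closed: "\<And>g. g \<in> carrier G \<Longrightarrow> \<rho> g \<in> carrier_mat n n"
    and e: "\<And>g i j. g \<in> carrier G \<Longrightarrow> i < n \<Longrightarrow> j < n \<Longrightarrow> \<rho> g $$ (i, j) = e g i j"
    and one: "\<And>i j. i < n \<Longrightarrow> j < n \<Longrightarrow> e \<one> i j = (if i = j then 1 else 0)"
    and ex: "\<And>h j. h \<in> carrier G \<Longrightarrow> j < n \<Longrightarrow> \<exists>k<n. (\<forall>l<n. l \<noteq> k \<longrightarrow> e h l j = 0) \<and>
               (\<forall>g\<in>carrier G. \<forall>i<n. e (g \<otimes> h) i j = e g i k * e h k j)"
  shows "\<rho> \<in> hom G (GL n)"
proof (rule hom_GLI)
  fix g h assume gh: "g \<in> carrier G" "h \<in> carrier G"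
  show "\<rho> (g \<otimes> h) = \<rho> g * \<rho> h"
  proof (rule eq_matI)
    fix i j assume "i < dim_row (\<rho> g * \<rho> h)" "j < dim_col (\<rho> g * \<rho> h)"
    then have ij: "i < n" "j < n"
      using closed gh by (auto simp: carrier_matD[OF closed[OF gh(1)]] carrier_matD[OF closed[OF gh(2)]])
    obtain k where k: "k < n" "\<And>l. l < n \<Longrightarrow> l \<noteq> k \<Longrightarrow> e h l j = 0"
      "e (g \<otimes> h) i j = e g i k * e h k j"
      using ex[OF gh(2) ij(2)] gh(1) ij(1) by blast
    have "(\<rho> g * \<rho> h) $$ (i, j) = (\<Sum>l<n. e g i l * e h l j)"
      using gh ij closed[OF gh(1)] closed[OF gh(2)]
      by (auto simp: scalar_prod_def e lessThan_atLeast0 intro!: sum.cong)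
    also have "\<dots> = (\<Sum>l\<in>{k}. e g i l * e h l j)"
      using k(1,2) by (intro sum.mono_neutral_right) auto
    finally show "\<rho> (g \<otimes> h) $$ (i, j) = (\<rho> g * \<rho> h) $$ (i, j)"
      using e[of "g \<otimes> h" i j] gh ij k(3) by simp
  qed (use closed gh in \<open>auto simp: carrier_matD[OF closed]\<close>)
next
  show "\<rho> \<one> = 1\<^sub>m n"
    using closed[of \<one>] one e by (intro eq_matI) auto
qed (rule closed)

lemma (in group) lcos_lcosets:
  assumes "subgroup H G" "g \<in> carrier G" "c \<in> lcosets H"
  shows "g <# c \<in> lcosets H"
proof -
  obtain a where a: "a \<in> carrier G" "c = a <# H"
    using assms(3) by (auto simp: LCOSETS_def)
  then show ?thesis
    using assms lcos_m_assoc[OF subgroup.subset[OF assms(1)], of g a] by (auto simp: LCOSETS_def)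
qed

lemma (in group) lcosets_subset:
  assumes "subgroup H G" "c \<in> lcosets H"
  shows "c \<subseteq> carrier G"
  using subgroup.lcosets_carrier[OF assms(1) group_axioms assms(2)] .

lemma (in group) lcos_action:
  assumes "subgroup H G" "g \<in> carrier G" "h \<in> carrier G" "c \<in> lcosets H"
  shows "(g \<otimes> h) <# c = g <# (h <# c)"
  using lcos_m_assoc[OF lcosets_subset[OF assms(1,4)] assms(2,3)] by simp

lemma (in group) lcos_one:
  assumes "subgroup H G" "c \<in> lcosets H"
  shows "\<one> <# c = c"
  using lcos_mult_one[OF lcosets_subset[OF assms]] .

lemma (in group) coset_rep_hom:
  assumes H: "subgroup H G" and cs: "distinct cs" "set cs = lcosets H"
  shows "coset_rep G cs \<in> hom G (GL (length cs))"
proof (rule hom_monomial)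
  let ?e = "\<lambda>g i j. if cs ! i = g <# (cs ! j) then 1 else (0::complex)"
  fix g i j assume "g \<in> carrier G" "i < length cs" "j < length cs"
  then show "coset_rep G cs g $$ (i, j) = ?e g i j"
    by (simp add: coset_rep_def)
next
  have mem: "cs ! i \<in> lcosets H" if "i < length cs" for i
    using that cs(2) by (metis nth_mem)
  show "(if cs ! i = \<one> <# cs ! j then 1 else 0) = (if i = j then 1 else (0::complex))"
    if "i < length cs" "j < length cs" for i j
    using that lcos_one[OF H mem] cs(1) by (simp add: nth_eq_iff_index_eq)
  fix h j assume h: "h \<in> carrier G" and j: "j < length cs"
  have "h <# cs ! j \<in> set cs"
    using lcos_lcosets[OF H h mem[OF j]] cs(2) by simp
  then obtain k where k: "k < length cs" "cs ! k = h <# cs ! j"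
    by (auto simp: in_set_conv_nth)
  show "\<exists>k<length cs. (\<forall>l<length cs. l \<noteq> k \<longrightarrow> (if cs ! l = h <# cs ! j then 1 else (0::complex)) = 0) \<and>
      (\<forall>g\<in>carrier G. \<forall>i<length cs. (if cs ! i = g \<otimes> h <# cs ! j then 1 else (0::complex)) =
        (if cs ! i = g <# cs ! k then 1 else 0) * (if cs ! k = h <# cs ! j then 1 else 0))"
    using k cs(1) lcos_action[OF H _ h mem[OF j]] nth_eq_iff_index_eq[OF cs(1)]
    by (intro exI[of _ k]) (auto, metis)
qed (simp add: coset_rep_def)

lemma (in group) coset_rep_character:
  assumes "distinct cs" "set cs = lcosets H" "g \<in> carrier G"
  shows "character G (coset_rep G cs) g = of_nat (card {c \<in> lcosets H. g <# c = c})"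
proof -
  have "mat_trace (coset_rep G cs g) = (\<Sum>i<length cs. if cs ! i = g <# cs ! i then 1 else 0)"
    by (simp add: mat_trace_def coset_rep_def)
  also have "\<dots> = (\<Sum>c\<in>set cs. if c = g <# c then 1 else 0)"
    by (rule sum.reindex_bij_betw[OF bij_betw_nth]) (use assms in auto)
  also have "\<dots> = of_nat (card {c \<in> set cs. c = g <# c})"
    by (simp add: sum.If_cases Int_def)
  also have "{c \<in> set cs. c = g <# c} = {c \<in> lcosets H. g <# c = c}"
    using assms(2) by auto
  finally show ?thesis
    using assms(3) by (simp add: character_def)
qed

lemma character_in_characters: "\<rho> \<in> hom G (GL n) \<Longrightarrow> character G \<rho> \<in> characters G"
  by (auto simp: characters_def)

section \<open>Virtual characters as an additive group of functions\<close>

lemma carrier_fun_group [simp]: "carrier fun_group = UNIV"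
  and mult_fun_group [simp]: "f \<otimes>\<^bsub>fun_group\<^esub> g = (\<lambda>x. f x + g x)"
  and one_fun_group [simp]: "\<one>\<^bsub>fun_group\<^esub> = (\<lambda>x. 0)"
  by (simp_all add: fun_group_def)

lemma comm_group_fun_group: "comm_group fun_group"
  by (rule comm_groupI) (auto simp: fun_eq_iff add_ac intro!: exI[of _ "\<lambda>x. - f x" for f])

lemma inv_fun_group [simp]: "inv\<^bsub>fun_group\<^esub> f = (\<lambda>x. - f x)"
proof -
  interpret comm_group fun_group by (rule comm_group_fun_group)
  show ?thesis
    by (rule inv_equality) auto
qed

lemma subgroup_fun_group_iff:
  "subgroup S fun_group \<longleftrightarrow> (\<lambda>x. 0) \<in> S \<and> (\<forall>f\<in>S. \<forall>g\<in>S. (\<lambda>x. f x + g x) \<in> S) \<and> (\<forall>f\<in>S. (\<lambda>x. - f x) \<in> S)"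
  by (auto simp: subgroup_def)

lemma subgroup_generate_fun_group: "subgroup (generate fun_group S) fun_group"
proof -
  interpret comm_group fun_group by (rule comm_group_fun_group)
  show ?thesis by (rule generate_is_subgroup) simp
qed

lemma subgroup_sum_mem:
  assumes "subgroup S fun_group" "\<And>i. i \<in> I \<Longrightarrow> f i \<in> S"
  shows "(\<lambda>x. \<Sum>i\<in>I. f i x) \<in> S"
  using assms(2) by (induction I rule: infinite_finite_induct) (use assms(1) in \<open>auto simp: subgroup_fun_group_iff\<close>)

lemma subgroup_of_nat_mult_mem:
  assumes "subgroup S fun_group" "f \<in> S"
  shows "(\<lambda>x. of_nat n * f x) \<in> S"
  using subgroup_sum_mem[OF assms(1), of "{..<n}" "\<lambda>_. f"] assms(2) by simp

lemma subgroup_Char_Q: "subgroup (Char_Q G) fun_group"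
  using subgroup_generate_fun_group[of "characters G"]
  by (auto simp: subgroup_fun_group_iff Char_Q_def)

lemma (in group) perm_characters_subset_Char_Q:
  "perm_characters G \<subseteq> Char_Q G"
proof
  fix \<chi> assume "\<chi> \<in> perm_characters G"
  then obtain H cs where *: "subgroup H G" "distinct cs" "set cs = lcosets H" "\<chi> = character G (coset_rep G cs)"
    by (auto simp: perm_characters_def)
  then show "\<chi> \<in> Char_Q G"
    using character_in_characters[OF coset_rep_hom[OF *(1-3)]] coset_rep_character[OF *(2,3)]
    by (auto simp: Char_Q_def intro: generate.incl)
qed

lemma (in group) Perm_subset_Char_Q: "Perm G \<subseteq> Char_Q G"
proof -
  interpret F: comm_group fun_group by (rule comm_group_fun_group)
  show ?thesis
    unfolding Perm_def
    by (rule F.generate_subgroup_incl[OF perm_characters_subset_Char_Q subgroup_Char_Q])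
qed

lemma fun_group_pow: "f [^]\<^bsub>fun_group\<lparr>carrier := S\<rparr>\<^esub> (n::nat) = (\<lambda>x. of_nat n * f x)"
  by (induction n) (auto simp: nat_pow_def fun_eq_iff algebra_simps)

text \<open>The exponent is tested on one class: if \<open>N\<close> is the order of the class of
  \<open>\<chi>\<close>, then \<open>N\<close> times \<open>\<chi>\<close> lies in
  \<open>Perm G\<close>, and \<open>N\<close> divides the exponent.\<close>

lemma (in group) dvd_group_exponent_C_hat:
  assumes \<chi>: "\<chi> \<in> Char_Q G"
    and dvd: "\<And>N. (\<lambda>x. of_nat N * \<chi> x) \<in> Perm G \<Longrightarrow> d dvd N"
  shows "d dvd group_exponent (C_hat G)"
proof -
  define C where "C = fun_group\<lparr>carrier := Char_Q G\<rparr>"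
  interpret F: comm_group fun_group by (rule comm_group_fun_group)
  have C: "comm_group C"
    unfolding C_def
    by (rule group.group_comm_groupI[OF subgroup.subgroup_is_group[OF subgroup_Char_Q F.group_axioms]])
       (simp add: add.commute)
  interpret C: comm_group C by (rule C)
  have "subgroup (Perm G) C"
    unfolding C_def
    by (rule F.subgroup_incl[OF _ subgroup_Char_Q Perm_subset_Char_Q])
       (unfold Perm_def, rule subgroup_generate_fun_group)
  then have N: "Perm G \<lhd> C"
    by (rule C.subgroup_imp_normal)
  interpret N: normal "Perm G" C by (rule N)
  interpret Q: group "C_hat G"
    unfolding C_hat_def C_def[symmetric] by (rule N.factorgroup_is_group)
  have \<chi>C: "\<chi> \<in> carrier C"
    using \<chi> by (simp add: C_def)
  define y where "y = Perm G #>\<^bsub>C\<^esub> \<chi>"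
  have y: "y \<in> carrier (C_hat G)"
    using \<chi>C by (simp add: y_def C_hat_def C_def[symmetric] carrier_FactGroup)
  define N where "N = Q.ord y"
  have "y [^]\<^bsub>C_hat G\<^esub> N = \<one>\<^bsub>C_hat G\<^esub>"
    unfolding N_def by (rule Q.pow_ord_eq_1[OF y])
  then have "Perm G #>\<^bsub>C\<^esub> (\<chi> [^]\<^bsub>C\<^esub> N) = Perm G"
    using N.FactGroup_pow[OF \<chi>C, of N] by (simp add: y_def C_hat_def C_def[symmetric])
  then have "\<chi> [^]\<^bsub>C\<^esub> N \<in> Perm G"
    using C.rcos_self[of "\<chi> [^]\<^bsub>C\<^esub> N" "Perm G"] \<chi>C N.subgroup_axioms by auto
  then have "d dvd N"
    by (intro dvd) (simp add: C_def fun_group_pow)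
  also have "N dvd group_exponent (C_hat G)"
    unfolding N_def group_exponent_def using y by (intro dvd_Lcm) auto
  finally show ?thesis .
qed

text \<open>\<open>P\<close> acts through the homomorphism \<open>\<tau>\<close>, so that the
  argument carries over to a quotient of \<open>SL\<close> by composition, without realising
  \<open>P\<close> as a subgroup there.\<close>

lemma (in group) Perm_difference_dvd:
  assumes fin: "finite (carrier G)"
    and P: "group P" "finite (carrier P)" "2 ^ v dvd Coset.order P"
    and \<tau>: "\<tau> \<in> hom P G" and zP: "zP \<in> carrier P" and z: "\<tau> zP = z"
    and inv_P: "\<And>g. g \<in> carrier P \<Longrightarrow> g \<otimes>\<^bsub>P\<^esub> g = \<one>\<^bsub>P\<^esub> \<Longrightarrow> g = \<one>\<^bsub>P\<^esub> \<or> g = zP"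
    and central: "\<And>g. g \<in> carrier P \<Longrightarrow> g \<otimes>\<^bsub>P\<^esub> zP = zP \<otimes>\<^bsub>P\<^esub> g" "zP \<otimes>\<^bsub>P\<^esub> zP = \<one>\<^bsub>P\<^esub>"
    and u: "u \<in> carrier G" "u \<otimes> z = z \<otimes> u" "odd l" "u [^] (l::nat) = \<one>"
    and norm: "\<And>g. g \<in> carrier P \<Longrightarrow> \<exists>i::nat. u \<otimes> \<tau> g = \<tau> g \<otimes> u [^] i"
    and \<psi>: "\<psi> \<in> Perm G"
  shows "\<exists>c::int. \<psi> u - \<psi> (u \<otimes> z) = of_int (2 ^ v * c)"
proof -
  interpret P: group P by fact
  interpret \<tau>: group_hom P G \<tau> by unfold_locales (rule \<tau>)
  have zG: "z \<in> carrier G" using zP z by auto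
  have zz: "z \<otimes> z = \<one>" using central(2) zP z by (metis \<tau>.hom_mult \<tau>.hom_one)
  have generators: "\<exists>c::int. \<psi> u - \<psi> (u \<otimes> z) = of_int (2 ^ v * c)" if mem: "\<psi> \<in> perm_characters G" for \<psi>
  proof -
    obtain H cs where H: "subgroup H G" and cs: "distinct cs" "set cs = lcosets H"
      and \<psi>: "\<psi> = character G (coset_rep G cs)"
      using mem unfolding perm_characters_def by blast
    define S0 where "S0 = lcosets H"
    have finS0: "finite S0" using cs(2) unfolding S0_def by (metis finite_set)
    have act: "g <# c \<in> S0" "(g \<otimes> h) <# c = g <# (h <# c)" "\<one> <# c = c"
      if "c \<in> S0" "g \<in> carrier G" "h \<in> carrier G" for g h c
      using that H unfolding S0_def by (simp_all add: lcos_lcosets lcos_action lcos_one)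
    have pow: "g [^] (i::nat) <# c = c" if "c \<in> S0" "g \<in> carrier G" "g <# c = c" for g c i
      by (induction i) (use that act in auto)
    \<comment> \<open>Since \<open>u\<close> has odd order dividing \<open>l\<close> and commutes
      with the involution \<open>z\<close>, the \<open>l\<close>-th power of \<open>u z\<close> is
      \<open>z\<close>. Whatever \<open>u z\<close> fixes is therefore fixed by \<open>z\<close>,
      and then by \<open>u\<close>.\<close>
    have uz: "(u \<otimes> z) <# c = c \<longleftrightarrow> u <# c = c \<and> z <# c = c" if c: "c \<in> S0" for c
    proof
      assume *: "(u \<otimes> z) <# c = c"
      have "(u \<otimes> z) [^] l = u [^] l \<otimes> z [^] l"
        using u zG by (simp add: pow_mult_distrib)
      also have "z [^] l = z"
      proof -
        obtain m where m: "l = 2 * m + 1"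
          using u(3) by (rule oddE)
        have "z [^] (2 * m) = (z [^] (2::nat)) [^] m"
          using zG by (simp add: nat_pow_pow)
        also have "z [^] (2::nat) = \<one>"
          using zz zG by (simp add: numeral_2_eq_2)
        finally show ?thesis
          using zG by (simp add: m)
      qed
      finally have "z <# c = c"
        using pow[OF c _ *, of l] u zG by simp
      then show "u <# c = c \<and> z <# c = c"
        using * act(2)[OF c u(1) zG] by simp
    qed (use act(2)[OF c u(1) zG] in simp)
    \<comment> \<open>\<open>P\<close> preserves this set: it normalises the group generated by
      \<open>u\<close> and commutes with \<open>z\<close>. The only involution of \<open>P\<close>
      maps to \<open>z\<close>, which moves every point of the set.\<close>
    define Y where "Y = {c \<in> S0. u <# c = c \<and> z <# c \<noteq> c}"
    have "2 ^ v dvd card Y"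
    proof (rule P.two_power_dvd_card_free[where f = "\<lambda>g c. \<tau> g <# c"])
      fix g c assume g: "g \<in> carrier P" and c: "c \<in> Y"
      have cX: "c \<in> S0" using c by (simp add: Y_def)
      obtain i :: nat where i: "u \<otimes> \<tau> g = \<tau> g \<otimes> u [^] i"
        using norm g by blast
      have "u <# (\<tau> g <# c) = \<tau> g <# (u [^] i <# c)"
        using act(2)[OF cX] i u(1) g by (metis \<tau>.hom_closed nat_pow_closed)
      then have 1: "u <# (\<tau> g <# c) = \<tau> g <# c"
        using pow[OF cX u(1)] c by (simp add: Y_def)
      have "z <# (\<tau> g <# c) = \<tau> g <# (z <# c)"
        using act(2)[OF cX] central(1)[OF g] zP z g by (metis \<tau>.hom_closed \<tau>.hom_mult)
      moreover have "\<tau> g <# (z <# c) \<noteq> \<tau> g <# c"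
      proof
        assume "\<tau> g <# (z <# c) = \<tau> g <# c"
        then have "inv (\<tau> g) <# (\<tau> g <# (z <# c)) = inv (\<tau> g) <# (\<tau> g <# c)" by simp
        then have "z <# c = c"
          using act(2)[of _ "inv (\<tau> g)" "\<tau> g", symmetric] act(1,3) cX zG g by simp
        then show False using c by (simp add: Y_def)
      qed
      ultimately show "\<tau> g <# c \<in> Y"
        using 1 act(1)[OF cX, of "\<tau> g" "\<tau> g"] g by (simp add: Y_def)
    next
      fix g c assume "g \<in> carrier P" "g \<noteq> \<one>\<^bsub>P\<^esub>" "g \<otimes>\<^bsub>P\<^esub> g = \<one>\<^bsub>P\<^esub>" "c \<in> Y"
      then show "\<tau> g <# c \<noteq> c"
        using inv_P[of g] z by (auto simp: Y_def)
    qed (use P finS0 act(2,3) in \<open>simp_all add: Y_def, blast?\<close>)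
    then obtain c where c: "card Y = 2 ^ v * c" ..
    have "card {c \<in> S0. u <# c = c} = card ({c \<in> S0. (u \<otimes> z) <# c = c} \<union> Y)"
      by (rule arg_cong[of _ _ card]) (use uz in \<open>auto simp: Y_def\<close>)
    also have "\<dots> = card {c \<in> S0. (u \<otimes> z) <# c = c} + card Y"
      by (rule card_Un_disjoint) (use uz finS0 in \<open>auto simp: Y_def\<close>)
    finally have "\<psi> u - \<psi> (u \<otimes> z) = of_nat (card Y)"
      using coset_rep_character[OF cs] u(1) zG unfolding \<psi> S0_def by simp
    then show ?thesis
      using c by (intro exI[of _ "int c"]) simp
  qed
  \<comment> \<open>The divisibility survives sums and negatives, so it passes from the coset
    characters to their integral span.\<close>
  define S :: "('a \<Rightarrow> complex) set" where "S = {\<psi>. \<exists>c::int. \<psi> u - \<psi> (u \<otimes> z) = of_int (2 ^ v * c)}"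
  have "subgroup S fun_group"
    unfolding subgroup_fun_group_iff
  proof (intro conjI ballI)
    fix f g assume "f \<in> S"
      "g \<in> S"
    then obtain c d :: int where "f u - f (u \<otimes> z) = of_int (2 ^ v * c)" "g u - g (u \<otimes> z) = of_int (2 ^ v * d)"
      by (auto simp: S_def)
    then have "f u + g u - (f (u \<otimes> z) + g (u \<otimes> z)) = of_int (2 ^ v * (c + d))"
      by (simp add: algebra_simps)
    then show "(\<lambda>x. f x + g x) \<in> S"
      unfolding S_def by blast
  next
    fix f assume "f \<in> S"
    then obtain c :: int where "f u - f (u \<otimes> z) = of_int (2 ^ v * c)"
      by (auto simp: S_def)
    then have "- f u - - f (u \<otimes> z) = of_int (2 ^ v * - c)"
      by (simp add: algebra_simps) 
    then show "(\<lambda>x. - f x) \<in> S"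
      unfolding S_def by blast
  qed (auto simp: S_def intro: exI[of _ 0])
  interpret F: comm_group fun_group by (rule comm_group_fun_group)
  have "Perm G \<subseteq> S"
    unfolding Perm_def
    by (rule F.generate_subgroup_incl[OF _ \<open>subgroup S fun_group\<close>]) (use generators in \<open>auto simp: S_def\<close>)
  then show ?thesis
    using \<psi> by (auto simp: S_def)
qed

section \<open>Induced characters, their fusion and their descent to quotients\<close>

text \<open>The monomial matrices of the induced representation on representatives
  \<open>r i\<close> of the left cosets. Extending \<open>\<theta>\<close> by 0 outside
  \<open>B\<close> gives one formula for all entries. Multiplying the trace by \<open>card B\<close>
  replaces the sum over representatives by a sum over \<open>G\<close>. The set \<open>N\<close>,
  stable under conjugation, acts trivially, which is what a descent to a quotient requires.\<close>

lemma (in group) induced_rep: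
  fixes \<theta> :: "'a \<Rightarrow> complex"
  assumes fin: "finite (carrier G)" and B: "subgroup B G"
    and supp: "\<And>x. x \<in> carrier G \<Longrightarrow> x \<notin> B \<Longrightarrow> \<theta> x = 0"
    and mult: "\<And>x y. x \<in> B \<Longrightarrow> y \<in> B \<Longrightarrow> \<theta> (x \<otimes> y) = \<theta> x * \<theta> y"
    and one: "\<theta> \<one> = 1"
    and N: "N \<subseteq> B" "\<And>x. x \<in> N \<Longrightarrow> \<theta> x = 1"
      "\<And>x g. x \<in> N \<Longrightarrow> g \<in> carrier G \<Longrightarrow> inv g \<otimes> x \<otimes> g \<in> N"
  obtains \<rho> n where "\<rho> \<in> hom G (GL n)"
    "\<And>g. g \<in> carrier G \<Longrightarrow> of_nat (card B) * mat_trace (\<rho> g) = (\<Sum>h\<in>carrier G. \<theta> (inv h \<otimes> g \<otimes> h))"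
    "\<And>g. g \<in> N \<Longrightarrow> \<rho> g = 1\<^sub>m n"
proof -
  have BG: "B \<subseteq> carrier G" using B by (rule subgroup.subset)
  have finB: "finite B" using BG fin by (rule finite_subset)
  have one_B: "\<one> \<in> B" using B by (rule subgroup.one_closed)
  have Bm: "x \<otimes> y \<in> B" if "x \<in> B" "y \<in> B" for x y
    using B that by (rule subgroup.m_closed)
  have Bi: "inv x \<in> B" if "x \<in> B" for x
    using B that by (rule subgroup.m_inv_closed)
  \<comment> \<open>If \<open>x\<close> lies outside \<open>B\<close>, then so does
    \<open>x y\<close>, and both sides vanish.\<close>
  have mult': "\<theta> (x \<otimes> y) = \<theta> x * \<theta> y" if x: "x \<in> carrier G" and y: "y \<in> B" for x y
  proof (cases "x \<in> B")
    case False
    have "x \<otimes> y \<notin> B"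
    proof
      assume "x \<otimes> y \<in> B"
      then have "x \<otimes> y \<otimes> inv y \<in> B" using Bm Bi y by blast
      moreover have "x \<otimes> y \<otimes> inv y = x" using x y BG by (simp add: m_assoc subset_iff)
      ultimately show False using False by simp
    qed
    then show ?thesis using supp x y False BG by auto
  qed (use mult y in auto)
  have conj: "\<theta> (inv b \<otimes> x \<otimes> b) = \<theta> x" if x: "x \<in> carrier G" and b: "b \<in> B" for x b
  proof (cases "x \<in> B")
    case True
    have "\<theta> (inv b \<otimes> x \<otimes> b) = \<theta> (inv b) * \<theta> x * \<theta> b"
      using True b Bi Bm mult by simp
    also have "\<dots> = \<theta> x * (\<theta> (inv b) * \<theta> b)" by simp
    also have "\<theta> (inv b) * \<theta> b = 1"
      using mult[of "inv b" b] Bi b one BG by (simp add: subset_iff)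
    finally show ?thesis by simp
  next
    case False
    have "inv b \<otimes> x \<otimes> b \<notin> B"
    proof
      assume "inv b \<otimes> x \<otimes> b \<in> B"
      then have "b \<otimes> (inv b \<otimes> x \<otimes> b) \<otimes> inv b \<in> B" using Bm Bi b by blast
      moreover have "b \<otimes> (inv b \<otimes> x \<otimes> b) \<otimes> inv b = x"
        using x b BG by (simp add: m_assoc subset_iff) (simp add: m_assoc[symmetric] subset_iff)
      ultimately show False using False by simp
    qed
    then show ?thesis using supp x b False BG by auto
  qed
  have "finite (lcosets B)"
    using fin lcosets_subset_PowG[OF B] by (meson finite_Pow_iff finite_subset)
  then obtain cs where cs: "distinct cs" "set cs = lcosets B"
    using finite_distinct_list by blast
  define n where "n = length cs"
  define r where "r = (\<lambda>i. SOME x. x \<in> cs ! i)"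
  have r: "r i \<in> carrier G" "r i <# B = cs ! i" if i: "i < n" for i
  proof -
    have "cs ! i \<in> lcosets B" using i cs(2) unfolding n_def by (metis nth_mem)
    then obtain a where a: "a \<in> carrier G" "cs ! i = a <# B" by (auto simp: LCOSETS_def)
    then have "a \<in> cs ! i" using lcos_self[OF a(1) B] by simp
    then have ri: "r i \<in> cs ! i" unfolding r_def by (rule someI)
    show "r i \<in> carrier G"
      using ri a l_coset_carrier[of "r i" a B] B by simp
    show "r i <# B = cs ! i"
      using l_repr_independence[of "r i" a B] ri a B by simp
  qed
  have inB: "inv (r i) \<otimes> r j \<in> B \<longleftrightarrow> i = j" if "i < n" "j < n" for i j
  proof
    assume *: "inv (r i) \<otimes> r j \<in> B"
    have "r j = r i \<otimes> (inv (r i) \<otimes> r j)"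
      using r(1) that by (simp add: m_assoc[symmetric])
    then have "r j \<in> r i <# B" using * by (auto simp: l_coset_def)
    then have "cs ! i = cs ! j"
      using l_repr_independence[of "r j" "r i" B] r that B by simp
    then show "i = j" using cs(1) that unfolding n_def by (simp add: nth_eq_iff_index_eq)
  qed (use r(1) that one_B in simp)
  have ex: "\<exists>k<n. inv (r k) \<otimes> x \<in> B" if x: "x \<in> carrier G" for x
  proof -
    have "x <# B \<in> set cs" using x cs(2) by (auto simp: LCOSETS_def)
    then obtain k where k: "k < n" "cs ! k = x <# B" unfolding n_def by (auto simp: in_set_conv_nth)
    then have "x \<in> r k <# B" using r(2) lcos_self[OF x B] by simp
    then show ?thesis using k subgroup.lcos_module_imp[OF B group_axioms] r(1) x by blast
  qed
  have uniq: "i = k" if i: "i < n" "k < n" and x: "x \<in> carrier G" "inv (r k) \<otimes> x \<in> B" "inv (r i) \<otimes> x \<in> B" for i k x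
  proof -
    have "inv (r i) \<otimes> x \<otimes> inv (inv (r k) \<otimes> x) \<in> B" using Bm[OF x(3) Bi[OF x(2)]] .
    also have "inv (r i) \<otimes> x \<otimes> inv (inv (r k) \<otimes> x) = inv (r i) \<otimes> r k"
      using r(1) i x(1) by (simp add: inv_mult_group m_assoc) (simp add: m_assoc[symmetric])
    finally show ?thesis using inB i by blast
  qed
  define \<rho> where "\<rho> = (\<lambda>g. mat n n (\<lambda>(i, j). \<theta> (inv (r i) \<otimes> g \<otimes> r j)))"
  have "\<rho> \<in> hom G (GL n)"
  proof (rule hom_monomial[where e = "\<lambda>g i j. \<theta> (inv (r i) \<otimes> g \<otimes> r j)"])
    fix i j assume ij: "i < n" "j < n"
    show "\<theta> (inv (r i) \<otimes> \<one> \<otimes> r j) = (if i = j then 1 else 0)"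
      using inB[OF ij] supp[of "inv (r i) \<otimes> r j"] r(1) ij one by auto
  next
    fix h j assume h: "h \<in> carrier G" and j: "j < n"
    have hG: "h \<otimes> r j \<in> carrier G" using h r(1)[OF j] by simp
    \<comment> \<open>\<open>k\<close> names the coset containing \<open>h r_j\<close>; it is the
      only row where column \<open>j\<close> can be nonzero.\<close>
    obtain k where k: "k < n" "inv (r k) \<otimes> (h \<otimes> r j) \<in> B" using ex[OF hG] by blast
    show "\<exists>k<n. (\<forall>l<n. l \<noteq> k \<longrightarrow> \<theta> (inv (r l) \<otimes> h \<otimes> r j) = 0) \<and>
        (\<forall>g\<in>carrier G. \<forall>i<n. \<theta> (inv (r i) \<otimes> (g \<otimes> h) \<otimes> r j) =
           \<theta> (inv (r i) \<otimes> g \<otimes> r k) * \<theta> (inv (r k) \<otimes> h \<otimes> r j))"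
    proof (intro exI[of _ k] conjI k(1) allI impI ballI)
      fix l assume l: "l < n" "l \<noteq> k"
      then have "inv (r l) \<otimes> (h \<otimes> r j) \<notin> B" using uniq[OF l(1) k(1) hG k(2)] by blast
      then show "\<theta> (inv (r l) \<otimes> h \<otimes> r j) = 0"
        using supp r(1) l j h by (simp add: m_assoc)
    next
      fix g i assume g: "g \<in> carrier G" and i: "i < n"
      have "inv (r i) \<otimes> (g \<otimes> h) \<otimes> r j = (inv (r i) \<otimes> g \<otimes> r k) \<otimes> (inv (r k) \<otimes> (h \<otimes> r j))"
      proof -
        have "r k \<otimes> (inv (r k) \<otimes> (h \<otimes> r j)) = h \<otimes> r j"
          using r(1) k(1) hG by (simp add: m_assoc[symmetric])
        then show ?thesis using r(1) g h i j k(1) by (simp add: m_assoc)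
      qed
      moreover have "inv (r k) \<otimes> (h \<otimes> r j) = inv (r k) \<otimes> h \<otimes> r j"
        using r(1) k(1) j h by (simp add: m_assoc)
      moreover have "inv (r i) \<otimes> g \<otimes> r k \<in> carrier G"
        using r(1) i k(1) g by simp
      ultimately show "\<theta> (inv (r i) \<otimes> (g \<otimes> h) \<otimes> r j) = \<theta> (inv (r i) \<otimes> g \<otimes> r k) * \<theta> (inv (r k) \<otimes> h \<otimes> r j)"
        using mult'[of "inv (r i) \<otimes> g \<otimes> r k" "inv (r k) \<otimes> (h \<otimes> r j)"] k(2) by metis
    qed
  qed (simp_all add: \<rho>_def)
  moreover have "of_nat (card B) * mat_trace (\<rho> g) = (\<Sum>h\<in>carrier G. \<theta> (inv h \<otimes> g \<otimes> h))" if g: "g \<in> carrier G" for g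
  proof -
    \<comment> \<open>Every element of \<open>G\<close> is \<open>r i\<close> times an element of
      \<open>B\<close> in a unique way. Conjugating by the second factor does not change
      \<open>\<theta>\<close>, so each diagonal entry occurs \<open>card B\<close> times.\<close>
    have bij: "bij_betw (\<lambda>(i, b). r i \<otimes> b) ({..<n} \<times> B) (carrier G)"
    proof (rule bij_betwI')
      fix x y assume "x \<in> {..<n} \<times> B" "y \<in> {..<n} \<times> B"
      then obtain i b j c where *: "x = (i, b)" "y = (j, c)" "i < n" "j < n" "b \<in> B" "c \<in> B" by auto
      show "((case x of (i, b) \<Rightarrow> r i \<otimes> b) = (case y of (i, b) \<Rightarrow> r i \<otimes> b)) = (x = y)"
      proof
        assume "(case x of (i, b) \<Rightarrow> r i \<otimes> b) = (case y of (i, b) \<Rightarrow> r i \<otimes> b)"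
        then have eq: "r i \<otimes> b = r j \<otimes> c" using * by simp
        have cancel: "inv (r k) \<otimes> (r k \<otimes> d) = d" if "k < n" "d \<in> B" for k d
          using r(1)[OF that(1)] that(2) BG by (simp add: m_assoc[symmetric] subset_iff)
        have "r i \<otimes> b \<in> carrier G" using r(1) * BG by blast
        moreover have "inv (r j) \<otimes> (r i \<otimes> b) \<in> B" using cancel[of j c] * eq by simp
        moreover have "inv (r i) \<otimes> (r i \<otimes> b) \<in> B" using cancel[of i b] * by simp
        ultimately have "i = j" using uniq * by blast
        moreover have "b = c" using eq cancel[of i b] cancel[of j c] * \<open>i = j\<close> by metis
        ultimately show "x = y" using * by simp
      qed simp
    next
      fix x assume "x \<in> {..<n} \<times> B"
      then show "(case x of (i, b) \<Rightarrow> r i \<otimes> b) \<in> carrier G" using r(1) BG by auto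
    next
      fix y assume y: "y \<in> carrier G"
      obtain k where k: "k < n" "inv (r k) \<otimes> y \<in> B" using ex[OF y] by blast
      have "y = r k \<otimes> (inv (r k) \<otimes> y)" using r(1) k(1) y by (simp add: m_assoc[symmetric])
      then show "\<exists>x\<in>{..<n} \<times> B. y = (case x of (i, b) \<Rightarrow> r i \<otimes> b)"
        using k by (intro bexI[of _ "(k, inv (r k) \<otimes> y)"]) auto
    qed
    have "(\<Sum>h\<in>carrier G. \<theta> (inv h \<otimes> g \<otimes> h)) = (\<Sum>(i, b)\<in>{..<n} \<times> B. \<theta> (inv (r i \<otimes> b) \<otimes> g \<otimes> (r i \<otimes> b)))"
      by (subst sum.reindex_bij_betw[OF bij, symmetric]) (simp add: case_prod_unfold)
    also have "\<dots> = (\<Sum>(i, b)\<in>{..<n} \<times> B. \<theta> (inv (r i) \<otimes> g \<otimes> r i))"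
    proof -
      have "\<theta> (inv (r i \<otimes> b) \<otimes> g \<otimes> (r i \<otimes> b)) = \<theta> (inv (r i) \<otimes> g \<otimes> r i)"
        if ib: "i < n" "b \<in> B" for i b
      proof -
        have "inv (r i \<otimes> b) \<otimes> g \<otimes> (r i \<otimes> b) = inv b \<otimes> (inv (r i) \<otimes> g \<otimes> r i) \<otimes> b"
          using r(1) ib BG g by (simp add: inv_mult_group m_assoc subset_iff)
        then show ?thesis
          using conj[of "inv (r i) \<otimes> g \<otimes> r i" b] r(1) g ib by simp
      qed
      then show ?thesis by (intro sum.cong) auto
    qed
    also have "\<dots> = of_nat (card B) * (\<Sum>i<n. \<theta> (inv (r i) \<otimes> g \<otimes> r i))"
      by (simp add: sum.cartesian_product[symmetric] sum_distrib_left)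
    also have "(\<Sum>i<n. \<theta> (inv (r i) \<otimes> g \<otimes> r i)) = mat_trace (\<rho> g)"
      by (simp add: mat_trace_def \<rho>_def)
    finally show ?thesis by simp
  qed
  moreover have "\<rho> g = 1\<^sub>m n" if g: "g \<in> N" for g
  proof (rule eq_matI)
    fix i j assume "i < dim_row (1\<^sub>m n)" "j < dim_col (1\<^sub>m n)"
    then have ij: "i < n" "j < n" by auto
    have gG: "g \<in> carrier G" using g N(1) BG by blast
    have "inv (r i) \<otimes> g \<otimes> r j = (inv (r i) \<otimes> g \<otimes> r i) \<otimes> (inv (r i) \<otimes> r j)"
    proof -
      have "r i \<otimes> (inv (r i) \<otimes> r j) = r j" using r(1) ij by (simp add: m_assoc[symmetric])
      then show ?thesis using r(1) ij gG by (simp add: m_assoc)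
    qed
    moreover have m: "inv (r i) \<otimes> g \<otimes> r i \<in> N" using N(3) g r(1) ij by simp
    moreover have "inv (r i) \<otimes> g \<otimes> r i \<otimes> (inv (r i) \<otimes> r j) \<notin> B" if "i \<noteq> j"
    proof
      assume *: "inv (r i) \<otimes> g \<otimes> r i \<otimes> (inv (r i) \<otimes> r j) \<in> B"
      let ?m = "inv (r i) \<otimes> g \<otimes> r i"
      have "inv ?m \<otimes> (?m \<otimes> (inv (r i) \<otimes> r j)) \<in> B"
        using Bm Bi * m N(1) by blast
      then have "inv (r i) \<otimes> r j \<in> B"
        using r(1) ij gG by (subst (asm) m_assoc[symmetric]) auto
      then show False using inB ij that by simp
    qed
    ultimately show "\<rho> g $$ (i, j) = 1\<^sub>m n $$ (i, j)"
      using ij N(2)[OF m] supp[of "inv (r i) \<otimes> g \<otimes> r i \<otimes> (inv (r i) \<otimes> r j)"] r(1) gG inB[OF ij]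
      by (cases "i = j") (simp_all add: \<rho>_def)
  qed (simp_all add: \<rho>_def)
  ultimately show ?thesis by (rule that)
qed

text \<open>Two preimages of one element differ by an element of the kernel, so
  \<open>\<rho>\<close> may be evaluated at a chosen preimage.\<close>

lemma (in group_hom) hom_descend:
  assumes surj: "h ` carrier G = carrier H" and \<rho>: "\<rho> \<in> hom G K" and K: "group K"
    and ker: "\<And>x. x \<in> kernel G H h \<Longrightarrow> \<rho> x = \<one>\<^bsub>K\<^esub>"
  obtains \<sigma> where "\<sigma> \<in> hom H K" "\<And>g. g \<in> carrier G \<Longrightarrow> \<sigma> (h g) = \<rho> g"
proof -
  interpret K: group K by (rule K)
  interpret \<rho>: group_hom G K \<rho> by unfold_locales (rule \<rho>)
  define s where "s = (\<lambda>y. SOME x. x \<in> carrier G \<and> h x = y)"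
  have s: "s y \<in> carrier G" "h (s y) = y" if "y \<in> carrier H" for y
  proof -
    have "y \<in> h ` carrier G" using that by (simp only: surj)
    then have "\<exists>x. x \<in> carrier G \<and> h x = y" by blast
    then have "s y \<in> carrier G \<and> h (s y) = y" unfolding s_def by (rule someI_ex)
    then show "s y \<in> carrier G" "h (s y) = y" by auto
  qed
  have eq: "\<rho> x = \<rho> y" if "x \<in> carrier G" "y \<in> carrier G" "h x = h y" for x y
  proof -
    have "inv x \<otimes> y \<in> kernel G H h"
      using that by (simp add: kernel_def)
    then have "\<rho> (inv x \<otimes> y) = \<one>\<^bsub>K\<^esub>" by (rule ker)
    then have "inv\<^bsub>K\<^esub> (\<rho> x) \<otimes>\<^bsub>K\<^esub> \<rho> y = \<one>\<^bsub>K\<^esub>"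
      using that by simp
    then show ?thesis
      using K.inv_equality[of "inv\<^bsub>K\<^esub> (\<rho> x)" "\<rho> y"] K.inv_comm that
      by (metis K.inv_closed K.inv_equality K.inv_inv \<rho>.hom_closed)
  qed
  show ?thesis
  proof (rule that[of "\<lambda>y. \<rho> (s y)"])
    show "(\<lambda>y. \<rho> (s y)) \<in> hom H K"
    proof (rule homI)
      fix x y assume xy: "x \<in> carrier H" "y \<in> carrier H"
      have "\<rho> (s (x \<otimes>\<^bsub>H\<^esub> y)) = \<rho> (s x \<otimes> s y)"
        by (rule eq) (use xy s in auto)
      then show "\<rho> (s (x \<otimes>\<^bsub>H\<^esub> y)) = \<rho> (s x) \<otimes>\<^bsub>K\<^esub> \<rho> (s y)" using xy s by simp
    qed (use s in auto)
  next
    fix g assume "g \<in> carrier G"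
    then show "\<rho> (s (h g)) = \<rho> g"
      using eq[of "s (h g)" g] s[of "h g"] by simp
  qed
qed

text \<open>Inducing in \<open>G\<close> but landing in a quotient \<open>H\<close> treats
  \<open>SL\<close> (with the identity map) and \<open>PSL\<close> (with the projection) at the same
  time.\<close>

lemma (in group_hom) induced_character:
  fixes \<theta> :: "'a \<Rightarrow> complex"
  assumes surj: "h ` carrier G = carrier H"
    and fin: "finite (carrier G)" and B: "subgroup B G"
    and supp: "\<And>x. x \<in> carrier G \<Longrightarrow> x \<notin> B \<Longrightarrow> \<theta> x = 0"
    and mult: "\<And>x y. x \<in> B \<Longrightarrow> y \<in> B \<Longrightarrow> \<theta> (x \<otimes> y) = \<theta> x * \<theta> y"
    and ker: "kernel G H h \<subseteq> B" "\<And>x. x \<in> kernel G H h \<Longrightarrow> \<theta> x = 1"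
  shows "\<exists>\<psi>\<in>characters H. \<forall>g\<in>carrier G.
    of_nat (card B) * \<psi> (h g) = (\<Sum>x\<in>carrier G. \<theta> (inv x \<otimes> g \<otimes> x))"
proof -
  have ker_conj: "inv g \<otimes> x \<otimes> g \<in> kernel G H h" if "x \<in> kernel G H h" "g \<in> carrier G" for x g
    using that by (simp add: kernel_def)
  have "\<one> \<in> kernel G H h" by (simp add: kernel_def)
  then have one: "\<theta> \<one> = 1" by (rule ker(2))
  obtain \<rho> n where \<rho>: "\<rho> \<in> hom G (GL n)"
    "\<And>g. g \<in> carrier G \<Longrightarrow> of_nat (card B) * mat_trace (\<rho> g) = (\<Sum>h\<in>carrier G. \<theta> (inv h \<otimes> g \<otimes> h))"
    "\<And>g. g \<in> kernel G H h \<Longrightarrow> \<rho> g = 1\<^sub>m n"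
    using G.induced_rep[OF fin B supp mult one ker ker_conj] by blast
  obtain \<sigma> where \<sigma>: "\<sigma> \<in> hom H (GL n)" "\<And>g. g \<in> carrier G \<Longrightarrow> \<sigma> (h g) = \<rho> g"
    using hom_descend[OF surj \<rho>(1) group_GL] \<rho>(3) by auto
  show ?thesis
    by (rule bexI[OF _ character_in_characters[OF \<sigma>(1)]])
       (simp add: character_def \<sigma>(2) \<rho>(2))
qed

text \<open>The characters indexed by a class \<open>C\<close> all induce the same character, so the
  class contributes that character \<open>card C\<close> times. If \<open>d\<close> divides every
  class size, the total divided by \<open>d\<close> is still a virtual character. This division
  makes the 2-adic valuation of its values small.\<close>

lemma (in group_hom) rational_induced_combination:
  fixes \<theta> :: "'i \<Rightarrow> 'a \<Rightarrow> complex" and d :: nat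
  defines "S \<equiv> \<lambda>j g. \<Sum>x\<in>carrier G. \<theta> j (inv x \<otimes> g \<otimes> x)"
  assumes surj: "h ` carrier G = carrier H"
    and fin: "finite (carrier G)" and B: "subgroup B G"
    and supp: "\<And>j x. j \<in> J \<Longrightarrow> x \<in> carrier G \<Longrightarrow> x \<notin> B \<Longrightarrow> \<theta> j x = 0"
    and mult: "\<And>j x y. j \<in> J \<Longrightarrow> x \<in> B \<Longrightarrow> y \<in> B \<Longrightarrow> \<theta> j (x \<otimes> y) = \<theta> j x * \<theta> j y"
    and ker: "kernel G H h \<subseteq> B" "\<And>j x. j \<in> J \<Longrightarrow> x \<in> kernel G H h \<Longrightarrow> \<theta> j x = 1"
    and C: "\<And>C. C \<in> \<C> \<Longrightarrow> C \<subseteq> J \<and> C \<noteq> {} \<and> d dvd card C"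
    and const: "\<And>C i j g. C \<in> \<C> \<Longrightarrow> i \<in> C \<Longrightarrow> j \<in> C \<Longrightarrow> g \<in> carrier G \<Longrightarrow> S i g = S j g"
    and rat: "\<And>g. g \<in> carrier G \<Longrightarrow> (\<Sum>C\<in>\<C>. \<Sum>j\<in>C. S j g) \<in> \<rat>"
    and d: "d > 0"
  shows "\<exists>\<chi>\<in>Char_Q H. \<forall>g\<in>carrier G. of_nat (d * card B) * \<chi> (h g) = (\<Sum>C\<in>\<C>. \<Sum>j\<in>C. S j g)"
proof -
  have "\<exists>\<psi>\<in>characters H. \<forall>g\<in>carrier G. of_nat (card B) * \<psi> (h g) = S j g" if "j \<in> J" for j
    unfolding S_def by (rule induced_character[OF surj fin B]) (use that supp mult ker in auto)
  then obtain \<psi> where \<psi>: "\<And>j. j \<in> J \<Longrightarrow> \<psi> j \<in> characters H"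
    "\<And>j g. j \<in> J \<Longrightarrow> g \<in> carrier G \<Longrightarrow> of_nat (card B) * \<psi> j (h g) = S j g"
    by metis
  define r where "r = (\<lambda>C. SOME j::'i. j \<in> C)"
  have r: "r C \<in> C" if "C \<in> \<C>" for C
    using C[OF that] unfolding r_def by (auto intro: someI)
  \<comment> \<open>One representative per class, with the multiplicity that is left after division
    by \<open>d\<close>.\<close>
  define \<chi> where "\<chi> = (\<lambda>x. \<Sum>C\<in>\<C>. of_nat (card C div d) * \<psi> (r C) x)"
  have B0: "card B \<noteq> 0"
    using B fin by (metis card_eq_0_iff empty_iff finite_subset subgroup.one_closed subgroup.subset)
  have gen: "\<chi> \<in> generate fun_group (characters H)"
    unfolding \<chi>_def
  proof (rule subgroup_sum_mem[OF subgroup_generate_fun_group], rule subgroup_of_nat_mult_mem[OF subgroup_generate_fun_group])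
    fix C assume "C \<in> \<C>"
    then show "\<psi> (r C) \<in> generate fun_group (characters H)"
      using C r \<psi>(1) by (intro generate.incl) blast
  qed
  have eq: "of_nat (d * card B) * \<chi> (h g) = (\<Sum>C\<in>\<C>. \<Sum>j\<in>C. S j g)" if g: "g \<in> carrier G" for g
  proof -
    have "of_nat (d * card B) * \<chi> (h g) = (\<Sum>C\<in>\<C>. of_nat (card C div d * d) * (of_nat (card B) * \<psi> (r C) (h g)))"
      by (simp add: \<chi>_def sum_distrib_left mult_ac)
    also have "\<dots> = (\<Sum>C\<in>\<C>. \<Sum>j\<in>C. S j g)"
    proof (rule sum.cong[OF refl])
      fix C assume CC: "C \<in> \<C>"
      have "(\<Sum>j\<in>C. S j g) = (\<Sum>j\<in>C. S (r C) g)"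
        by (rule sum.cong[OF refl]) (use const[OF CC _ r[OF CC] g] in auto)
      also have "\<dots> = of_nat (card C) * S (r C) g" by simp
      also have "card C = card C div d * d" using C[OF CC] by simp
      finally show "of_nat (card C div d * d) * (of_nat (card B) * \<psi> (r C) (h g)) = (\<Sum>j\<in>C. S j g)"
        using \<psi>(2)[OF _ g, of "r C"] C[OF CC] r[OF CC] by (metis subsetD)
    qed
    finally show ?thesis .
  qed
  have "\<chi> y \<in> \<rat>" if y: "y \<in> carrier H" for y
  proof -
    obtain g where g: "g \<in> carrier G" "y = h g" using y surj by blast
    have "\<chi> (h g) = (\<Sum>C\<in>\<C>. \<Sum>j\<in>C. S j g) / of_nat (d * card B)"
      using eq[OF g(1)] B0 d by (simp add: field_simps)
    then show ?thesis using rat[OF g(1)] g(2) by simp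
  qed
  then have "\<chi> \<in> Char_Q H" using gen by (simp add: Char_Q_def)
  then show ?thesis using eq by blast
qed

text \<open>Right translation by \<open>g0\<close> permutes the summation range; hence linear
  characters that are conjugate in \<open>G\<close> induce the same character.\<close>

lemma (in group) sum_conj_invariant:
  assumes g0: "g0 \<in> carrier G" and g: "g \<in> carrier G"
    and eq: "\<And>x. x \<in> carrier G \<Longrightarrow> \<theta>' x = \<theta> (inv g0 \<otimes> x \<otimes> g0)"
  shows "(\<Sum>x\<in>carrier G. \<theta>' (inv x \<otimes> g \<otimes> x)) = (\<Sum>x\<in>carrier G. \<theta> (inv x \<otimes> g \<otimes> x))"
proof -
  have "(\<Sum>x\<in>carrier G. \<theta>' (inv x \<otimes> g \<otimes> x)) = (\<Sum>x\<in>carrier G. \<theta> (inv (x \<otimes> g0) \<otimes> g \<otimes> (x \<otimes> g0)))"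
    by (rule sum.cong) (use g0 g in \<open>auto simp: eq inv_mult_group m_assoc\<close>)
  also have "\<dots> = (\<Sum>x\<in>carrier G. \<theta> (inv x \<otimes> g \<otimes> x))"
  proof (rule sum.reindex_bij_witness[where i = "\<lambda>x. x \<otimes> inv g0" and j = "\<lambda>x. x \<otimes> g0"])
  qed (use g0 in \<open>auto simp: m_assoc\<close>)
  finally show ?thesis .
qed

text \<open>Conjugation by \<open>g0\<close> maps the finite set \<open>B\<close> injectively into
  itself, hence onto itself. Elements outside \<open>B\<close> therefore stay outside, where both
  functions vanish.\<close>

lemma (in group) extend_conj:
  fixes \<theta> \<theta>' :: "'a \<Rightarrow> 'c::zero"
  assumes g0: "g0 \<in> carrier G" and B: "B \<subseteq> carrier G" "finite B"
    and supp: "\<And>x. x \<in> carrier G \<Longrightarrow> x \<notin> B \<Longrightarrow> \<theta> x = 0" "\<And>x. x \<in> carrier G \<Longrightarrow> x \<notin> B \<Longrightarrow> \<theta>' x = 0"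
    and conj: "\<And>x. x \<in> B \<Longrightarrow> inv g0 \<otimes> x \<otimes> g0 \<in> B \<and> \<theta>' x = \<theta> (inv g0 \<otimes> x \<otimes> g0)"
    and x: "x \<in> carrier G"
  shows "\<theta>' x = \<theta> (inv g0 \<otimes> x \<otimes> g0)"
proof (cases "x \<in> B")
  case False
  let ?c = "\<lambda>x. inv g0 \<otimes> x \<otimes> g0"
  have undo: "g0 \<otimes> ?c y \<otimes> inv g0 = y" if "y \<in> carrier G" for y
    using g0 that by (simp add: m_assoc) (simp add: m_assoc[symmetric])
  have "inj_on ?c B"
    using undo B(1) by (intro inj_on_inverseI[of _ "\<lambda>y. g0 \<otimes> y \<otimes> inv g0"]) blast
  then have "?c ` B = B"
    using conj B(2) by (intro endo_inj_surj) auto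
  have "?c x \<notin> B"
  proof
    assume "?c x \<in> B"
    then obtain y where "y \<in> B" "?c x = ?c y" using \<open>?c ` B = B\<close> by blast
    then have "x = y" using undo x B(1) by (metis subsetD)
    then show False using \<open>y \<in> B\<close> False by simp
  qed
  then show ?thesis using supp False x g0 by simp
qed (use conj in auto)

text \<open>The difference of the two values of \<open>\<chi>\<close> is \<open>b / a\<close>,
  recorded without division. The two cases of the theorem then only differ in the data and in the
  arithmetic of the last hypothesis.\<close>

lemma (in group_hom) two_power_dvd_exponent:
  fixes a :: nat and b :: int
  assumes surj: "h ` carrier G = carrier H" and fin: "finite (carrier G)"
    and P: "group P" "finite (carrier P)" "2 ^ v dvd Coset.order P"
    and \<tau>: "\<tau> \<in> hom P G" and zP: "zP \<in> carrier P" and z: "\<tau> zP = z"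
    and inv_P: "\<And>g. g \<in> carrier P \<Longrightarrow> g \<otimes>\<^bsub>P\<^esub> g = \<one>\<^bsub>P\<^esub> \<Longrightarrow> g = \<one>\<^bsub>P\<^esub> \<or> g = zP"
    and central: "\<And>g. g \<in> carrier P \<Longrightarrow> g \<otimes>\<^bsub>P\<^esub> zP = zP \<otimes>\<^bsub>P\<^esub> g" "zP \<otimes>\<^bsub>P\<^esub> zP = \<one>\<^bsub>P\<^esub>"
    and u: "u \<in> carrier G" "u \<otimes> z = z \<otimes> u" "odd l" "u [^] (l::nat) = \<one>"
    and norm: "\<And>g. g \<in> carrier P \<Longrightarrow> \<exists>i::nat. u \<otimes> \<tau> g = \<tau> g \<otimes> u [^] i"
    and \<chi>: "\<chi> \<in> Char_Q H"
    and eq: "of_nat a * (\<chi> (h u) - \<chi> (h (u \<otimes> z))) = of_int b"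
    and arith: "\<And>N c. int N * b = 2 ^ v * c * int a \<Longrightarrow> 2 ^ m dvd N"
  shows "2 ^ m dvd group_exponent (C_hat H)"
proof (rule H.dvd_group_exponent_C_hat[OF \<chi>])
  interpret P: group P by fact
  interpret \<tau>: group_hom P G \<tau> by unfold_locales (rule \<tau>)
  have zG: "z \<in> carrier G" using zP z by auto
  fix N assume N: "(\<lambda>x. of_nat N * \<chi> x) \<in> Perm H"
  have "\<exists>c::int. of_nat N * \<chi> (h u) - of_nat N * \<chi> (h u \<otimes>\<^bsub>H\<^esub> h z) = of_int (2 ^ v * c)"
  proof (rule H.Perm_difference_dvd[OF _ P _ zP _ inv_P central _ _ u(3) _ _ N])
    show "finite (carrier H)" using fin surj by (metis finite_imageI)
    show "(\<lambda>x. h (\<tau> x)) \<in> hom P H"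
      by (rule homI) auto
    show "h (\<tau> zP) = h z" using z by simp
    show "h u \<in> carrier H" using u by simp
    show "h u \<otimes>\<^bsub>H\<^esub> h z = h z \<otimes>\<^bsub>H\<^esub> h u" using u zG by (metis hom_mult)
    show "h u [^]\<^bsub>H\<^esub> l = \<one>\<^bsub>H\<^esub>" using u by (metis hom_nat_pow hom_one)
    show "\<exists>i::nat. h u \<otimes>\<^bsub>H\<^esub> h (\<tau> g) = h (\<tau> g) \<otimes>\<^bsub>H\<^esub> h u [^]\<^bsub>H\<^esub> i" if "g \<in> carrier P" for g
      using norm[OF that] u(1) that by (metis \<tau>.hom_closed hom_mult hom_nat_pow G.nat_pow_closed)
  qed
  then obtain c :: int where c: "of_nat N * (\<chi> (h u) - \<chi> (h (u \<otimes> z))) = of_int (2 ^ v * c)"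
    using u(1) zG by (auto simp: algebra_simps)
  have "(of_int (int N * b) :: complex) = of_nat N * (of_nat a * (\<chi> (h u) - \<chi> (h (u \<otimes> z))))"
    by (simp add: eq)
  also have "\<dots> = of_nat a * (of_nat N * (\<chi> (h u) - \<chi> (h (u \<otimes> z))))"
    by (simp add: mult_ac)
  also have "\<dots> = of_int (2 ^ v * c * int a)"
    by (simp add: c)
  finally have "int N * b = 2 ^ v * c * int a" by (simp only: of_int_eq_iff)
  then show "2 ^ m dvd N" by (rule arith)
qed

section \<open>Matrix groups and block diagonal matrices over a finite field\<close>

lemma finite_carrier_mat: "finite (carrier_mat n m :: 'a :: finite mat set)"
proof (rule finite_surj)
  show "finite (({..<n} \<times> {..<m}) \<rightarrow>\<^sub>E (UNIV :: 'a set))"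
    by (intro finite_PiE) auto
  show "carrier_mat n m \<subseteq> mat n m ` (({..<n} \<times> {..<m}) \<rightarrow>\<^sub>E (UNIV :: 'a set))"
  proof
    fix A :: "'a mat" assume "A \<in> carrier_mat n m"
    then have eq: "A = mat n m (restrict (\<lambda>ij. A $$ ij) ({..<n} \<times> {..<m}))"
      by (intro eq_matI) auto
    have "mat n m (restrict (\<lambda>ij. A $$ ij) ({..<n} \<times> {..<m})) \<in> mat n m ` (({..<n} \<times> {..<m}) \<rightarrow>\<^sub>E (UNIV :: 'a set))"
      by (rule imageI, simp only: restrict_PiE_iff, simp)
    then show "A \<in> mat n m ` (({..<n} \<times> {..<m}) \<rightarrow>\<^sub>E (UNIV :: 'a set))"
      by (simp only: eq[symmetric])
  qed
qed

lemma GL_iff: "A \<in> carrier (GL n) \<longleftrightarrow> A \<in> carrier_mat n n \<and> det (A :: 'a :: field mat) \<noteq> 0"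
proof
  assume *: "A \<in> carrier_mat n n \<and> det A \<noteq> 0"
  then have "A \<in> Units (ring_mat TYPE('a) n ())"
    by (intro det_non_zero_imp_unit) auto
  then show "A \<in> carrier (GL n)" by (simp add: GL_def units_of_def)
next
  assume "A \<in> carrier (GL n)"
  then have "A \<in> Units (ring_mat TYPE('a) n ())" by (simp add: GL_def units_of_def)
  then show "A \<in> carrier_mat n n \<and> det A \<noteq> 0"
    using unit_imp_det_non_zero by (auto simp: Units_def ring_mat_def)
qed

lemma SL_iff: "A \<in> carrier (SL n) \<longleftrightarrow> A \<in> carrier_mat n n \<and> det (A :: 'a :: field mat) = 1"
  by (auto simp: SL_def GL_iff)

lemma mult_SL [simp]: "A \<otimes>\<^bsub>SL n\<^esub> B = A * B"
  and one_SL [simp]: "\<one>\<^bsub>SL n\<^esub> = 1\<^sub>m n"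
  by (simp_all add: SL_def)

lemma det_pow_mat: "A \<in> carrier_mat n n \<Longrightarrow> det (A ^\<^sub>m i) = det (A :: 'a :: comm_ring_1 mat) ^ i"
  by (induction i) (auto simp: det_mult[of _ n] pow_carrier_mat mult.commute)

lemma pow_mat_add: "A \<in> carrier_mat n n \<Longrightarrow> (A :: 'a :: semiring_1 mat) ^\<^sub>m (i + j) = A ^\<^sub>m i * A ^\<^sub>m j"
  by (induction j) (auto simp: pow_carrier_mat assoc_mult_mat[of _ n n _ n _ n])

lemma pow_mat_mult: "A \<in> carrier_mat n n \<Longrightarrow> (A :: 'a :: semiring_1 mat) ^\<^sub>m (i * j) = (A ^\<^sub>m i) ^\<^sub>m j"
proof (induction j)
  case (Suc j)
  have "A ^\<^sub>m (i * Suc j) = A ^\<^sub>m (i * j + i)" by (simp add: add.commute)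
  then show ?case using Suc pow_mat_add[of A n "i * j" i] by simp
qed auto

lemma one_pow_mat [simp]: "(1\<^sub>m n :: 'a :: semiring_1 mat) ^\<^sub>m i = 1\<^sub>m n"
  by (induction i) auto

lemma pow_mat_intertwine:
  assumes "A \<in> carrier_mat n n" "B \<in> carrier_mat n n" "Q \<in> carrier_mat n n" "A * Q = Q * (B :: 'a :: semiring_1 mat)"
  shows "A ^\<^sub>m i * Q = Q * B ^\<^sub>m i"
proof (induction i)
  case (Suc i)
  have "A ^\<^sub>m i * A * Q = A ^\<^sub>m i * (Q * B)"
    using assms by (simp add: assoc_mult_mat[of _ n n _ n _ n] pow_carrier_mat)
  also have "\<dots> = (Q * B ^\<^sub>m i) * B"
    using assms Suc by (simp add: assoc_mult_mat[of _ n n _ n _ n, symmetric] pow_carrier_mat)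
  finally show ?case
    using assms by (simp add: assoc_mult_mat[of _ n n _ n _ n] pow_carrier_mat)
qed (use assms in auto)

lemma inverse_mat_obtain:
  assumes "A \<in> carrier_mat n n" "det (A :: 'a :: field mat) \<noteq> 0"
  obtains A' where "A' \<in> carrier_mat n n" "A * A' = 1\<^sub>m n" "A' * A = 1\<^sub>m n" "det A' = 1 / det A"
proof -
  have "A \<in> carrier (GL n)" using assms by (simp add: GL_iff)
  then obtain A' where A': "A' \<in> carrier_mat n n" "A * A' = 1\<^sub>m n" "A' * A = 1\<^sub>m n"
    by (auto simp: carrier_GL)
  have "det A * det A' = 1"
    using det_mult[OF assms(1) A'(1)] A'(2) by simp
  then have "det A' = 1 / det A" using assms(2) by (simp add: field_simps)
  then show ?thesis using A' that by blast
qed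

lemma group_SL: "group (SL n :: 'a :: field mat monoid)"
proof (rule groupI)
  fix A assume "A \<in> carrier (SL n :: 'a mat monoid)"
  then have A: "A \<in> carrier_mat n n" "det A = 1" by (auto simp: SL_iff)
  then show "\<one>\<^bsub>SL n\<^esub> \<otimes>\<^bsub>SL n\<^esub> A = A" by simp
  obtain A' where "A' \<in> carrier_mat n n" "A * A' = 1\<^sub>m n" "A' * A = 1\<^sub>m n" "det A' = 1 / det A"
    using inverse_mat_obtain A by (metis zero_neq_one)
  then show "\<exists>y\<in>carrier (SL n). y \<otimes>\<^bsub>SL n\<^esub> A = \<one>\<^bsub>SL n\<^esub>"
    using A by (auto simp: SL_iff)
next
  fix A B C assume "A \<in> carrier (SL n :: 'a mat monoid)" "B \<in> carrier (SL n :: 'a mat monoid)" "C \<in> carrier (SL n :: 'a mat monoid)"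
  then show "A \<otimes>\<^bsub>SL n\<^esub> B \<otimes>\<^bsub>SL n\<^esub> C = A \<otimes>\<^bsub>SL n\<^esub> (B \<otimes>\<^bsub>SL n\<^esub> C)"
    by (simp add: SL_iff assoc_mult_mat[of A n n B n C n])
next
  fix A B assume "A \<in> carrier (SL n :: 'a mat monoid)" "B \<in> carrier (SL n :: 'a mat monoid)"
  then show "A \<otimes>\<^bsub>SL n\<^esub> B \<in> carrier (SL n)"
    by (simp add: SL_iff det_mult[of A n B] mult_carrier_mat[of A n n B n])
next
  show "\<one>\<^bsub>SL n\<^esub> \<in> carrier (SL n :: 'a mat monoid)"
    unfolding SL_iff one_SL by simp
qed

lemma finite_SL: "finite (carrier (SL n :: 'a :: {finite, field} mat monoid))"
  by (rule finite_subset[of _ "carrier_mat n n"]) (use SL_iff in blast, rule finite_carrier_mat)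

lemma SL_pow: "A \<in> carrier (SL n) \<Longrightarrow> A [^]\<^bsub>SL n\<^esub> (i::nat) = (A :: 'a :: field mat) ^\<^sub>m i"
  by (induction i) (auto simp: SL_iff nat_pow_def)

definition bdiag :: "'a :: zero mat \<Rightarrow> 'a mat \<Rightarrow> 'a mat" where
  "bdiag P Q = four_block_mat P (0\<^sub>m (dim_row P) (dim_col Q)) (0\<^sub>m (dim_row Q) (dim_col P)) Q"

lemma bdiag_carrier [simp]:
  "P \<in> carrier_mat m m \<Longrightarrow> Q \<in> carrier_mat n n \<Longrightarrow> bdiag P Q \<in> carrier_mat (m + n) (m + n)"
  by (simp add: bdiag_def)

lemma bdiag_mult:
  assumes "P \<in> carrier_mat m m" "Q \<in> carrier_mat n n" "P' \<in> carrier_mat m m" "Q' \<in> carrier_mat n n"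
  shows "bdiag P Q * bdiag P' Q' = bdiag (P * P') (Q * (Q' :: 'a :: semiring_1 mat))"
  using assms unfolding bdiag_def
  by (subst mult_four_block_mat[where ?nr1.0 = m and ?n1.0 = m and ?n2.0 = n and ?nr2.0 = n and ?nc1.0 = m and ?nc2.0 = n])
     (auto intro!: cong_four_block_mat)

lemma bdiag_one: "bdiag (1\<^sub>m m) (1\<^sub>m n) = 1\<^sub>m (m + n)"
  by (simp add: bdiag_def)

lemma bdiag_det:
  assumes "P \<in> carrier_mat m m" "Q \<in> carrier_mat n n"
  shows "det (bdiag P Q) = det P * det (Q :: 'a :: idom mat)"
  using assms unfolding bdiag_def
  by (intro det_four_block_mat_lower_left_zero[of _ m _ n]) auto

lemma four_block_eq_iff:
  assumes "A \<in> carrier_mat m m" "B \<in> carrier_mat m n" "C \<in> carrier_mat n m" "D \<in> carrier_mat n n"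
    "A' \<in> carrier_mat m m" "B' \<in> carrier_mat m n" "C' \<in> carrier_mat n m" "D' \<in> carrier_mat n n"
  shows "four_block_mat A B C D = four_block_mat A' B' C' D' \<longleftrightarrow> A = A' \<and> B = B' \<and> C = C' \<and> D = D'"
proof
  assume eq: "four_block_mat A B C D = four_block_mat A' B' C' D'"
  have e: "four_block_mat A B C D $$ (i, j) = four_block_mat A' B' C' D' $$ (i, j)" for i j
    using eq by simp
  have "A $$ (i, j) = A' $$ (i, j)" if "i < m" "j < m" for i j
    using e[of i j] assms that by simp
  moreover have "B $$ (i, j) = B' $$ (i, j)" if "i < m" "j < n" for i j
    using e[of i "j + m"] assms that by simp
  moreover have "C $$ (i, j) = C' $$ (i, j)" if "i < n" "j < m" for i j
    using e[of "i + m" j] assms that by simp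
  moreover have "D $$ (i, j) = D' $$ (i, j)" if "i < n" "j < n" for i j
    using e[of "i + m" "j + m"] assms that by simp
  ultimately show "A = A' \<and> B = B' \<and> C = C' \<and> D = D'"
    using assms by (auto intro!: eq_matI)
qed auto

lemma bdiag_eq_iff:
  assumes "P \<in> carrier_mat m m" "Q \<in> carrier_mat n n" "P' \<in> carrier_mat m m" "Q' \<in> carrier_mat n n"
  shows "bdiag P Q = bdiag P' Q' \<longleftrightarrow> P = P' \<and> Q = Q'"
  using assms unfolding bdiag_def by (subst four_block_eq_iff[of _ m _ n]) auto

definition upper2 :: "'a \<Rightarrow> 'a \<Rightarrow> 'a \<Rightarrow> 'a :: zero mat" where
  "upper2 a b d = mat 2 2 (\<lambda>(i, j). if i = 0 then (if j = 0 then a else b) else (if j = 0 then 0 else d))"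

lemma upper2_carrier [simp]: "upper2 a b d \<in> carrier_mat 2 2"
  by (simp add: upper2_def)

lemma less_2_cases': "i < 2 \<longleftrightarrow> i = 0 \<or> i = (1::nat)"
  by auto

lemma mat2_eq_iff:
  assumes "A \<in> carrier_mat 2 2" "B \<in> carrier_mat 2 2"
  shows "A = B \<longleftrightarrow> A $$ (0,0) = B $$ (0,0) \<and> A $$ (0,1) = B $$ (0,1) \<and> A $$ (1,0) = B $$ (1,0) \<and> A $$ (1,1) = B $$ (1,1)"
proof
  assume "A $$ (0,0) = B $$ (0,0) \<and> A $$ (0,1) = B $$ (0,1) \<and> A $$ (1,0) = B $$ (1,0) \<and> A $$ (1,1) = B $$ (1,1)"
  then show "A = B"
    using assms by (intro eq_matI) (auto simp: less_2_cases')
qed auto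

lemma mat2_mult_index:
  assumes "A \<in> carrier_mat 2 2" "B \<in> carrier_mat 2 2" "i < 2" "j < 2"
  shows "(A * B) $$ (i, j) = A $$ (i, 0) * B $$ (0, j) + A $$ (i, 1) * (B :: 'a :: semiring_0 mat) $$ (1, j)"
  using assms by (simp add: scalar_prod_def numeral_2_eq_2)

lemma upper2_index [simp]:
  "upper2 a b d $$ (0, 0) = a" "upper2 a b d $$ (0, Suc 0) = b"
  "upper2 a b d $$ (Suc 0, 0) = 0" "upper2 a b d $$ (Suc 0, Suc 0) = d"
  by (simp_all add: upper2_def)

lemma upper2_mult: "upper2 a b d * upper2 a' b' d' = upper2 (a * a') (a * b' + b * d') (d * (d' :: 'a :: comm_ring_1))"
  by (subst mat2_eq_iff[OF mult_carrier_mat[OF upper2_carrier upper2_carrier] upper2_carrier])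
     (simp add: mat2_mult_index del: index_mult_mat)

lemma upper2_eq_iff: "upper2 a b d = upper2 a' b' d' \<longleftrightarrow> a = a' \<and> b = b' \<and> d = d'"
  by (subst mat2_eq_iff) auto

lemma upper2_one: "upper2 1 0 1 = 1\<^sub>m 2"
  by (subst mat2_eq_iff) auto

lemma det_upper2: "det (upper2 a b d) = a * (d :: 'a :: idom)"
proof -
  have "upper_triangular (upper2 a b d)" by (auto simp: upper_triangular_def upper2_def)
  then show ?thesis
    by (simp add: det_upper_triangular[OF _ upper2_carrier] diag_mat_def carrier_matD[OF upper2_carrier] numeral_2_eq_2)
qed

section \<open>Additive characters and squares of a prime field\<close>

text \<open>A fixed nontrivial character of the additive group of the prime field; the nontrivial
  ones used below are its composites with multiplication by a nonzero \<open>t\<close>.\<close>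

definition add_char :: "'p::prime_card mod_ring \<Rightarrow> complex" where
  "add_char x = cis (2 * pi * of_int (to_int_mod_ring x) / of_nat CARD('p))"

lemma add_char_of_int: "add_char (of_int i :: 'p::prime_card mod_ring) = cis (2 * pi * of_int i / of_nat CARD('p))"
proof -
  let ?p = "int CARD('p)"
  have p: "real CARD('p) \<noteq> 0" by simp
  have "to_int_mod_ring (of_int i :: 'p mod_ring) = i mod ?p"
    by (simp add: of_int_of_int_mod_ring of_int_mod_ring.rep_eq to_int_mod_ring.rep_eq)
  then have "add_char (of_int i :: 'p mod_ring) = cis (2 * pi * of_int (i mod ?p) / of_nat CARD('p))"
    by (simp add: add_char_def)
  also have "\<dots> = cis (2 * pi * of_int (i div ?p)) * cis (2 * pi * of_int (i mod ?p) / of_nat CARD('p))"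
    by (simp add: cis_multiple_2pi)
  also have "\<dots> = cis (2 * pi * of_int i / of_nat CARD('p))"
  proof -
    define a b P r where "a = real_of_int (i div ?p)" and "b = real_of_int (i mod ?p)" and "P = real CARD('p)" and "r = real_of_int i"
    have "r = P * a + b"
      unfolding a_def b_def P_def r_def by (metis mult_div_mod_eq of_int_add of_int_mult of_int_of_nat_eq)
    then have "2 * pi * a + 2 * pi * b / P = 2 * pi * r / P"
      using p by (simp add: P_def field_simps)
    then show ?thesis unfolding cis_mult a_def b_def P_def r_def by simp
  qed
  finally show ?thesis .
qed

lemma add_char_add: "add_char (x + y) = add_char x * add_char (y :: 'p::prime_card mod_ring)"
proof -
  have *: "z = of_int (to_int_mod_ring z)" for z :: "'p mod_ring"
    by (simp add: of_int_of_int_mod_ring)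
  have "add_char (of_int (to_int_mod_ring x) + of_int (to_int_mod_ring y) :: 'p mod_ring)
      = add_char (of_int (to_int_mod_ring x) :: 'p mod_ring) * add_char (of_int (to_int_mod_ring y) :: 'p mod_ring)"
    unfolding of_int_add[symmetric] add_char_of_int
    by (simp add: cis_mult field_simps)
  then show ?thesis unfolding *[symmetric] .
qed

lemma add_char_0 [simp]: "add_char 0 = 1"
  using add_char_of_int[of 0] by simp

lemma add_char_1: "add_char (1 :: 'p::prime_card mod_ring) \<noteq> 1"
proof
  assume "add_char (1 :: 'p mod_ring) = 1"
  then have "cis (2 * pi / CARD('p)) = 1"
    using add_char_of_int[of 1, where ?'p = 'p] by simp
  then have "cos (2 * pi / CARD('p)) = 1"
    by (simp add: complex_eq_iff)
  then obtain n :: int where n: "2 * pi / CARD('p) = real_of_int n * 2 * pi"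
    unfolding cos_one_2pi_int by blast
  then have "1 = real_of_int (n * int CARD('p))" by (simp add: field_simps)
  then have "n * int CARD('p) = 1" by (metis of_int_eq_1_iff)
  then have "int CARD('p) dvd 1" by (metis dvd_triv_right)
  then show False using prime_card[where ?'a = 'p] by simp
qed

text \<open>The sum over all \<open>t\<close> vanishes for nonzero \<open>b\<close>, since a shift
  by 1 multiplies it by a number other than 1; leaving out \<open>t = 0\<close> subtracts 1. The
  integral values are the source of rationality later.\<close>

lemma sum_add_char: "(\<Sum>t\<in>UNIV - {0}. add_char (t * b)) = (if b = 0 then of_nat (CARD('p) - 1) else - 1)"
  for b :: "'p::prime_card mod_ring"
proof (cases "b = 0")
  case False
  let ?S = "\<Sum>t\<in>(UNIV :: 'p mod_ring set). add_char t"
  have "?S = (\<Sum>t\<in>(UNIV :: 'p mod_ring set). add_char (t + 1))"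
    by (rule sum.reindex_bij_witness[of _ "\<lambda>t. t + 1" "\<lambda>t. t - 1"]) auto
  also have "\<dots> = ?S * add_char (1 :: 'p mod_ring)" by (simp add: add_char_add sum_distrib_right)
  finally have "?S * (1 - add_char (1 :: 'p mod_ring)) = 0" by (simp add: algebra_simps)
  then have S: "?S = 0" using add_char_1[where ?'p = 'p] by simp
  have "(\<Sum>t\<in>UNIV - {0}. add_char (t * b)) = (\<Sum>t\<in>UNIV - {0::'p mod_ring}. add_char t)"
    by (rule sum.reindex_bij_witness[of _ "\<lambda>t. t / b" "\<lambda>t. t * b"]) (use False in auto)
  also have "\<dots> = ?S - add_char (0 :: 'p mod_ring)" by (subst sum_diff1) auto
  finally show ?thesis using S False by simp
qed (simp add: card_Diff_singleton)

text \<open>Squaring is two-to-one on the nonzero elements, so the squares are half of them, and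
  multiplication by \<open>a\<close> carries the squares onto the other half.\<close>

lemma nonsquare_mult:
  fixes a b :: "'a :: {field, finite}"
  assumes two: "(2 :: 'a) \<noteq> 0" and a: "a \<noteq> 0" "\<not> (\<exists>x. a = x ^ 2)" and b: "b \<noteq> 0" "\<not> (\<exists>x. b = x ^ 2)"
  shows "\<exists>x. a * b = x ^ 2"
proof -
  let ?F = "UNIV - {0 :: 'a}"
  let ?Q = "(\<lambda>x. x ^ 2) ` ?F"
  have fib: "card {x \<in> ?F. x ^ 2 = y} = 2" if y: "y \<in> ?Q" for y
  proof -
    obtain x where x: "x \<noteq> 0" "y = x ^ 2" using y by auto
    have "{x \<in> ?F. x ^ 2 = y} = {x, - x}"
      using x by (auto simp: power2_eq_iff)
    moreover have "x \<noteq> - x"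
    proof
      assume "x = - x"
      then have "2 * x = 0" by (metis add.right_inverse mult_2)
      then show False using two x by simp
    qed
    ultimately show ?thesis by simp
  qed
  have "card ?F = (\<Sum>y\<in>?Q. card {x \<in> ?F. x ^ 2 = y})"
    using sum.image_gen[of ?F "\<lambda>_. 1::nat" "\<lambda>x. x ^ 2"] by simp
  also have "\<dots> = 2 * card ?Q" using fib by simp
  finally have F: "card ?F = 2 * card ?Q" .
  have disj: "?Q \<inter> (*) a ` ?Q = {}"
  proof (rule ccontr)
    assume "?Q \<inter> (*) a ` ?Q \<noteq> {}"
    then obtain x y where xy: "x \<noteq> 0" "y \<noteq> 0" "x ^ 2 = a * y ^ 2" by auto
    then have "a = (x / y) ^ 2" by (simp add: field_simps power2_eq_square)
    then show False using a by blast
  qed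
  have "card (?Q \<union> (*) a ` ?Q) = card ?Q + card ((*) a ` ?Q)"
    by (rule card_Un_disjoint) (use disj in auto)
  also have "card ((*) a ` ?Q) = card ?Q"
    by (rule card_image) (use a in \<open>auto intro: inj_onI\<close>)
  finally have "card (?Q \<union> (*) a ` ?Q) = card ?F" using F by simp
  then have "?Q \<union> (*) a ` ?Q = ?F"
    using a by (intro card_subset_eq) auto
  then have "b \<in> (*) a ` ?Q" using b by auto
  then obtain x where "b = a * x ^ 2" by auto
  then have "a * b = (a * x) ^ 2" by (simp add: power2_eq_square)
  then show ?thesis by blast
qed

lemma smult_smult_mat [simp]: "a \<cdot>\<^sub>m (b \<cdot>\<^sub>m A) = (a * b) \<cdot>\<^sub>m (A :: 'a :: comm_ring_1 mat)"
  by (intro eq_matI) (auto simp: mult_ac)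

lemma one_smult_mat [simp]: "1 \<cdot>\<^sub>m A = (A :: 'a :: comm_ring_1 mat)"
  by (intro eq_matI) auto

section \<open>The subgroup B, its linear characters and their conjugacy\<close>

text \<open>The common part of both cases: \<open>W\<close> has order exactly \<open>N\<close>. In
  the general case \<open>W\<close> is \<open>-U\<close> with \<open>N = 2 * q\<close>, in the
  exceptional case \<open>W\<close> has order 4.\<close>

locale torus_block =
  fixes n k N :: nat and W :: "'p::prime_card mod_ring mat"
  assumes n: "n > 0" and k: "k = n + 2" and N: "N > 0"
    and W: "W \<in> carrier_mat n n" "det W = 1" "W ^\<^sub>m N = 1\<^sub>m n"
    and W_inj: "\<And>i j. W ^\<^sub>m i = W ^\<^sub>m j \<Longrightarrow> i mod N = j mod N"
begin

abbreviation "G \<equiv> SL k :: 'p mod_ring mat monoid"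

sublocale G: group G by (rule group_SL)

lemma carrier_G: "A \<in> carrier G \<longleftrightarrow> A \<in> carrier_mat k k \<and> det A = 1"
  by (simp add: SL_iff)

lemma bdiag_k [simp]: "P \<in> carrier_mat 2 2 \<Longrightarrow> Q \<in> carrier_mat n n \<Longrightarrow> bdiag P Q \<in> carrier_mat k k"
  using bdiag_carrier[of P 2 Q n] unfolding k by (simp only: add.commute)

lemma inv_conj_iff:
  assumes "x \<in> carrier G" "g \<in> carrier G" "v \<in> carrier G"
  shows "inv\<^bsub>G\<^esub> x * g * x = v \<longleftrightarrow> g * x = x * v"
proof -
  have "inv\<^bsub>G\<^esub> x \<otimes>\<^bsub>G\<^esub> g \<otimes>\<^bsub>G\<^esub> x = v \<longleftrightarrow> g \<otimes>\<^bsub>G\<^esub> x = x \<otimes>\<^bsub>G\<^esub> v"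
    using assms G.inv_solve_left[of v x "g \<otimes>\<^bsub>G\<^esub> x"] by (auto simp: G.m_assoc simp del: mult_SL)
  then show ?thesis by simp
qed

text \<open>A scalar \<open>s\<close> times a unipotent block times a power of \<open>W\<close>. The
  corner entry is \<open>s * b\<close> rather than \<open>b\<close>, so that the parameter
  \<open>b\<close> is additive under multiplication, independently of \<open>s\<close>.\<close>

definition bel :: "'p mod_ring \<Rightarrow> 'p mod_ring \<Rightarrow> nat \<Rightarrow> 'p mod_ring mat" where
  "bel s b i = bdiag (upper2 s (s * b) s) (s \<cdot>\<^sub>m (W ^\<^sub>m i))"

lemma W_pow [simp]: "W ^\<^sub>m i \<in> carrier_mat n n"
  using W by simp

lemma smult_W_pow [simp]: "s \<cdot>\<^sub>m (W ^\<^sub>m i) \<in> carrier_mat n n"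
  by simp

lemma W_pow_mod: "W ^\<^sub>m (i mod N) = W ^\<^sub>m i"
proof -
  have "W ^\<^sub>m i = W ^\<^sub>m (N * (i div N) + i mod N)" by simp
  also have "\<dots> = (W ^\<^sub>m N) ^\<^sub>m (i div N) * W ^\<^sub>m (i mod N)"
    using W(1) by (simp only: pow_mat_add pow_mat_mult)
  also have "\<dots> = W ^\<^sub>m (i mod N)"
    using W by simp
  finally show ?thesis by simp
qed

lemma W_pow_eq_iff: "W ^\<^sub>m i = W ^\<^sub>m j \<longleftrightarrow> i mod N = j mod N"
  using W_inj W_pow_mod by metis

lemma bel_mod: "bel s b (i mod N) = bel s b i"
  by (simp add: bel_def W_pow_mod)

lemma bel_carrier_mat: "bel s b i \<in> carrier_mat k k"
  by (simp add: bel_def)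

lemma det_bel: "det (bel s b i) = s ^ k"
proof -
  have "det (bel s b i) = (s * s) * (s ^ n * det W ^ i)"
    using W(1) by (simp add: bel_def bdiag_det[of _ 2 _ n] det_upper2 det_pow_mat[of W n])
  then show ?thesis using W(2) by (simp add: k power_add power2_eq_square)
qed

lemma bel_carrier: "bel s b i \<in> carrier G \<longleftrightarrow> s ^ k = 1"
  by (simp add: carrier_G bel_carrier_mat det_bel)

lemma bel_mult: "bel s b i * bel s' b' i' = bel (s * s') (b + b') (i + i')"
  using W(1) by (simp add: bel_def bdiag_mult[of _ 2 _ n] upper2_mult pow_mat_add[of W n] mult_smult_assoc_mat[of _ n n _ n]
      mult_smult_distrib[of _ n n _ n] algebra_simps)

lemma bel_one: "bel 1 0 0 = 1\<^sub>m k"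
proof -
  have "bel 1 0 0 = bdiag (1\<^sub>m 2) (1\<^sub>m n)"
    using W(1) by (simp add: bel_def upper2_one)
  then show ?thesis by (simp only: bdiag_one k add.commute)
qed

lemma bel_pow: "bel s b i ^\<^sub>m j = bel (s ^ j) (of_nat j * b) (i * j)"
proof (induction j)
  case 0
  then show ?case using bel_carrier_mat[of s b i] by (simp add: bel_one)
next
  case (Suc j)
  then show ?case by (simp add: bel_mult algebra_simps)
qed

lemma bel_eq_iff:
  assumes "s \<noteq> 0"
  shows "bel s b i = bel s' b' i' \<longleftrightarrow> s = s' \<and> b = b' \<and> i mod N = i' mod N"
proof -
  have "bel s b i = bel s' b' i' \<longleftrightarrow> s = s' \<and> s * b = s * b' \<and> s \<cdot>\<^sub>m (W ^\<^sub>m i) = s \<cdot>\<^sub>m (W ^\<^sub>m i')"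
    by (auto simp: bel_def bdiag_eq_iff[of _ 2 _ n] upper2_eq_iff)
  also have "s \<cdot>\<^sub>m (W ^\<^sub>m i) = s \<cdot>\<^sub>m (W ^\<^sub>m i') \<longleftrightarrow> W ^\<^sub>m i = W ^\<^sub>m i'"
  proof
    assume "s \<cdot>\<^sub>m (W ^\<^sub>m i) = s \<cdot>\<^sub>m (W ^\<^sub>m i')"
    then have "(1 / s) \<cdot>\<^sub>m (s \<cdot>\<^sub>m (W ^\<^sub>m i)) = (1 / s) \<cdot>\<^sub>m (s \<cdot>\<^sub>m (W ^\<^sub>m i'))" by simp
    then show "W ^\<^sub>m i = W ^\<^sub>m i'" using assms by simp
  qed simp
  finally show ?thesis using assms by (simp add: W_pow_eq_iff)
qed

lemma root_nonzero: "s ^ k = 1 \<Longrightarrow> s \<noteq> (0 :: 'p mod_ring)"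
  using k by (auto simp: power_0_left)

definition B :: "'p mod_ring mat set" where
  "B = {bel s b i |s b i. s ^ k = 1}"

lemma bel_in_B: "s ^ k = 1 \<Longrightarrow> bel s b i \<in> B"
  by (auto simp: B_def)

lemma subgroup_B: "subgroup B G"
proof
  show "B \<subseteq> carrier G" by (auto simp: B_def bel_carrier)
  show "x \<otimes>\<^bsub>G\<^esub> y \<in> B" if "x \<in> B" "y \<in> B" for x y
    using that by (force simp: B_def bel_mult power_mult_distrib)
  show one: "\<one>\<^bsub>G\<^esub> \<in> B"
    using bel_in_B[of 1 0 0] by (simp add: bel_one)
  show "inv\<^bsub>G\<^esub> x \<in> B" if xB: "x \<in> B" for x
  proof -
    obtain s b i where x: "x = bel s b i" "s ^ k = 1" using xB by (auto simp: B_def)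
    \<comment> \<open>\<open>W ^ N = 1\<close> allows a natural number as the exponent of the
      inverse of \<open>W ^ i\<close>.\<close>
    let ?y = "bel (1 / s) (- b) (i * (N - 1))"
    have y: "?y \<in> B" using x by (intro bel_in_B) (simp add: power_one_over)
    have "i * (N - 1) + i = i * N" using N by (cases N) auto
    then have "?y * x = bel 1 0 (i * N)"
      using root_nonzero[OF x(2)] by (simp add: x bel_mult)
    also have "\<dots> = 1\<^sub>m k" using bel_mod[of 1 0 "i * N"] by (simp add: bel_one)
    finally have "inv\<^bsub>G\<^esub> x = ?y"
      using x by (intro G.inv_equality) (auto simp: bel_carrier power_one_over)
    then show ?thesis using y by simp
  qed
qed

text \<open>The first factor is the number of scalars in \<open>SL\<close>; it is the factor that
  survives in the final comparison.\<close>

lemma card_B: "card B = card {s :: 'p mod_ring. s ^ k = 1} * CARD('p) * N"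
proof -
  let ?D = "{s :: 'p mod_ring. s ^ k = 1} \<times> (UNIV :: 'p mod_ring set) \<times> {..<N}"
  have "bij_betw (\<lambda>(s, b, i). bel s b i) ?D B"
  proof (rule bij_betw_imageI)
    show "inj_on (\<lambda>(s, b, i). bel s b i) ?D"
      by (auto simp: inj_on_def bel_eq_iff[OF root_nonzero])
    have "bel s b i \<in> (\<lambda>(s, b, i). bel s b i) ` ?D" if "s ^ k = 1" for s b i
      using that N by (intro image_eqI[of _ _ "(s, b, i mod N)"]) (auto simp: bel_mod)
    then show "(\<lambda>(s, b, i). bel s b i) ` ?D = B"
      by (auto simp: B_def)
  qed
  then have "card B = card ?D" by (simp add: bij_betw_same_card)
  then show ?thesis by (simp add: card_cartesian_product)
qed

text \<open>The scalar \<open>s\<close> does not enter, which makes the character trivial on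
  scalars. The exponent of \<open>W\<close> is only determined modulo \<open>N\<close>, hence the
  choice; it is harmless when \<open>\<xi> ^ N = 1\<close>. The value 0 outside \<open>B\<close> is
  the one that induction expects.\<close>

definition chr :: "'p mod_ring \<Rightarrow> complex \<Rightarrow> 'p mod_ring mat \<Rightarrow> complex" where
  "chr t \<xi> x = (if x \<in> B then (let (s, b, i) = (SOME (s, b, i). s ^ k = 1 \<and> x = bel s b i) in add_char (t * b) * \<xi> ^ i) else 0)"

lemma chr_bel:
  assumes "s ^ k = 1" "\<xi> ^ N = 1"
  shows "chr t \<xi> (bel s b i) = add_char (t * b) * \<xi> ^ i"
proof -
  define w where "w = (SOME (s', b', i'). s' ^ k = 1 \<and> bel s b i = bel s' b' i')"
  obtain s' b' i' where w: "w = (s', b', i')" by (cases w)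
  have "\<exists>w. case w of (s', b', i') \<Rightarrow> s' ^ k = 1 \<and> bel s b i = bel s' b' i'"
    using assms(1) by auto
  then have "case w of (s', b', i') \<Rightarrow> s' ^ k = 1 \<and> bel s b i = bel s' b' i'"
    unfolding w_def by (rule someI_ex)
  then have b': "b = b'" and i': "i mod N = i' mod N"
    by (simp_all add: w bel_eq_iff[OF root_nonzero[OF assms(1)]])
  have "\<xi> ^ j = \<xi> ^ (j mod N)" for j
    using assms(2) by (subst mult_div_mod_eq[of N j, symmetric]) (simp only: power_add power_mult, simp)
  then have "\<xi> ^ i = \<xi> ^ i'" using i' by metis
  moreover have "chr t \<xi> (bel s b i) = (case w of (s, b, i) \<Rightarrow> add_char (t * b) * \<xi> ^ i)"
    using bel_in_B[OF assms(1), of b i] unfolding chr_def w_def Let_def by simp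
  ultimately show ?thesis by (simp add: w b')
qed

lemma chr_outside: "x \<notin> B \<Longrightarrow> chr t \<xi> x = 0"
  by (simp add: chr_def)

lemma chr_mult:
  assumes "\<xi> ^ N = 1" "x \<in> B" "y \<in> B"
  shows "chr t \<xi> (x * y) = chr t \<xi> x * chr t \<xi> y"
  using assms(2,3) unfolding B_def
  by (auto simp: bel_mult chr_bel assms(1) power_mult_distrib distrib_left add_char_add power_add)

lemma scalar_in_B:
  assumes "x \<in> carrier G" "x = c \<cdot>\<^sub>m 1\<^sub>m k"
  shows "x = bel c 0 0" "c ^ k = 1"
proof -
  have "upper2 c 0 c = c \<cdot>\<^sub>m 1\<^sub>m 2"
    by (intro eq_matI) (auto simp: upper2_def less_2_cases')
  then show x: "x = bel c 0 0"
    using W(1) unfolding assms(2) bel_def bdiag_def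
    by (intro eq_matI) (auto simp: k)
  show "c ^ k = 1" using assms(1) x bel_carrier by simp
qed

lemma chr_scalar:
  assumes "x \<in> carrier G" "x = c \<cdot>\<^sub>m 1\<^sub>m k" "\<xi> ^ N = 1"
  shows "x \<in> B" "chr t \<xi> x = 1"
  using scalar_in_B[OF assms(1,2)] by (auto simp: bel_in_B chr_bel assms(3))

definition ind_sum :: "'p mod_ring \<Rightarrow> complex \<Rightarrow> 'p mod_ring mat \<Rightarrow> complex" where
  "ind_sum t \<xi> g = (\<Sum>x\<in>carrier G. chr t \<xi> (inv\<^bsub>G\<^esub> x \<otimes>\<^bsub>G\<^esub> g \<otimes>\<^bsub>G\<^esub> x))"

text \<open>Conjugation by the matrix with blocks diag(\<open>\<alpha>\<close>,
  \<open>\<delta>\<close>) and \<open>Q\<close> multiplies the unipotent parameter by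
  \<open>\<delta> / \<alpha>\<close> and raises \<open>W\<close> to the power
  \<open>\<gamma>\<close>. The determinant condition puts this matrix into
  \<open>SL\<close>.\<close>

lemma ind_sum_conj_block:
  assumes Q: "Q \<in> carrier_mat n n" "W * Q = Q * W ^\<^sub>m \<gamma>" and \<alpha>: "\<alpha> * \<delta> * det Q = 1"
    and \<xi>: "\<xi> ^ N = 1" and g: "g \<in> carrier G"
  shows "ind_sum (t * (\<delta> / \<alpha>)) (\<xi> ^ \<gamma>) g = ind_sum t \<xi> g"
proof -
  let ?g0 = "bdiag (upper2 \<alpha> 0 \<delta>) Q"
  have a0: "\<alpha> \<noteq> 0" using \<alpha> by auto
  have g0: "?g0 \<in> carrier G"
    using Q(1) \<alpha> by (simp add: carrier_G bdiag_det[of _ 2 _ n] det_upper2)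
  have \<xi>': "(\<xi> ^ \<gamma>) ^ N = 1"
    using \<xi> by (metis power_commutes power_mult power_one mult.commute)
  have conj: "inv\<^bsub>G\<^esub> ?g0 * bel s b i * ?g0 = bel s (b * \<delta> / \<alpha>) (\<gamma> * i)" if s: "s ^ k = 1" for s b i
  proof -
    have WQ: "W ^\<^sub>m i * Q = Q * W ^\<^sub>m (\<gamma> * i)"
      using pow_mat_intertwine[OF W(1) _ Q(1,2), of i] W(1) by (simp add: pow_mat_mult[of W n])
    have "bel s b i * ?g0 = ?g0 * bel s (b * \<delta> / \<alpha>) (\<gamma> * i)"
      using Q(1) a0 WQ
      by (simp add: bel_def bdiag_mult[of _ 2 _ n] upper2_mult mult_smult_assoc_mat[of _ n n _ n] mult_smult_distrib[of _ n n _ n] mult_ac)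
    then show ?thesis
      using inv_conj_iff[OF g0, of "bel s b i" "bel s (b * \<delta> / \<alpha>) (\<gamma> * i)"] s by (simp add: bel_carrier)
  qed
  show ?thesis
    unfolding ind_sum_def
  proof (rule G.sum_conj_invariant[OF g0 g])
    fix x assume x: "x \<in> carrier G"
    show "chr (t * (\<delta> / \<alpha>)) (\<xi> ^ \<gamma>) x = chr t \<xi> (inv\<^bsub>G\<^esub> ?g0 \<otimes>\<^bsub>G\<^esub> x \<otimes>\<^bsub>G\<^esub> ?g0)"
    proof (rule G.extend_conj[OF g0 _ _ _ _ _ x])
      show "B \<subseteq> carrier G" using subgroup_B by (rule subgroup.subset)
      then show "finite B" using finite_SL by (rule finite_subset)
    next
      fix y assume "y \<in> B"
      then obtain s b i where y: "y = bel s b i" "s ^ k = 1" by (auto simp: B_def)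
      show "inv\<^bsub>G\<^esub> ?g0 \<otimes>\<^bsub>G\<^esub> y \<otimes>\<^bsub>G\<^esub> ?g0 \<in> B \<and> chr (t * (\<delta> / \<alpha>)) (\<xi> ^ \<gamma>) y = chr t \<xi> (inv\<^bsub>G\<^esub> ?g0 \<otimes>\<^bsub>G\<^esub> y \<otimes>\<^bsub>G\<^esub> ?g0)"
        using y(2) by (simp add: y(1) conj bel_in_B chr_bel \<xi> \<xi>' power_mult mult_ac)
    qed (simp_all add: chr_outside)
  qed
qed

text \<open>With c = \<open>\<delta> / \<alpha>\<close>, determinant 1 means that c det Q is the
  square of 1 / \<open>\<alpha>\<close>. If c det Q is not a square, \<open>Q\<close> is replaced by
  \<open>Q0 * Q\<close>, which induces the same power map on \<open>W\<close> and has the other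
  square class.\<close>

lemma ind_sum_conj:
  assumes Q: "Q \<in> carrier_mat n n" "det Q \<noteq> 0" "W * Q = Q * W ^\<^sub>m \<gamma>"
    and Q0: "Q0 \<in> carrier_mat n n" "W * Q0 = Q0 * W" "det Q0 \<noteq> 0" "\<not> (\<exists>x. det Q0 = x ^ 2)"
    and two: "(2 :: 'p mod_ring) \<noteq> 0"
    and c: "c \<noteq> 0" and \<xi>: "\<xi> ^ N = 1" and g: "g \<in> carrier G"
  shows "ind_sum (t * c) (\<xi> ^ \<gamma>) g = ind_sum t \<xi> g"
proof -
  have "\<exists>Q'. Q' \<in> carrier_mat n n \<and> det Q' \<noteq> 0 \<and> W * Q' = Q' * W ^\<^sub>m \<gamma> \<and> (\<exists>x. c * det Q' = x ^ 2)"
  proof (cases "\<exists>x. c * det Q = x ^ 2")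
    case False
    then have "\<exists>x. c * det Q * det Q0 = x ^ 2"
      using nonsquare_mult[OF two, of "c * det Q" "det Q0"] Q(2) c Q0(3,4) by simp
    moreover have "det (Q0 * Q) = det Q0 * det Q" using Q Q0 by (simp add: det_mult[of _ n])
    moreover have "W * (Q0 * Q) = Q0 * Q * W ^\<^sub>m \<gamma>"
    proof -
      have "W * (Q0 * Q) = W * Q0 * Q" using W(1) Q(1) Q0(1) by (simp add: assoc_mult_mat[of W n n Q0 n Q n])
      also have "\<dots> = Q0 * (W * Q)" using W(1) Q(1) Q0 by (simp add: assoc_mult_mat[of Q0 n n W n Q n])
      also have "\<dots> = Q0 * Q * W ^\<^sub>m \<gamma>" using W(1) Q Q0 by (simp add: assoc_mult_mat[of Q0 n n Q n "W ^\<^sub>m \<gamma>" n])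
      finally show ?thesis .
    qed
    ultimately show ?thesis
      using Q Q0 by (intro exI[of _ "Q0 * Q"]) (auto simp: mult_ac)
  qed (use Q in blast)
  then obtain Q' x where Q': "Q' \<in> carrier_mat n n" "det Q' \<noteq> 0" "W * Q' = Q' * W ^\<^sub>m \<gamma>" "c * det Q' = x ^ 2"
    by blast
  then have "x \<noteq> 0" using c by auto
  then have "(1 / x) * (c / x) * det Q' = 1" using Q'(4) by (simp add: field_simps power2_eq_square)
  then show ?thesis
    using ind_sum_conj_block[OF Q'(1,3) _ \<xi> g, of "1 / x" "c / x" t] \<open>x \<noteq> 0\<close> by simp
qed

text \<open>Only those \<open>x\<close> that conjugate \<open>g\<close> into \<open>B\<close>
  contribute; they form \<open>M'\<close>, where the summand is constant. Writing conjugation as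
  \<open>g * x = x * v\<close> leaves matrix equations without inverses to be solved.\<close>

lemma conj_sum_eq_card:
  fixes F :: "'p mod_ring mat \<Rightarrow> complex"
  assumes out: "\<And>x. x \<notin> B \<Longrightarrow> F x = 0" and g: "g \<in> carrier G" and sub: "M' \<subseteq> carrier G"
    and M: "\<And>x. x \<in> M' \<Longrightarrow> \<exists>v\<in>carrier G. g * x = x * v \<and> F v = c"
    and conv: "\<And>x s b i. x \<in> carrier G \<Longrightarrow> s ^ k = 1 \<Longrightarrow> g * x = x * bel s b i \<Longrightarrow> x \<in> M'"
  shows "(\<Sum>x\<in>carrier G. F (inv\<^bsub>G\<^esub> x \<otimes>\<^bsub>G\<^esub> g \<otimes>\<^bsub>G\<^esub> x)) = of_nat (card M') * c"
proof -
  have "F (inv\<^bsub>G\<^esub> x \<otimes>\<^bsub>G\<^esub> g \<otimes>\<^bsub>G\<^esub> x) = (if x \<in> M' then c else 0)" if x: "x \<in> carrier G" for x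
  proof (cases "x \<in> M'")
    case True
    then obtain v where v: "v \<in> carrier G" "g * x = x * v" "F v = c" using M by blast
    then show ?thesis using inv_conj_iff[OF x g v(1)] True by simp
  next
    case False
    have "inv\<^bsub>G\<^esub> x \<otimes>\<^bsub>G\<^esub> g \<otimes>\<^bsub>G\<^esub> x \<notin> B"
    proof
      assume inB: "inv\<^bsub>G\<^esub> x \<otimes>\<^bsub>G\<^esub> g \<otimes>\<^bsub>G\<^esub> x \<in> B"
      then obtain s b i where v: "inv\<^bsub>G\<^esub> x * g * x = bel s b i" "s ^ k = 1" by (auto simp: B_def)
      then have "g * x = x * bel s b i" using inv_conj_iff[OF x g] by (simp add: bel_carrier)
      then show False using conv[OF x v(2)] False by blast
    qed
    then show ?thesis using False by (simp add: out)
  qed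
  then have "(\<Sum>x\<in>carrier G. F (inv\<^bsub>G\<^esub> x \<otimes>\<^bsub>G\<^esub> g \<otimes>\<^bsub>G\<^esub> x)) = (\<Sum>x\<in>carrier G. if x \<in> M' then c else 0)" by simp
  also have "\<dots> = (\<Sum>x\<in>carrier G \<inter> M'. c)"
    using finite_SL[of k, where ?'a = "'p mod_ring"] by (simp add: sum.If_cases)
  also have "carrier G \<inter> M' = M'" using sub by blast
  finally show ?thesis by simp
qed

end

section \<open>Roots of unity in the algebraic closure\<close>

text \<open>X^N - 1 splits, and a double root would also be a root of its derivative N X^(N-1),
  hence would be 0, which is not a root.\<close>

lemma card_roots_of_unity:
  assumes N: "N > 0" "of_nat N \<noteq> (0 :: 'a :: alg_closed_field)"
  shows "card {x :: 'a. x ^ N = 1} = N"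
proof -
  define f where "f = Polynomial.monom (1 :: 'a) N - 1"
  have poly_f: "poly f x = x ^ N - 1" for x by (simp add: f_def Polynomial.poly_monom)
  have deg: "Polynomial.degree f = N"
  proof -
    have "Polynomial.degree (Polynomial.monom (1 :: 'a) N + (- 1)) = Polynomial.degree (Polynomial.monom (1 :: 'a) N)"
      by (rule degree_add_eq_left) (use N in \<open>simp add: Polynomial.degree_monom_eq\<close>)
    then show ?thesis by (simp add: f_def Polynomial.degree_monom_eq)
  qed
  have "f \<noteq> 0" using deg N by auto
  then obtain A where A: "size A = Polynomial.degree f" "f = Polynomial.smult (Polynomial.coeff f (Polynomial.degree f)) (\<Prod>x\<in>#A. [:-x, 1:])"
    using alg_closed_imp_factorization by blast
  define l where "l = Polynomial.coeff f (Polynomial.degree f)"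
  have l0: "l \<noteq> 0" using \<open>f \<noteq> 0\<close> by (simp add: l_def)
  have roots: "poly f x = 0 \<longleftrightarrow> x \<in># A" for x
    using l0 unfolding l_def by (subst A(2)) (auto simp: poly_prod_mset)
  have "count A x \<le> 1" for x
  proof (rule ccontr)
    assume "\<not> count A x \<le> 1"
    then have "{#x, x#} \<subseteq># A" by (simp add: subseteq_mset_def)
    then obtain A' where A': "A = {#x, x#} + A'" by (metis subset_mset.add_diff_inverse)
    have f: "f = [:-x, 1:] * ([:-x, 1:] * Polynomial.smult l (\<Prod>x\<in>#A'. [:-x, 1:]))"
      unfolding l_def by (subst A(2)) (simp add: A')
    have "poly (pderiv f) x = 0"
      unfolding f pderiv_mult by simp
    then have "of_nat N * x ^ (N - 1) = 0"
      by (simp add: f_def pderiv_diff Polynomial.pderiv_monom Polynomial.poly_monom)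
    then have "x = 0" using N by simp
    moreover have "poly f x = 0" by (simp add: f)
    ultimately show False using N by (simp add: poly_f power_0_left)
  qed
  then have "count A x = 1" if "x \<in># A" for x
    using that by (simp add: le_antisym Suc_le_eq)
  then have "size A = card (set_mset A)"
    by (simp add: size_multiset_overloaded_eq)
  also have "set_mset A = {x. x ^ N = 1}"
    using roots by (auto simp: poly_f)
  finally show ?thesis using A(1) deg by simp
qed

text \<open>For positive \<open>n\<close>, the field with p^n elements, as the fixed points of a
  power of Frobenius in the algebraic closure.\<close>

abbreviation frob_field :: "nat \<Rightarrow> 'p::prime_card mod_ring alg_closure set" where
  "frob_field n \<equiv> {x. x ^ (CARD('p) ^ n) = x}"

lemma CHAR_ac: "CHAR('p::prime_card mod_ring alg_closure) = CARD('p)"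
  by simp

lemma prime_CHAR_ac: "Factorial_Ring.prime CHAR('p::prime_card mod_ring alg_closure)"
  using prime_card[where ?'a = 'p] by simp

lemma frob_add:
  "(x + y :: 'p::prime_card mod_ring alg_closure) ^ (CARD('p) ^ n) = x ^ (CARD('p) ^ n) + y ^ (CARD('p) ^ n)"
  by (rule freshmans_dream'[OF prime_CHAR_ac]) (simp add: CHAR_ac)

lemma frob_sum:
  "(sum f A :: 'p::prime_card mod_ring alg_closure) ^ (CARD('p) ^ n) = (\<Sum>i\<in>A. f i ^ (CARD('p) ^ n))"
  by (rule freshmans_dream_sum'[OF prime_CHAR_ac]) (simp add: CHAR_ac)

lemma frob_to_ac: "to_ac (c :: 'p::prime_card mod_ring) ^ (CARD('p) ^ n) = to_ac c"
proof -
  have "c ^ (CARD('p) ^ n) = c"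
    using finite_field_power_card_power_eq_same[of "CARD('p) ^ n" n c] by simp
  then show ?thesis by (metis to_ac_power)
qed

text \<open>The fixed points form a finite field, whose multiplicative group is cyclic; counting
  roots of unity shows that its order is p^n - 1.\<close>

lemma exists_primitive_root:
  assumes "n > 0"
  shows "\<exists>g :: 'p::prime_card mod_ring alg_closure. \<forall>i. g ^ i = 1 \<longleftrightarrow> (CARD('p) ^ n - 1) dvd i"
proof -
  let ?p = "CARD('p)" and ?L = "frob_field n :: 'p mod_ring alg_closure set"
  define N where "N = ?p ^ n - 1"
  have p2: "?p \<ge> 2" using prime_card[where ?'a = 'p] prime_ge_2_nat by blast
  have pn: "?p ^ n > 1" using one_less_power[of ?p n] p2 assms by simp
  have N: "N > 0" "?p ^ n = Suc N" using pn by (simp_all add: N_def)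
  \<comment> \<open>p^n vanishes in characteristic p, so p^n - 1 equals -1 there, and the count of
    roots of unity applies.\<close>
  have ofN: "of_nat N = (- 1 :: 'p mod_ring alg_closure)"
  proof -
    have "of_nat ?p = (0 :: 'p mod_ring alg_closure)" by (metis CHAR_ac of_nat_CHAR)
    then have "of_nat (Suc N) = (0 :: 'p mod_ring alg_closure)"
      unfolding N(2)[symmetric] using assms by (simp add: power_0_left)
    then show ?thesis by (simp add: add_eq_0_iff)
  qed
  have L_iff: "x \<in> ?L \<longleftrightarrow> x = 0 \<or> x ^ N = 1" for x by (auto simp: N(2))
  have card: "card {x :: 'p mod_ring alg_closure. x ^ N = 1} = N"
    by (rule card_roots_of_unity) (use N ofN in auto)
  then have fin: "finite {x :: 'p mod_ring alg_closure. x ^ N = 1}"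
    using N by (metis card.infinite less_irrefl)
  have "?L = insert 0 {x. x ^ N = 1}" using L_iff by blast
  then have finL: "finite ?L" using fin by simp
  define R :: "'p mod_ring alg_closure ring" where "R = \<lparr>carrier = ?L, monoid.mult = (*), one = 1, zero = 0, add = (+)\<rparr>"
  have neg: "- x \<in> ?L" if "x \<in> ?L" for x
  proof -
    have "0 = (x + - x) ^ (?p ^ n)" using pn by simp
    also have "\<dots> = x + (- x) ^ (?p ^ n)" using that by (subst frob_add) simp
    finally show ?thesis by (simp add: eq_neg_iff_add_eq_0 add.commute)
  qed
  have "cring R"
  proof (rule cringI)
    show "abelian_group R"
    proof (rule abelian_groupI)
      fix x assume "x \<in> carrier R"
      then show "\<exists>y\<in>carrier R. y \<oplus>\<^bsub>R\<^esub> x = \<zero>\<^bsub>R\<^esub>"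
        using neg[of x] by (intro bexI[of _ "- x"]) (simp_all add: R_def)
    qed (use pn in \<open>auto simp: R_def frob_add add_ac power_0_left\<close>)
    show "comm_monoid R"
      by (rule comm_monoidI) (auto simp: R_def power_mult_distrib mult_ac)
  qed (auto simp: R_def distrib_right)
  moreover have "\<exists>y\<in>carrier R. x \<otimes>\<^bsub>R\<^esub> y = \<one>\<^bsub>R\<^esub>" if "x \<in> carrier R" "x \<noteq> \<zero>\<^bsub>R\<^esub>" for x
    using that by (intro bexI[of _ "inverse x"]) (auto simp: R_def power_inverse)
  ultimately have "field R"
    by (intro cring.cring_fieldI2) (auto simp: R_def)
  then interpret R: field R .
  obtain g where g: "g \<in> carrier (mult_of R)" "carrier (mult_of R) = {g [^]\<^bsub>R\<^esub> i |i::nat. i \<in> UNIV}"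
    using R.finite_field_mult_group_has_gen finL by (auto simp: R_def)
  have pow: "g [^]\<^bsub>R\<^esub> i = g ^ i" for i :: nat
    by (induction i) (simp_all add: R_def nat_pow_def mult.commute)
  have "carrier (mult_of R) = {x. x ^ N = 1}"
    using L_iff N(1) by (auto simp: mult_of_def R_def power_0_left)
  then have gen: "{x. x ^ N = 1} = range (\<lambda>i. g ^ i)" and gN: "g ^ N = 1"
    using g by (auto simp: pow)
  have "g ^ i = 1 \<longleftrightarrow> N dvd i" for i
  proof
    assume i: "g ^ i = 1"
    show "N dvd i"
    proof (cases "i mod N = 0")
      case False
      define m where "m = i mod N"
      have "g ^ i = g ^ (N * (i div N) + m)" by (simp add: m_def)
      also have "\<dots> = (g ^ N) ^ (i div N) * g ^ m" by (simp only: power_add power_mult)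
      finally have m: "g ^ m = 1" using i gN by simp
      have m0: "m > 0" "m < N" using False N by (simp_all add: m_def)
      \<comment> \<open>If a positive m < N had g^m = 1, the powers of \<open>g\<close> would take
        at most m values and could not be all N roots of unity.\<close>
      have "range (\<lambda>i. g ^ i) \<subseteq> (\<lambda>i. g ^ i) ` {..<m}"
      proof clarify
        fix j
        have "g ^ j = g ^ (m * (j div m) + j mod m)" by simp
        also have "\<dots> = (g ^ m) ^ (j div m) * g ^ (j mod m)" by (simp only: power_add power_mult)
        finally have "g ^ j = g ^ (j mod m)" using m by simp
        then show "g ^ j \<in> (\<lambda>i. g ^ i) ` {..<m}" using m0 by auto
      qed
      then have "card (range (\<lambda>i. g ^ i)) \<le> card {..<m}"
        by (meson card_image_le card_mono finite_imageI finite_lessThan le_trans)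
      then show ?thesis using card gen m0 by simp
    qed auto
  next
    assume "N dvd i"
    then show "g ^ i = 1" using gN by (auto simp: power_mult)
  qed
  then show ?thesis unfolding N_def by blast
qed

lemma exists_root_of_unity:
  assumes "n > 0" and q: "q dvd CARD('p) ^ n - 1"
  shows "\<exists>\<alpha> :: 'p::prime_card mod_ring alg_closure. \<forall>i. \<alpha> ^ i = 1 \<longleftrightarrow> q dvd i"
proof -
  let ?N = "CARD('p) ^ n - 1"
  have "CARD('p) ^ n > 1"
    using one_less_power[of "CARD('p)" n] prime_gt_1_nat[OF prime_card[where ?'a = 'p]] assms(1) by simp
  then have N: "?N > 0" by simp
  obtain g :: "'p mod_ring alg_closure" where g: "\<And>i. g ^ i = 1 \<longleftrightarrow> ?N dvd i"
    using exists_primitive_root[OF assms(1), where ?'p = 'p] by blast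
  obtain m where m: "?N = q * m" using q by blast
  have "(g ^ m) ^ i = 1 \<longleftrightarrow> q dvd i" for i
    using g[of "m * i"] m N by (simp add: power_mult mult.commute[of q m])
  then show ?thesis by blast
qed

section \<open>Multiplication matrices of a finite field\<close>

text \<open>\<open>\<alpha>\<close> is a primitive \<open>q\<close>-th root of unity, and
  \<open>ord\<close> says that p has order exactly \<open>n\<close> modulo \<open>q\<close>. Thus
  \<open>\<alpha>\<close> has \<open>n\<close> distinct Frobenius conjugates and generates the field
  with p^n elements.\<close>

locale root_mult =
  fixes n q :: nat and \<alpha> :: "'p::prime_card mod_ring alg_closure"
  assumes n: "n > 0" and \<alpha>: "\<And>i. \<alpha> ^ i = 1 \<longleftrightarrow> q dvd i"
    and ord: "\<And>j. q dvd CARD('p) ^ j - 1 \<longleftrightarrow> n dvd j"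
begin

abbreviation "L \<equiv> frob_field n :: 'p mod_ring alg_closure set"

lemma p_gt_1: "CARD('p) > 1"
  using prime_card[where ?'a = 'p] by (rule prime_gt_1_nat)

lemma pn_gt_1: "CARD('p) ^ n > 1"
  using one_less_power[OF p_gt_1 n] .

lemma q_pos: "q > 0"
  using ord[of n] pn_gt_1 by (auto intro: Nat.gr0I)

lemma alpha_nonzero: "\<alpha> \<noteq> 0"
  using \<alpha>[of q] q_pos by (auto simp: power_0_left)

lemma coprime_q_p: "coprime q CARD('p)"
proof -
  have "q dvd CARD('p) ^ n - 1" using ord by simp
  moreover have cop: "coprime (CARD('p) ^ n - 1) (CARD('p) ^ n)"
    by (rule coprime_diff_one_left_nat) (use pn_gt_1 in linarith)
  ultimately have "coprime q (CARD('p) ^ n)" by (intro coprime_divisors[OF _ dvd_refl cop])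
  then show ?thesis using n by simp
qed

lemma alpha_pow_eq_iff: "\<alpha> ^ i = \<alpha> ^ j \<longleftrightarrow> int q dvd int i - int j"
proof -
  have *: "\<alpha> ^ i = \<alpha> ^ j \<longleftrightarrow> int q dvd int i - int j" if "j \<le> i" for i j
  proof -
    have "\<alpha> ^ i = \<alpha> ^ j * \<alpha> ^ (i - j)" using that by (simp add: power_add[symmetric])
    then have "\<alpha> ^ i = \<alpha> ^ j \<longleftrightarrow> q dvd i - j" using \<alpha>[of "i - j"] alpha_nonzero by simp
    then show ?thesis using that by (metis int_dvd_int_iff of_nat_diff)
  qed
  show ?thesis
  proof (cases "j \<le> i")
    case False
    then have "\<alpha> ^ j = \<alpha> ^ i \<longleftrightarrow> int q dvd int j - int i" using *[of i j] by simp
    then show ?thesis by (metis dvd_diff_commute)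
  qed (rule *)
qed

lemma conj_eq_iff:
  assumes "i < n" "j < n"
  shows "\<alpha> ^ (CARD('p) ^ i) = \<alpha> ^ (CARD('p) ^ j) \<longleftrightarrow> i = j"
proof -
  have *: "i = j" if "i \<le> j" "j < n" "\<alpha> ^ (CARD('p) ^ j) = \<alpha> ^ (CARD('p) ^ i)" for i j
  proof -
    have "CARD('p) ^ j = CARD('p) ^ i * CARD('p) ^ (j - i)" using that(1) by (simp add: power_add[symmetric])
    then have "int (CARD('p) ^ j) - int (CARD('p) ^ i) = int (CARD('p) ^ i * (CARD('p) ^ (j - i) - 1))"
      using p_gt_1 by (simp add: algebra_simps of_nat_diff)
    then have "q dvd CARD('p) ^ i * (CARD('p) ^ (j - i) - 1)"
      using that(3) unfolding alpha_pow_eq_iff by (metis int_dvd_int_iff)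
    then have "q dvd CARD('p) ^ (j - i) - 1"
      using coprime_q_p by (simp add: coprime_dvd_mult_right_iff)
    then have "n dvd j - i" using ord by simp
    then show "i = j" using that(1,2) by (auto dest: dvd_imp_le)
  qed
  show ?thesis
    using *[of i j] *[of j i] assms by (metis nat_le_linear)
qed

lemma alpha_L: "\<alpha> ^ i \<in> L"
proof -
  have "\<alpha> ^ (CARD('p) ^ n) = \<alpha> ^ 1"
    unfolding alpha_pow_eq_iff using ord[of n] pn_gt_1 by (metis dvd_refl int_dvd_int_iff less_imp_le_nat of_nat_1 of_nat_diff)
  then have "\<alpha> ^ (CARD('p) ^ n) = \<alpha>" by simp
  moreover have "(\<alpha> ^ i) ^ (CARD('p) ^ n) = (\<alpha> ^ (CARD('p) ^ n)) ^ i"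
    by (simp only: power_mult[symmetric] mult.commute)
  ultimately show ?thesis by simp
qed

lemma L_mult: "x \<in> L \<Longrightarrow> y \<in> L \<Longrightarrow> x * y \<in> L"
  by (simp add: power_mult_distrib)

text \<open>At \<open>x = \<alpha>\<close> this is the field element with coordinates
  \<open>c\<close> in the basis 1, \<open>\<alpha>\<close>, ...,
  \<open>\<alpha> ^ (n - 1)\<close>.\<close>

definition evl :: "(nat \<Rightarrow> 'p mod_ring) \<Rightarrow> 'p mod_ring alg_closure \<Rightarrow> 'p mod_ring alg_closure" where
  "evl c x = (\<Sum>i<n. to_ac (c i) * x ^ i)"

lemma evl_frob: "evl c (x ^ (CARD('p) ^ j)) = evl c x ^ (CARD('p) ^ j)"
  unfolding evl_def frob_sum
  by (simp add: power_mult_distrib frob_to_ac power_mult[symmetric] mult.commute)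

text \<open>The \<open>n\<close> conjugates of \<open>\<alpha>\<close> are distinct roots, so they
  fill up the degree. This does the work of the minimal polynomial of
  \<open>\<alpha>\<close>.\<close>

lemma roots_conj:
  fixes P :: "'p mod_ring alg_closure poly"
  assumes "\<And>j. j < n \<Longrightarrow> poly P (\<alpha> ^ (CARD('p) ^ j)) = 0" "P \<noteq> 0"
  shows "Polynomial.degree P \<ge> n" "Polynomial.degree P = n \<Longrightarrow> poly P x = 0 \<Longrightarrow> \<exists>j<n. x = \<alpha> ^ (CARD('p) ^ j)"
proof -
  let ?A = "(\<lambda>j. \<alpha> ^ (CARD('p) ^ j)) ` {..<n}"
  have card: "card ?A = n"
    by (subst card_image) (auto simp: inj_on_def conj_eq_iff)
  have sub: "?A \<subseteq> {x. poly P x = 0}" using assms(1) by auto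
  have fin: "finite {x. poly P x = 0}" using assms(2) by (rule poly_roots_finite)
  have le: "card {x. poly P x = 0} \<le> Polynomial.degree P"
    using assms(2) by (rule card_poly_roots_bound)
  have "n \<le> card {x. poly P x = 0}" using card_mono[OF fin sub] card by simp
  then show "Polynomial.degree P \<ge> n" using le by simp
  assume "Polynomial.degree P = n" "poly P x = 0"
  then have "?A = {x. poly P x = 0}"
    using card_mono[OF fin sub] card le by (intro card_subset_eq[OF fin sub]) auto
  then show "\<exists>j<n. x = \<alpha> ^ (CARD('p) ^ j)" using \<open>poly P x = 0\<close> by blast
qed

lemma poly_evl: "poly (\<Sum>i<n. Polynomial.monom (a i) i) x = (\<Sum>i<n. a i * x ^ i)"
  for a :: "nat \<Rightarrow> 'p mod_ring alg_closure"
  by (simp add: poly_sum Polynomial.poly_monom)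

lemma degree_evl: "Polynomial.degree (\<Sum>i<n. Polynomial.monom (a i) i) < n"
  for a :: "nat \<Rightarrow> 'p mod_ring alg_closure"
proof -
  have "Polynomial.degree (\<Sum>i<n. Polynomial.monom (a i) i) \<le> n - 1"
  proof (rule degree_sum_le)
    fix i assume "i \<in> {..<n}"
    then show "Polynomial.degree (Polynomial.monom (a i) i) \<le> n - 1"
      using Polynomial.degree_monom_le[of "a i" i] by auto
  qed simp
  then show ?thesis using n by simp
qed

lemma coeffs_zero:
  fixes a :: "nat \<Rightarrow> 'p mod_ring alg_closure"
  assumes "\<And>j. j < n \<Longrightarrow> (\<Sum>i<n. a i * (\<alpha> ^ (CARD('p) ^ j)) ^ i) = 0" "i < n"
  shows "a i = 0"
proof -
  let ?P = "\<Sum>i<n. Polynomial.monom (a i) i"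
  have "?P = 0"
    using roots_conj(1)[of ?P] degree_evl[of a] assms(1) by (force simp: poly_evl)
  then have "Polynomial.coeff ?P i = 0" by simp
  moreover have "Polynomial.coeff ?P i = a i"
    using assms(2) by (simp add: coeff_sum)
  ultimately show ?thesis by simp
qed

lemma evl_zero:
  assumes "evl c \<alpha> = 0" "i < n"
  shows "c i = 0"
proof -
  have "to_ac (c i) = 0"
  proof (rule coeffs_zero[where a = "\<lambda>i. to_ac (c i)"])
    fix j
    have "evl c (\<alpha> ^ (CARD('p) ^ j)) = 0" using assms(1) p_gt_1 by (simp add: evl_frob)
    then show "(\<Sum>i<n. to_ac (c i) * (\<alpha> ^ CARD('p) ^ j) ^ i) = 0" by (simp add: evl_def)
  qed (rule assms(2))
  then show ?thesis by simp
qed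

lemma evl_inj:
  assumes "evl c \<alpha> = evl d \<alpha>" "i < n"
  shows "c i = d i"
proof -
  have "evl (\<lambda>i. c i - d i) \<alpha> = 0"
    using assms(1) by (simp add: evl_def left_diff_distrib sum_subtractf)
  then show ?thesis using evl_zero[of "\<lambda>i. c i - d i" i] assms(2) by simp
qed

lemma finite_L: "finite L" and card_L: "card L \<le> CARD('p) ^ n"
proof -
  let ?P = "Polynomial.monom 1 (CARD('p) ^ n) - Polynomial.monom 1 1 :: 'p mod_ring alg_closure poly"
  have c: "Polynomial.coeff ?P (CARD('p) ^ n) = 1" using pn_gt_1 by simp
  then have P0: "?P \<noteq> 0" by (metis coeff_0 zero_neq_one)
  have deg: "Polynomial.degree ?P \<le> CARD('p) ^ n"
    using pn_gt_1 by (intro degree_diff_le) (auto intro: order.trans[OF Polynomial.degree_monom_le])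
  have L: "L = {x. poly ?P x = 0}" by (auto simp: Polynomial.poly_monom)
  show "finite L" unfolding L using P0 by (rule poly_roots_finite)
  show "card L \<le> CARD('p) ^ n" unfolding L using card_poly_roots_bound[OF P0] deg by simp
qed

text \<open>The p^n coordinate vectors give distinct elements of \<open>L\<close>, which has at most
  p^n elements; counting makes the independent powers of \<open>\<alpha>\<close> a basis.\<close>

lemma L_coords:
  assumes "x \<in> L"
  shows "\<exists>c. evl c \<alpha> = x"
proof -
  let ?D = "{..<n} \<rightarrow>\<^sub>E (UNIV :: 'p mod_ring set)"
  have inj: "inj_on (\<lambda>c. evl c \<alpha>) ?D"
  proof (rule inj_onI)
    fix c d assume "c \<in> ?D" "d \<in> ?D" "evl c \<alpha> = evl d \<alpha>"
    then show "c = d" using evl_inj[of c d] by (intro PiE_ext) auto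
  qed
  have sub: "(\<lambda>c. evl c \<alpha>) ` ?D \<subseteq> L"
  proof clarify
    fix c
    have "evl c \<alpha> ^ (CARD('p) ^ n) = evl c (\<alpha> ^ (CARD('p) ^ n))" by (simp add: evl_frob)
    also have "\<alpha> ^ (CARD('p) ^ n) = \<alpha>" using alpha_L[of 1] by simp
    finally show "evl c \<alpha> ^ (CARD('p) ^ n) = evl c \<alpha>" .
  qed
  have "card ((\<lambda>c. evl c \<alpha>) ` ?D) = CARD('p) ^ n"
    by (subst card_image[OF inj]) (simp add: card_PiE)
  then have "(\<lambda>c. evl c \<alpha>) ` ?D = L"
    using card_mono[OF finite_L sub] card_L by (intro card_subset_eq[OF finite_L sub]) linarith
  then have "x \<in> (\<lambda>c. evl c \<alpha>) ` ?D" using assms by (simp only:)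
  then show ?thesis by (elim imageE) (intro exI, rule sym)
qed

text \<open>\<open>Q\<close> is the matrix of multiplication by \<open>x\<close> in the basis of
  powers of \<open>\<alpha>\<close>: its column \<open>j\<close> holds the coordinates of
  \<open>x * \<alpha> ^ j\<close>.\<close>

definition lev :: "'p mod_ring mat \<Rightarrow> 'p mod_ring alg_closure \<Rightarrow> bool" where
  "lev Q x \<longleftrightarrow> Q \<in> carrier_mat n n \<and> (\<forall>j<n. evl (\<lambda>i. Q $$ (i, j)) \<alpha> = x * \<alpha> ^ j)"

definition mmat :: "'p mod_ring alg_closure \<Rightarrow> 'p mod_ring mat" where
  "mmat x = mat n n (\<lambda>(i, j). (SOME c. evl c \<alpha> = x * \<alpha> ^ j) i)"

lemma lev_mmat:
  assumes "x \<in> L"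
  shows "lev (mmat x) x"
proof -
  have "evl (\<lambda>i. mmat x $$ (i, j)) \<alpha> = x * \<alpha> ^ j" if j: "j < n" for j
  proof -
    have "evl (\<lambda>i. mmat x $$ (i, j)) \<alpha> = evl (SOME c. evl c \<alpha> = x * \<alpha> ^ j) \<alpha>"
      using j by (simp add: evl_def mmat_def)
    also have "\<dots> = x * \<alpha> ^ j"
      by (rule someI_ex[of "\<lambda>c. evl c \<alpha> = x * \<alpha> ^ j"]) (rule L_coords[OF L_mult[OF assms alpha_L]])
    finally show ?thesis .
  qed
  then show ?thesis by (simp add: lev_def mmat_def)
qed

lemma lev_unique: "lev Q x \<Longrightarrow> lev Q' x \<Longrightarrow> Q = Q'"
  unfolding lev_def by (intro eq_matI) (auto intro: evl_inj)

lemma evl_mult_col: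
  assumes "Q \<in> carrier_mat n n" "R \<in> carrier_mat n n" "j < n"
  shows "evl (\<lambda>i. (Q * R) $$ (i, j)) x = (\<Sum>k<n. evl (\<lambda>i. Q $$ (i, k)) x * to_ac (R $$ (k, j)))"
proof -
  have "evl (\<lambda>i. (Q * R) $$ (i, j)) x = (\<Sum>i<n. \<Sum>k<n. to_ac (Q $$ (i, k)) * to_ac (R $$ (k, j)) * x ^ i)"
    using assms unfolding evl_def
    by (intro sum.cong) (auto simp: scalar_prod_def to_ac_sum lessThan_atLeast0 sum_distrib_right)
  also have "\<dots> = (\<Sum>k<n. \<Sum>i<n. to_ac (Q $$ (i, k)) * to_ac (R $$ (k, j)) * x ^ i)"
    by (rule sum.swap)
  also have "\<dots> = (\<Sum>k<n. evl (\<lambda>i. Q $$ (i, k)) x * to_ac (R $$ (k, j)))"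
    by (simp add: evl_def sum_distrib_left mult_ac)
  finally show ?thesis .
qed

lemma evl_mult_lev:
  assumes "lev Q x" "R \<in> carrier_mat n n" "j < n"
  shows "evl (\<lambda>i. (Q * R) $$ (i, j)) \<alpha> = x * evl (\<lambda>i. R $$ (i, j)) \<alpha>"
proof -
  have Q: "Q \<in> carrier_mat n n" using assms(1) by (simp add: lev_def)
  have "evl (\<lambda>i. (Q * R) $$ (i, j)) \<alpha> = (\<Sum>k<n. x * \<alpha> ^ k * to_ac (R $$ (k, j)))"
    unfolding evl_mult_col[OF Q assms(2,3)] using assms(1) by (simp add: lev_def)
  then show ?thesis by (simp add: evl_def sum_distrib_left mult_ac)
qed

lemma lev_mult: "lev Q x \<Longrightarrow> lev R y \<Longrightarrow> lev (Q * R) (x * y)"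
  using evl_mult_lev[of Q x R] unfolding lev_def by (auto simp: mult_ac)

lemma lev_one: "lev (1\<^sub>m n) 1"
proof -
  have "evl (\<lambda>i. 1\<^sub>m n $$ (i, j)) \<alpha> = 1 * \<alpha> ^ j" if j: "j < n" for j
  proof -
    have "evl (\<lambda>i. 1\<^sub>m n $$ (i, j)) \<alpha> = (\<Sum>i<n. if i = j then \<alpha> ^ i else 0)"
      unfolding evl_def by (rule sum.cong) (use j in auto)
    then show ?thesis using j by simp
  qed
  then show ?thesis by (simp add: lev_def)
qed

lemma lev_pow: "lev Q x \<Longrightarrow> lev (Q ^\<^sub>m i) (x ^ i)"
proof (induction i)
  case 0
  then have "Q ^\<^sub>m 0 = 1\<^sub>m n" by (auto simp: lev_def)
  then show ?case using lev_one by simp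
next
  case (Suc i)
  then show ?case using lev_mult[of "Q ^\<^sub>m i" "x ^ i" Q x] by (simp add: mult.commute)
qed

lemma lev_diff: "lev Q x \<Longrightarrow> lev R y \<Longrightarrow> lev (Q - R) (x - y)"
proof -
  assume Q: "lev Q x" and R: "lev R y"
  have "evl (\<lambda>i. (Q - R) $$ (i, j)) \<alpha> = evl (\<lambda>i. Q $$ (i, j)) \<alpha> - evl (\<lambda>i. R $$ (i, j)) \<alpha>" if "j < n" for j
    using that Q R unfolding evl_def sum_subtractf[symmetric]
    by (intro sum.cong) (auto simp: lev_def left_diff_distrib)
  then show ?thesis using Q R by (auto simp: lev_def left_diff_distrib)
qed

lemma lev_smult: "lev Q x \<Longrightarrow> lev (c \<cdot>\<^sub>m Q) (to_ac c * x)"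
proof -
  assume Q: "lev Q x"
  have "evl (\<lambda>i. (c \<cdot>\<^sub>m Q) $$ (i, j)) \<alpha> = to_ac c * evl (\<lambda>i. Q $$ (i, j)) \<alpha>" if "j < n" for j
    using that Q unfolding evl_def sum_distrib_left
    by (intro sum.cong) (auto simp: lev_def mult_ac)
  then show ?thesis using Q by (auto simp: lev_def mult_ac)
qed

lemma lev_L: "lev Q x \<Longrightarrow> x \<in> L"
proof -
  assume "lev Q x"
  then have x: "x = evl (\<lambda>i. Q $$ (i, 0)) \<alpha>" using n by (auto simp: lev_def)
  have "evl (\<lambda>i. Q $$ (i, 0)) \<alpha> ^ (CARD('p) ^ n) = evl (\<lambda>i. Q $$ (i, 0)) (\<alpha> ^ (CARD('p) ^ n))" by (simp add: evl_frob)
  also have "\<alpha> ^ (CARD('p) ^ n) = \<alpha>" using alpha_L[of 1] by simp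
  finally show ?thesis by (simp add: x)
qed

abbreviation "U \<equiv> mmat \<alpha>"

lemma U_carrier: "U \<in> carrier_mat n n" and lev_U: "lev U \<alpha>"
  using lev_mmat[of \<alpha>] alpha_L[of 1] by (simp_all add: lev_def)

text \<open>Multiplication by \<open>\<alpha>\<close> shifts the basis, so \<open>U\<close> is a
  companion matrix; only its last column carries information.\<close>

lemma U_col:
  assumes "i < n" "Suc j < n"
  shows "U $$ (i, j) = (if i = Suc j then 1 else 0)"
proof -
  have "evl (\<lambda>i. U $$ (i, j)) \<alpha> = \<alpha> ^ Suc j" using lev_U assms by (simp add: lev_def)
  also have "\<dots> = evl (\<lambda>i. if i = Suc j then 1 else 0) \<alpha>"
    using assms by (simp add: evl_def if_distrib[of to_ac] if_distrib[of "\<lambda>x. x * _"] cong: if_cong)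
  finally show ?thesis using evl_inj[of _ "\<lambda>i. if i = Suc j then 1 else 0"] assms(1) by blast
qed

lemma mult_U_col:
  assumes Q: "Q \<in> carrier_mat n n" and "i < n" "Suc j < n"
  shows "(Q * U) $$ (i, j) = Q $$ (i, Suc j)"
proof -
  have "(Q * U) $$ (i, j) = (\<Sum>k<n. Q $$ (i, k) * U $$ (k, j))"
    using assms U_carrier by (simp add: scalar_prod_def lessThan_atLeast0)
  also have "\<dots> = (\<Sum>k<n. if k = Suc j then Q $$ (i, k) else 0)"
    by (rule sum.cong) (use assms in \<open>auto simp: U_col\<close>)
  finally show ?thesis using assms by simp
qed

text \<open>Right multiplication by a companion matrix shifts columns, so the intertwining relation
  is a recursion that determines \<open>R\<close> from its first column.\<close>

lemma intertwine_cols: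
  assumes R: "R \<in> carrier_mat n n" and eq: "V * R = R * U" and V: "lev V \<beta>" and j: "j < n"
  shows "evl (\<lambda>i. R $$ (i, j)) \<alpha> = evl (\<lambda>i. R $$ (i, 0)) \<alpha> * \<beta> ^ j"
  using j
proof (induction j)
  case (Suc j)
  have "evl (\<lambda>i. R $$ (i, Suc j)) \<alpha> = evl (\<lambda>i. (R * U) $$ (i, j)) \<alpha>"
    unfolding evl_def by (rule sum.cong) (use Suc mult_U_col[OF R] in auto)
  also have "\<dots> = \<beta> * evl (\<lambda>i. R $$ (i, j)) \<alpha>"
    unfolding eq[symmetric] using evl_mult_lev[OF V R, of j] Suc by simp
  finally show ?case using Suc by (simp add: mult_ac)
qed simp

text \<open>The centraliser of \<open>U\<close> is the field itself: a commuting matrix is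
  multiplication by the image of the basis vector 1.\<close>

lemma commute_lev:
  assumes "Q \<in> carrier_mat n n" "U * Q = Q * U"
  shows "lev Q (evl (\<lambda>i. Q $$ (i, 0)) \<alpha>)"
  unfolding lev_def using intertwine_cols[OF assms lev_U] assms(1) by blast

lemma lev_commute: "lev Q x \<Longrightarrow> U * Q = Q * U"
  using lev_unique lev_mult lev_U by (metis mult.commute)

lemma lev_det_nonzero:
  assumes "lev Q x" "x \<noteq> 0"
  shows "det Q \<noteq> 0"
proof -
  have "inverse x \<in> L" using lev_L[OF assms(1)] by (simp add: power_inverse)
  then have "lev (Q * mmat (inverse x)) (x * inverse x)"
    using assms(1) lev_mmat lev_mult by blast
  then have "Q * mmat (inverse x) = 1\<^sub>m n" using assms(2) lev_one lev_unique by simp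
  then have "det Q * det (mmat (inverse x)) = 1"
    using det_mult[of Q n "mmat (inverse x)"] assms(1) lev_mmat[OF \<open>inverse x \<in> L\<close>] by (simp add: lev_def)
  then show ?thesis by auto
qed

lemma U_pow_q: "U ^\<^sub>m q = 1\<^sub>m n"
  using lev_pow[OF lev_U, of q] lev_one lev_unique \<alpha>[of q] by simp

text \<open>The matrix is multiplication by \<open>\<alpha> ^ i - 1\<close>, a nonzero field
  element.\<close>

lemma U_fixed_point_free: "\<not> q dvd i \<Longrightarrow> det (U ^\<^sub>m i - 1\<^sub>m n) \<noteq> 0"
  using lev_det_nonzero[OF lev_diff[OF lev_pow[OF lev_U, of i] lev_one]] \<alpha>[of i] by simp

text \<open>The centraliser is a field, where 1 has only the square roots 1 and -1.\<close>

lemma U_involution: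
  assumes "Q \<in> carrier_mat n n" "U * Q = Q * U" "Q * Q = 1\<^sub>m n"
  shows "Q = 1\<^sub>m n \<or> Q = (-1) \<cdot>\<^sub>m 1\<^sub>m n"
proof -
  obtain x where x: "lev Q x" using commute_lev[OF assms(1,2)] by blast
  then have "lev (1\<^sub>m n) (x * x)" using lev_mult[OF x x] assms(3) by simp
  then have "x * x = 1" using lev_one n by (auto simp: lev_def)
  then have "x = 1 \<or> x = -1" by (metis square_eq_1_iff)
  moreover have "lev ((-1) \<cdot>\<^sub>m 1\<^sub>m n) (-1)"
    using lev_smult[OF lev_one, of "-1"] by simp
  ultimately show ?thesis
    using lev_unique[OF x] lev_one by metis
qed

text \<open>\<open>U\<close> is conjugate to its power \<open>U ^ \<gamma>\<close>, so
  \<open>\<alpha> ^ \<gamma>\<close> satisfies the minimal equation of \<open>\<alpha>\<close>. The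
  roots of that equation are the Frobenius conjugates of \<open>\<alpha>\<close>.\<close>

lemma U_galois:
  assumes Q: "Q \<in> carrier_mat n n" "det Q \<noteq> 0" "U * Q = Q * U ^\<^sub>m \<gamma>"
  shows "\<exists>j<n. int q dvd int \<gamma> - int (CARD('p) ^ j)"
proof -
  obtain R where R: "R \<in> carrier_mat n n" "Q * R = 1\<^sub>m n" "R * Q = 1\<^sub>m n"
    using inverse_mat_obtain[OF Q(1,2)] by metis
  let ?V = "U ^\<^sub>m \<gamma>" and ?\<beta> = "\<alpha> ^ \<gamma>"
  have V: "?V \<in> carrier_mat n n" "lev ?V ?\<beta>" using lev_pow[OF lev_U] by (auto simp: lev_def)
  have "?V * R = R * Q * ?V * R" using R left_mult_one_mat[OF V(1)] by simp
  also have "\<dots> = R * (Q * ?V) * R" by (simp only: assoc_mult_mat[OF R(1) Q(1) V(1)])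
  also have "\<dots> = R * (U * Q) * R" by (simp only: Q(3))
  also have "\<dots> = R * (U * Q * R)" by (simp only: assoc_mult_mat[OF R(1) mult_carrier_mat[OF U_carrier Q(1)] R(1)])
  also have "\<dots> = R * U" using R(2) U_carrier by (simp add: assoc_mult_mat[OF U_carrier Q(1) R(1)])
  finally have VR: "?V * R = R * U" .
  define r where "r = evl (\<lambda>i. R $$ (i, 0)) \<alpha>"
  have cols: "evl (\<lambda>i. R $$ (i, j)) \<alpha> = r * ?\<beta> ^ j" if "j < n" for j
    using intertwine_cols[OF R(1) VR V(2) that] by (simp add: r_def)
  have r0: "r \<noteq> 0"
  proof
    assume "r = 0"
    then have "R $$ (i, j) = 0" if "i < n" "j < n" for i j
      using cols[OF that(2)] evl_zero[of "\<lambda>i. R $$ (i, j)" i] that by simp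
    then have "R = 0\<^sub>m n n" using R(1) by (intro eq_matI) auto
    then have "1\<^sub>m n = (0\<^sub>m n n :: 'p mod_ring mat)" using R(2) Q(1) by simp
    then have "(1\<^sub>m n :: 'p mod_ring mat) $$ (0, 0) = 0\<^sub>m n n $$ (0, 0)" by simp
    then show False using n by simp
  qed
  \<comment> \<open>The last column of the companion matrix expresses \<open>\<alpha> ^ n\<close> in
    lower powers; the same column in the relation for \<open>R\<close> gives the same equation for
    \<open>\<alpha> ^ \<gamma>\<close>.\<close>
  define c where "c = (\<lambda>i. U $$ (i, n - 1))"
  have "evl c \<alpha> = \<alpha> * \<alpha> ^ (n - 1)" using lev_U n by (simp add: lev_def c_def)
  then have c\<alpha>: "evl c \<alpha> = \<alpha> ^ n" using n by (simp add: power_Suc[symmetric] del: power_Suc)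
  have "?\<beta> * (r * ?\<beta> ^ (n - 1)) = evl (\<lambda>i. (?V * R) $$ (i, n - 1)) \<alpha>"
    using evl_mult_lev[OF V(2) R(1), of "n - 1"] cols[of "n - 1"] n by simp
  also have "\<dots> = (\<Sum>k<n. evl (\<lambda>i. R $$ (i, k)) \<alpha> * to_ac (c k))"
    unfolding VR c_def using evl_mult_col[OF R(1) U_carrier, of "n - 1"] n by simp
  also have "\<dots> = (\<Sum>k<n. r * (to_ac (c k) * ?\<beta> ^ k))"
    by (rule sum.cong) (simp_all add: cols)
  also have "\<dots> = r * evl c ?\<beta>"
    by (simp add: evl_def sum_distrib_left)
  finally have "r * evl c ?\<beta> = r * (?\<beta> * ?\<beta> ^ (n - 1))"
    by (metis mult.left_commute)
  then have c\<beta>: "evl c ?\<beta> = ?\<beta> ^ n" using r0 n by (simp add: power_Suc[symmetric] del: power_Suc)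
  \<comment> \<open>The characteristic polynomial read off the companion matrix.\<close>
  let ?P = "Polynomial.monom 1 n + (\<Sum>i<n. Polynomial.monom (- to_ac (c i)) i)"
  have P: "poly ?P x = x ^ n - evl c x" for x
    by (simp add: poly_sum Polynomial.poly_monom evl_def sum_negf)
  have deg: "Polynomial.degree ?P = n"
    using degree_evl[of "\<lambda>i. - to_ac (c i)"] Polynomial.degree_monom_eq[of "1 :: 'p mod_ring alg_closure" n]
    by (subst degree_add_eq_left) auto
  then have "?P \<noteq> 0" using n by auto
  moreover have "poly ?P (\<alpha> ^ (CARD('p) ^ j)) = 0" for j
  proof -
    have "evl c (\<alpha> ^ (CARD('p) ^ j)) = (\<alpha> ^ n) ^ (CARD('p) ^ j)" by (simp add: evl_frob c\<alpha>)
    then show ?thesis unfolding P by (simp add: power_mult[symmetric] mult.commute)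
  qed
  moreover have "poly ?P ?\<beta> = 0" unfolding P c\<beta> by simp
  ultimately obtain j where "j < n" "?\<beta> = \<alpha> ^ (CARD('p) ^ j)"
    using roots_conj(2)[of ?P ?\<beta>] deg by blast
  then show ?thesis unfolding alpha_pow_eq_iff by blast
qed

text \<open>The determinant is the norm of \<open>x\<close>: the Vandermonde matrix of the
  conjugates of \<open>\<alpha>\<close> diagonalises multiplication by \<open>x\<close>, with the
  conjugates of \<open>x\<close> as eigenvalues.\<close>

lemma det_lev:
  assumes Q: "lev Q x"
  shows "to_ac (det Q) = x ^ (\<Sum>j<n. CARD('p) ^ j)"
proof -
  define V where "V = mat n n (\<lambda>(j, i). (\<alpha> ^ (CARD('p) ^ j)) ^ i)"
  define D where "D = mat n n (\<lambda>(j, i). if i = j then x ^ (CARD('p) ^ j) else 0)"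
  have Qc: "Q \<in> carrier_mat n n" using Q by (simp add: lev_def)
  have carr: "V \<in> carrier_mat n n" "D \<in> carrier_mat n n" "map_mat to_ac Q \<in> carrier_mat n n"
    using Qc by (simp_all add: V_def D_def)
  have "V * map_mat to_ac Q = D * V"
  proof (rule eq_matI)
    fix j k assume "j < dim_row (D * V)" "k < dim_col (D * V)"
    then have jk: "j < n" "k < n" using carr by auto
    have "(V * map_mat to_ac Q) $$ (j, k) = (\<Sum>i<n. (\<alpha> ^ (CARD('p) ^ j)) ^ i * to_ac (Q $$ (i, k)))"
      using jk Qc by (simp add: V_def scalar_prod_def lessThan_atLeast0)
    also have "\<dots> = evl (\<lambda>i. Q $$ (i, k)) (\<alpha> ^ (CARD('p) ^ j))" by (simp add: evl_def mult.commute)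
    also have "\<dots> = (x * \<alpha> ^ k) ^ (CARD('p) ^ j)" using Q jk by (simp add: evl_frob lev_def)
    also have "\<dots> = x ^ (CARD('p) ^ j) * (\<alpha> ^ (CARD('p) ^ j)) ^ k"
      by (simp add: power_mult_distrib power_mult[symmetric] mult.commute)
    also have "\<dots> = (\<Sum>i<n. (if i = j then x ^ (CARD('p) ^ j) else 0) * (\<alpha> ^ (CARD('p) ^ i)) ^ k)"
      using jk by (simp add: if_distrib[of "\<lambda>y. y * _"] cong: if_cong)
    also have "\<dots> = (D * V) $$ (j, k)"
      using jk by (simp add: D_def V_def scalar_prod_def lessThan_atLeast0)
    finally show "(V * map_mat to_ac Q) $$ (j, k) = (D * V) $$ (j, k)" .
  qed (use carr in auto)
  then have "det V * det (map_mat to_ac Q) = det D * det V"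
    using carr by (metis det_mult)
  moreover have "det V \<noteq> 0"
  proof
    assume "det V = 0"
    then obtain v where v: "v \<in> carrier_vec n" "v \<noteq> 0\<^sub>v n" "V *\<^sub>v v = 0\<^sub>v n"
      using det_0_iff_vec_prod_zero[OF carr(1)] by blast
    have v0: "v $ i = 0" if i: "i < n" for i
    proof (rule coeffs_zero[where a = "\<lambda>i. v $ i", OF _ i])
      fix j assume j: "j < n"
      have "(V *\<^sub>v v) $ j = (\<Sum>i<n. (\<alpha> ^ (CARD('p) ^ j)) ^ i * v $ i)"
        using j v(1) by (simp add: V_def scalar_prod_def lessThan_atLeast0)
      then show "(\<Sum>i<n. v $ i * (\<alpha> ^ (CARD('p) ^ j)) ^ i) = 0"
        using v(3) j by (simp add: mult.commute)
    qed
    have "v = 0\<^sub>v n" using v(1) v0 by (intro eq_vecI) auto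
    then show False using v(2) by simp
  qed
  ultimately have "det (map_mat to_ac Q) = det D" by simp
  moreover have "det (map_mat to_ac Q) = to_ac (det Q)"
  proof -
    interpret comm_ring_hom "to_ac :: 'p mod_ring \<Rightarrow> _" by unfold_locales auto
    show ?thesis by simp
  qed
  moreover have "det D = (\<Prod>j<n. x ^ (CARD('p) ^ j))"
  proof -
    have "upper_triangular D" by (auto simp: upper_triangular_def D_def)
    then have "det D = prod_list (diag_mat D)" using det_upper_triangular carr(2) by blast
    also have "\<dots> = (\<Prod>j<n. D $$ (j, j))"
      using carr(2) by (simp add: prod_list_diag_prod lessThan_atLeast0)
    finally show ?thesis by (simp add: D_def)
  qed
  ultimately show ?thesis by (simp add: power_sum)
qed

text \<open>Multiplication by a generator \<open>g\<close> has determinant the norm of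
  \<open>g\<close>. Were it a square in the prime field, its power with exponent (p-1)/2 would be 1,
  so \<open>g\<close> would have order at most (p^n - 1)/2.\<close>

lemma U_nonsquare_det:
  "\<exists>Q. Q \<in> carrier_mat n n \<and> U * Q = Q * U \<and> det Q \<noteq> 0 \<and> \<not> (\<exists>x. det Q = x ^ 2)" if "odd CARD('p)"
proof -
  obtain g :: "'p mod_ring alg_closure" where g: "\<And>i. g ^ i = 1 \<longleftrightarrow> (CARD('p) ^ n - 1) dvd i"
    using exists_primitive_root[OF n, where ?'p = 'p] by blast
  have "g ^ (CARD('p) ^ n) = g ^ (CARD('p) ^ n - 1) * g" using pn_gt_1 by (simp add: power_Suc2[symmetric] del: power_Suc2)
  then have gL: "g \<in> L" using g[of "CARD('p) ^ n - 1"] by simp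
  have g0: "g \<noteq> 0" using g[of "CARD('p) ^ n - 1"] pn_gt_1 by (auto simp: power_0_left)
  let ?Q = "mmat g"
  have Q: "lev ?Q g" using lev_mmat[OF gL] .
  have "\<not> (\<exists>x. det ?Q = x ^ 2)"
  proof
    assume "\<exists>x. det ?Q = x ^ 2"
    then obtain x where x: "det ?Q = x ^ 2" by blast
    have "x \<noteq> 0" using lev_det_nonzero[OF Q g0] x by auto
    have e: "(\<Sum>j<n. CARD('p) ^ j) * (CARD('p) - 1) = CARD('p) ^ n - 1"
    proof -
      have "int ((\<Sum>j<n. CARD('p) ^ j) * (CARD('p) - 1)) = (int CARD('p) - 1) * (\<Sum>j<n. int CARD('p) ^ j)"
        using p_gt_1 by (simp add: of_nat_diff mult.commute)
      also have "\<dots> = int CARD('p) ^ n - 1" by (rule power_diff_1_eq[symmetric])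
      also have "\<dots> = int (CARD('p) ^ n - 1)" using pn_gt_1 by (simp add: of_nat_diff)
      finally show ?thesis by (simp only: of_nat_eq_iff)
    qed
    have half: "2 * ((CARD('p) - 1) div 2) = CARD('p) - 1" using that by simp
    have "x ^ CARD('p) = x" using finite_field_power_card_eq_same[of x] by simp
    then have "x ^ (CARD('p) - 1) * x = 1 * x" using p_gt_1 by (simp add: power_Suc2[symmetric] del: power_Suc2)
    then have x1: "x ^ (CARD('p) - 1) = 1" using \<open>x \<noteq> 0\<close> by (metis mult_right_cancel)
    have "g ^ ((\<Sum>j<n. CARD('p) ^ j) * ((CARD('p) - 1) div 2)) = to_ac (x ^ 2) ^ ((CARD('p) - 1) div 2)"
      by (simp only: power_mult det_lev[OF Q, symmetric] x)
    also have "\<dots> = to_ac (x ^ (CARD('p) - 1))"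
      by (simp only: to_ac_power[symmetric] power_mult[symmetric] half)
    also have "\<dots> = 1" by (simp only: x1 to_ac_1)
    finally have "(CARD('p) ^ n - 1) dvd (\<Sum>j<n. CARD('p) ^ j) * ((CARD('p) - 1) div 2)"
      by (simp only: g)
    moreover have "2 * ((\<Sum>j<n. CARD('p) ^ j) * ((CARD('p) - 1) div 2)) = CARD('p) ^ n - 1"
      using e half by (metis mult.left_commute)
    moreover have "CARD('p) ^ n - 1 > 0" using pn_gt_1 by simp
    ultimately show False
      by (metis dvd_imp_le less_numeral_extra(3) mult_2 nat_0_less_mult_iff add_le_same_cancel1 not_le)
  qed
  then show ?thesis
    using Q lev_commute[OF Q] lev_det_nonzero[OF Q g0] by (intro exI[of _ ?Q]) (simp add: lev_def)
qed

end

section \<open>The odd part of $p^h+1$\<close>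

text \<open>The cofactor is 1 - y + y^2 - ... + y^(e-1), an odd number of odd terms; the alternating
  signs are the reason for computing in the integers.\<close>

lemma odd_power_plus_one_factor:
  fixes y e :: nat
  assumes "odd y" "odd e"
  shows "\<exists>S. odd S \<and> y ^ e + 1 = (y + 1) * S"
proof -
  define T where "T = (\<Sum>t<e. (- int y) ^ t)"
  have "even (\<Sum>t<k. (- int y) ^ t) \<longleftrightarrow> even k" for k
    by (induction k) (use assms(1) in auto)
  then have "odd T" using assms(2) by (simp add: T_def)
  have "1 - (- int y) ^ e = (1 - (- int y)) * T"
    unfolding T_def by (rule one_diff_power_eq)
  then have eq: "int (y ^ e + 1) = int (y + 1) * T"
    using assms(2) by (simp add: power_minus_odd algebra_simps)
  have "int (y + 1) * T > 0" unfolding eq[symmetric] by (simp add: add_pos_nonneg)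
  then have "T > 0" by (simp add: zero_less_mult_iff)
  then have "int (y ^ e + 1) = int ((y + 1) * nat T)" unfolding of_nat_mult eq by simp
  then have "y ^ e + 1 = (y + 1) * nat T" by (simp only: of_nat_eq_iff)
  moreover have "odd (nat T)" using \<open>odd T\<close> \<open>T > 0\<close> by (simp add: even_nat_iff)
  ultimately show ?thesis by blast
qed

lemma odd_dvd_two_power: "odd (S::nat) \<Longrightarrow> S dvd 2 ^ x \<Longrightarrow> S = 1"
  by (metis coprime_left_2_iff_odd coprime_power_right_iff coprime_commute coprime_absorb_left nat_dvd_1_iff_1)

locale plus_one =
  fixes p h q x :: nat
  assumes p: "p > 1" "odd p" and h: "h > 0" and q: "p ^ h + 1 = 2 ^ x * q" "odd q" "q > 1"
begin

lemma q_dvd: "q dvd p ^ h + 1"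
  using q(1) by simp

text \<open>A common divisor divides both p^h - 1 and p^h + 1, hence 2, and it is odd.\<close>

lemma coprime_q_p_minus_1: "coprime q (p - 1)"
proof (rule coprimeI)
  fix c assume c: "c dvd q" "c dvd p - 1"
  have "int p - 1 dvd int p ^ h - 1" by (metis dvd_triv_left power_diff_1_eq)
  then have "int c dvd int p ^ h - 1"
    using c(2) p by (metis dvd_trans int_dvd_int_iff less_imp_le_nat of_nat_1 of_nat_diff)
  moreover have "int c dvd int p ^ h + 1"
    using dvd_trans[OF c(1) q_dvd] by (metis int_dvd_int_iff of_nat_1 of_nat_add of_nat_power)
  ultimately have "int c dvd (int p ^ h + 1) - (int p ^ h - 1)" by (rule dvd_diff[rotated])
  then have "int c dvd 2" by simp
  then have c2: "c dvd 2 ^ 1" by (metis int_dvd_int_iff of_nat_numeral power_one_right)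
  have "odd c" using c(1) q(2) by (metis dvd_trans)
  from odd_dvd_two_power[OF this c2] show "is_unit c" by simp
qed

lemma coprime_p_q: "coprime p q"
proof (rule coprimeI)
  fix c assume c: "c dvd p" "c dvd q"
  have "c dvd p ^ h" using c(1) h by (metis dvd_power dvd_trans)
  moreover have "c dvd p ^ h + 1" using dvd_trans[OF c(2) q_dvd] .
  ultimately show "is_unit c" by (simp only: dvd_add_right_iff)
qed

text \<open>p^h is -1 modulo q, so the order d divides 2h but not h, and 2h = d e with e odd.
  Writing d = 2i, also p^i is -1 modulo q. The odd cofactor of p^i + 1 in p^h + 1 then divides a
  power of 2, because q is the whole odd part; so it is 1 and i = h.\<close>

lemma ord_p: "ord q p = 2 * h"
proof -
  define d where "d = ord q p"
  have m1: "[int p ^ h = -1] (mod int q)"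
    using q_dvd unfolding cong_iff_dvd_diff by (metis diff_minus_eq_add int_dvd_int_iff of_nat_1 of_nat_add of_nat_power)
  have d: "[int p ^ j = 1] (mod int q) \<longleftrightarrow> d dvd j" for j
  proof -
    have "[p ^ j = 1] (mod q) \<longleftrightarrow> d dvd j" unfolding d_def by (rule ord_divides)
    then show ?thesis by (metis cong_int_iff of_nat_1 of_nat_power)
  qed
  have "[int p ^ h * int p ^ h = (-1) * (-1)] (mod int q)" using m1 m1 by (rule cong_mult)
  then have "[int p ^ (2 * h) = 1] (mod int q)" by (simp add: mult_2 power_add)
  then have d2h: "d dvd 2 * h" using d by simp
  have ndh: "\<not> d dvd h"
  proof
    assume "d dvd h"
    then have "[int p ^ h = 1] (mod int q)" using d by simp
    then have "[1 = -1] (mod int q)" using m1 cong_trans cong_sym by blast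
    then have "int q dvd 2" by (simp add: cong_iff_dvd_diff)
    then have "q dvd 2 ^ 1" by (metis int_dvd_int_iff of_nat_numeral power_one_right)
    from odd_dvd_two_power[OF q(2) this] show False using q(3) by simp
  qed
  obtain e where e: "2 * h = d * e" using d2h by blast
  have odd_e: "odd e"
  proof
    assume "even e"
    then obtain e' where "e = 2 * e'" by blast
    then have "h = d * e'" using e by simp
    then show False using ndh by simp
  qed
  then have "even d" using e by (metis even_mult_iff dvd_triv_left)
  then obtain i where i: "d = 2 * i" by blast
  then have hie: "h = i * e" using e by simp
  have "[(int p ^ i) ^ (e - 1) = 1] (mod int q)"
  proof -
    obtain e' where "e = 2 * e' + 1" using odd_e by (rule oddE)
    then have "i * (e - 1) = d * e'" using i by simp
    then have "[int p ^ (i * (e - 1)) = 1] (mod int q)" using d by simp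
    then show ?thesis by (simp only: power_mult)
  qed
  then have "[(int p ^ i) ^ (e - 1) * int p ^ i = 1 * int p ^ i] (mod int q)" by (rule cong_mult) simp
  moreover have "(int p ^ i) ^ (e - 1) * int p ^ i = int p ^ h"
    using odd_e hie by (metis odd_pos power_minus_mult power_mult)
  ultimately have "[int p ^ i = -1] (mod int q)" using m1 by (metis cong_sym cong_trans mult_1)
  then have "int q dvd int p ^ i + 1" by (simp add: cong_iff_dvd_diff)
  then have "q dvd p ^ i + 1" by (metis int_dvd_int_iff of_nat_1 of_nat_add of_nat_power)
  then obtain w where w: "p ^ i + 1 = q * w" by blast
  obtain S where S: "odd S" "(p ^ i) ^ e + 1 = (p ^ i + 1) * S"
    using odd_power_plus_one_factor[of "p ^ i" e] p(2) odd_e by auto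
  have "2 ^ x * q = (p ^ i) ^ e + 1" unfolding q(1)[symmetric] hie power_mult by simp
  also have "\<dots> = (w * S) * q" unfolding S(2) w by (simp add: mult_ac)
  finally have "2 ^ x = w * S" using q(3) by simp
  then have "S = 1" by (intro odd_dvd_two_power[OF S(1), of x]) simp
  then have "p ^ (i * e) = p ^ i" using S(2) by (simp add: power_mult)
  then have "i * e = i" using p(1) by simp
  then have "i = h" using hie h by auto
  then show ?thesis using i d_def by simp
qed

lemma q_dvd_iff: "q dvd p ^ j - 1 \<longleftrightarrow> 2 * h dvd j"
proof -
  have "p ^ j \<ge> 1" using p(1) by simp
  then have "q dvd p ^ j - 1 \<longleftrightarrow> [p ^ j = 1] (mod q)"
    by (metis cong_altdef_nat cong_sym_eq)
  then show ?thesis using ord_divides[of p j q] ord_p by simp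
qed

text \<open>A composite \<open>q\<close> has further square roots of 1, but not among the powers of
  p: p^(2j) = 1 forces \<open>h\<close> to divide \<open>j\<close>, which leaves p^0 = 1 and p^h =
  -1.\<close>

lemma square_root_of_one:
  assumes "j < 2 * h" "int q dvd int g - int (p ^ j)" "int q dvd int g * int g - 1"
  shows "int q dvd int g - 1 \<or> int q dvd int g + 1"
proof -
  have g: "[int g = int p ^ j] (mod int q)" using assms(2) by (simp add: cong_iff_dvd_diff)
  have "[int g * int g = int p ^ j * int p ^ j] (mod int q)" using g g by (rule cong_mult)
  moreover have "[int g * int g = 1] (mod int q)" using assms(3) by (simp add: cong_iff_dvd_diff)
  ultimately have "[int p ^ (2 * j) = 1] (mod int q)"
    by (metis cong_sym cong_trans mult_2 power_add)
  then have "[p ^ (2 * j) = 1] (mod q)" by (metis cong_int_iff of_nat_1 of_nat_power)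
  then have "2 * h dvd 2 * j" using ord_divides[of p "2 * j" q] ord_p by simp
  then have "h dvd j" by simp
  then have "j = 0 \<or> j = h" using assms(1) by (auto elim!: dvdE)
  then show ?thesis
  proof
    assume "j = h"
    then have "int q dvd int g - int (p ^ h)" using assms(2) by simp
    moreover have "int q dvd int (p ^ h + 1)" using q_dvd by (simp only: int_dvd_int_iff)
    ultimately have "int q dvd (int g - int (p ^ h)) + int (p ^ h + 1)" by (rule dvd_add)
    then show ?thesis by simp
  qed (use assms(2) in simp)
qed

end

text \<open>For even h, p^h + 1 is 2 modulo 4 and exceeds 2. For odd h the cofactor of p + 1 is odd
  and divides a power of 2, hence is 1.\<close>

lemma power_plus_one_two_power:
  fixes p h x :: nat
  assumes "p > 1" "odd p" "h > 0" "p ^ h + 1 = 2 ^ x"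
  shows "h = 1 \<and> 4 dvd p + 1"
proof -
  have "x \<ge> 2"
  proof (rule ccontr)
    assume "\<not> x \<ge> 2"
    then have "x = 0 \<or> x = 1" by auto
    then have "p ^ h + 1 \<le> 2" unfolding assms(4) by auto
    then have "p ^ h \<le> 1" by simp
    moreover have "p ^ h > 1" using one_less_power[OF assms(1,3)] .
    ultimately show False by simp
  qed
  then have four: "4 dvd p ^ h + 1"
    unfolding assms(4) using le_imp_power_dvd[of 2 x "2::nat"] by simp
  have odd_h: "odd h"
  proof
    assume "even h"
    then obtain h' where "h = 2 * h'" by blast
    then have h': "p ^ h = (p ^ h') * (p ^ h')" by (simp add: mult_2 power_add)
    have "odd (p ^ h')" using assms(2) by simp
    then obtain y where y: "p ^ h' = 2 * y + 1" by (rule oddE)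
    have "p ^ h + 1 = 4 * (y * y + y) + 2" unfolding h' y by (simp add: algebra_simps)
    then show False using four by presburger
  qed
  obtain S where S: "odd S" "p ^ h + 1 = (p + 1) * S"
    using odd_power_plus_one_factor[OF assms(2) odd_h] by blast
  have "S dvd 2 ^ x" unfolding assms(4)[symmetric] S(2) by simp
  then have "S = 1" by (rule odd_dvd_two_power[OF S(1)])
  then have "p ^ h = p ^ 1" using S(2) by simp
  then have "h = 1" using assms(1) by (simp only: power_inject_exp)
  then show ?thesis using four by simp
qed

lemma odd_part: "(m::nat) > 0 \<Longrightarrow> \<exists>x q. m = 2 ^ x * q \<and> odd q"
  by (rule multiplicity_decompose'[of m 2]) auto

section \<open>Block computations and matrices without eigenvalue 1\<close>

lemma block_decomposition:
  assumes "x \<in> carrier_mat (m + n) (m + n)"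
  obtains A B C D where "A \<in> carrier_mat m m" "B \<in> carrier_mat m n" "C \<in> carrier_mat n m" "D \<in> carrier_mat n n"
    "x = four_block_mat A B C D"
proof
  show "x = four_block_mat (mat m m (\<lambda>(i, j). x $$ (i, j))) (mat m n (\<lambda>(i, j). x $$ (i, j + m)))
      (mat n m (\<lambda>(i, j). x $$ (i + m, j))) (mat n n (\<lambda>(i, j). x $$ (i + m, j + m)))"
    using assms by (intro eq_matI) auto
qed auto

lemma bdiag_four_block_mult:
  assumes "P \<in> carrier_mat m m" "Q \<in> carrier_mat n n"
    "A \<in> carrier_mat m m" "B \<in> carrier_mat m n" "C \<in> carrier_mat n m" "D \<in> carrier_mat n n"
  shows "bdiag P Q * four_block_mat A B C D = four_block_mat (P * A) (P * B) (Q * C) (Q * (D :: 'a :: comm_ring_1 mat))"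
    and "four_block_mat A B C D * bdiag P Q = four_block_mat (A * P) (B * Q) (C * P) (D * Q)"
  using assms unfolding bdiag_def
  by (subst mult_four_block_mat[where ?nr1.0 = m and ?n1.0 = m and ?n2.0 = n and ?nr2.0 = n and ?nc1.0 = m and ?nc2.0 = n];
      auto intro!: cong_four_block_mat)+

text \<open>The invertible matrix \<open>V - 1\<close> annihilates \<open>C\<close>.\<close>

lemma fixed_left_zero:
  assumes "V \<in> carrier_mat n n" "det (V - 1\<^sub>m n) \<noteq> 0" "C \<in> carrier_mat n m" "V * C = (C :: 'a :: field mat)"
  shows "C = 0\<^sub>m n m"
proof -
  have c: "V - 1\<^sub>m n \<in> carrier_mat n n" using assms(1) by auto
  obtain R where R: "R \<in> carrier_mat n n" "R * (V - 1\<^sub>m n) = 1\<^sub>m n"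
    using inverse_mat_obtain[OF c assms(2)] by metis
  have "(V - 1\<^sub>m n) * C = V * C - 1\<^sub>m n * C" by (rule minus_mult_distrib_mat[OF assms(1) _ assms(3)]) simp
  also have "\<dots> = 0\<^sub>m n m" using assms(3,4) by auto
  finally have "R * ((V - 1\<^sub>m n) * C) = 0\<^sub>m n m" using R(1) by simp
  then show ?thesis
    using assms(3) R by (simp add: assoc_mult_mat[OF R(1) c assms(3), symmetric])
qed

lemma fixed_right_zero:
  assumes "V \<in> carrier_mat n n" "det (V - 1\<^sub>m n) \<noteq> 0" "B \<in> carrier_mat m n" "B * V = (B :: 'a :: field mat)"
  shows "B = 0\<^sub>m m n"
proof -
  have c: "V - 1\<^sub>m n \<in> carrier_mat n n" using assms(1) by auto
  obtain R where R: "R \<in> carrier_mat n n" "(V - 1\<^sub>m n) * R = 1\<^sub>m n"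
    using inverse_mat_obtain[OF c assms(2)] by metis
  have "B * (V - 1\<^sub>m n) = B * V - B * 1\<^sub>m n" by (rule mult_minus_distrib_mat[OF assms(3,1)]) simp
  also have "\<dots> = 0\<^sub>m m n" using assms(3,4) by auto
  finally have "B * (V - 1\<^sub>m n) * R = 0\<^sub>m m n" using R(1) by simp
  then show ?thesis
    using assms(3) R by (simp add: assoc_mult_mat[OF assms(3) c R(1)])
qed

lemma mat_pow_cancel:
  assumes A: "A \<in> carrier_mat n n" "A ^\<^sub>m N = (1\<^sub>m n :: 'a :: comm_ring_1 mat)" and N: "N > 0"
    and eq: "A ^\<^sub>m i = A ^\<^sub>m j" and le: "i \<le> j"
  shows "A ^\<^sub>m (j - i) = 1\<^sub>m n"
proof -
  have pow1: "A ^\<^sub>m (N * i) = 1\<^sub>m n" using A by (simp add: pow_mat_mult)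
  have "i * (N - 1) + i = N * i" using N by (cases N) (auto simp: algebra_simps)
  then have "1\<^sub>m n = A ^\<^sub>m (i * (N - 1)) * A ^\<^sub>m i"
    using pow1 A(1) by (simp add: pow_mat_add[symmetric])
  also have "\<dots> = A ^\<^sub>m (i * (N - 1)) * A ^\<^sub>m j" by (simp only: eq)
  also have "\<dots> = A ^\<^sub>m (i * (N - 1) + i + (j - i))"
    using A(1) le by (simp add: pow_mat_add[symmetric])
  also have "\<dots> = A ^\<^sub>m (N * i) * A ^\<^sub>m (j - i)"
    using \<open>i * (N - 1) + i = N * i\<close> A(1) by (simp only: pow_mat_add)
  also have "\<dots> = A ^\<^sub>m (j - i)" using pow1 A(1) left_mult_one_mat[of "A ^\<^sub>m (j - i)" n n] by simp
  finally show ?thesis by simp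
qed

lemma power_coprime_one:
  assumes "s ^ a = 1" "s ^ b = (1 :: 'a :: field)" "coprime a b" "a > 0"
  shows "s = 1"
proof -
  obtain x y where "a * x = b * y + 1"
    using coprime_bezout_strong[of a b] assms(3,4) by (metis bezout_nat coprime_imp_gcd_eq_1 less_numeral_extra(3))
  then have "s ^ (a * x) = s ^ (b * y) * s" by simp
  then show ?thesis using assms(1,2) by (simp add: power_mult)
qed

section \<open>The general case: values of the rational character at u and u z\<close>

text \<open>The properties of \<open>U\<close> that matter, detached from its construction.
  \<open>free\<close> separates the two blocks, \<open>involution\<close> makes -1 the only
  involution of the centraliser, \<open>nonsquare\<close> fuses the additive characters, and
  \<open>galois\<close> makes involutions act freely on the characters of \<open>U\<close>.\<close>

locale field_block =
  fixes n k q :: nat and U :: "'p::prime_card mod_ring mat"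
  assumes n: "n > 0" "even n" and k: "k = n + 2"
    and p: "odd CARD('p)"
    and q: "odd q" "q > 1" "coprime q CARD('p)" "coprime q (CARD('p) - 1)"
    and U: "U \<in> carrier_mat n n" "U ^\<^sub>m q = 1\<^sub>m n"
    and free: "\<And>i. \<not> q dvd i \<Longrightarrow> det (U ^\<^sub>m i - 1\<^sub>m n) \<noteq> 0"
    and involution: "\<And>Q. Q \<in> carrier_mat n n \<Longrightarrow> U * Q = Q * U \<Longrightarrow> Q * Q = 1\<^sub>m n \<Longrightarrow> Q = 1\<^sub>m n \<or> Q = (-1) \<cdot>\<^sub>m 1\<^sub>m n"
    and nonsquare: "\<exists>Q. Q \<in> carrier_mat n n \<and> U * Q = Q * U \<and> det Q \<noteq> 0 \<and> \<not> (\<exists>x. det Q = x ^ 2)"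
    and galois: "\<And>Q \<gamma>. Q \<in> carrier_mat n n \<Longrightarrow> det Q \<noteq> 0 \<Longrightarrow> U * Q = Q * U ^\<^sub>m \<gamma> \<Longrightarrow> int q dvd int \<gamma> * int \<gamma> - 1 \<Longrightarrow>
        int q dvd int \<gamma> - 1 \<or> int q dvd int \<gamma> + 1"
begin

lemma p_gt_2: "CARD('p) > 2"
  using p prime_gt_1_nat[OF prime_card[where ?'a = 'p]] by (cases "CARD('p) = 2") auto

lemma two_nonzero: "(2 :: 'p mod_ring) \<noteq> 0"
proof
  assume "(2 :: 'p mod_ring) = 0"
  then have "(of_nat 2 :: 'p mod_ring) = 0" by simp
  then have "CARD('p) dvd 2" by (rule of_nat_0_mod_ring_dvd)
  then show False using p_gt_2 by (auto dest: dvd_imp_le)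
qed

lemma minus_one_neq_one: "(- 1 :: 'p mod_ring) \<noteq> 1"
proof
  assume "(- 1 :: 'p mod_ring) = 1"
  then have "(1 :: 'p mod_ring) + 1 = 0" by (metis add.left_inverse)
  then show False using two_nonzero by simp
qed

lemma unit_power: "s \<noteq> 0 \<Longrightarrow> s ^ (CARD('p) - 1) = (1 :: 'p mod_ring)"
proof -
  assume s: "s \<noteq> 0"
  have "s ^ (CARD('p) - 1) * s = s ^ CARD('p)"
    using p_gt_2 by (simp add: power_Suc2[symmetric] del: power_Suc2)
  also have "\<dots> = 1 * s" using finite_field_power_card_eq_same[of s] by simp
  finally show ?thesis using s by (metis mult_right_cancel)
qed

lemma U_pow [simp]: "U ^\<^sub>m i \<in> carrier_mat n n"
  using U by simp

text \<open>The order of the determinant divides both \<open>q\<close> and p - 1, which are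
  coprime.\<close>

lemma det_U: "det U = 1"
proof (rule power_coprime_one[OF _ _ q(4)])
  show "det U ^ q = 1" using U det_pow_mat[of U n q] by simp
  then have "det U \<noteq> 0" using q(2) by (auto simp: power_0_left)
  then show "det U ^ (CARD('p) - 1) = 1" by (rule unit_power)
qed (use q in simp)

lemma U_pow_one_iff: "U ^\<^sub>m i = 1\<^sub>m n \<longleftrightarrow> q dvd i"
proof
  assume "U ^\<^sub>m i = 1\<^sub>m n"
  then have "U ^\<^sub>m i - 1\<^sub>m n = 0\<^sub>m n n" by (auto intro!: eq_matI)
  then have "det (U ^\<^sub>m i - 1\<^sub>m n) = 0" using n by simp
  then show "q dvd i" using free by blast
next
  assume "q dvd i"
  then show "U ^\<^sub>m i = 1\<^sub>m n" using U by (auto simp: pow_mat_mult)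
qed

lemma mod_eq_if_dvd_diff: "(i :: nat) \<le> j \<Longrightarrow> a dvd j - i \<Longrightarrow> i mod a = j mod a"
  by (metis mod_eq_iff_dvd_symdiff_nat mod_eq_dvd_iff_nat)

lemma U_pow_eq_iff: "U ^\<^sub>m i = U ^\<^sub>m j \<longleftrightarrow> i mod q = j mod q"
proof
  assume eq: "U ^\<^sub>m i = U ^\<^sub>m j"
  have *: "i mod q = j mod q" if "i \<le> j" "U ^\<^sub>m i = U ^\<^sub>m j" for i j
    using mat_pow_cancel[OF U _ that(2,1)] q that(1) by (simp add: U_pow_one_iff mod_eq_if_dvd_diff)
  show "i mod q = j mod q"
    using *[of i j] *[of j i] eq by (metis nat_le_linear)
next
  assume m: "i mod q = j mod q"
  have "U ^\<^sub>m i = U ^\<^sub>m (i mod q)" for i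
  proof -
    have "U ^\<^sub>m i = U ^\<^sub>m (q * (i div q) + i mod q)" by simp
    also have "\<dots> = (U ^\<^sub>m q) ^\<^sub>m (i div q) * U ^\<^sub>m (i mod q)"
      using U(1) by (simp only: pow_mat_add pow_mat_mult)
    also have "\<dots> = U ^\<^sub>m (i mod q)" using U left_mult_one_mat[OF U_pow] by simp
    finally show ?thesis .
  qed
  then show "U ^\<^sub>m i = U ^\<^sub>m j" using m by metis
qed

text \<open>One generator for \<open>U\<close> and -1 together: as \<open>q\<close> is odd,
  \<open>W ^ q\<close> is -1 and \<open>W ^ (q + 1)\<close> is \<open>U\<close>. This explains the
  exponents in \<open>u\<close> and \<open>z\<close> below.\<close>

definition W :: "'p mod_ring mat" where "W = (- 1) \<cdot>\<^sub>m U"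

lemma W_carrier: "W \<in> carrier_mat n n"
  using U by (simp add: W_def)

lemma W_pow_U: "W ^\<^sub>m i = ((- 1) ^ i) \<cdot>\<^sub>m (U ^\<^sub>m i)"
proof (induction i)
  case (Suc i)
  have "W ^\<^sub>m Suc i = ((- 1) ^ i) \<cdot>\<^sub>m (U ^\<^sub>m i) * ((- 1) \<cdot>\<^sub>m U)" by (simp add: Suc) (simp add: W_def)
  also have "\<dots> = ((- 1) ^ i * (- 1)) \<cdot>\<^sub>m (U ^\<^sub>m i * U)"
    using U by (auto simp: mult_smult_assoc_mat[of _ n n _ n] mult_smult_distrib[of _ n n _ n] intro!: eq_matI)
  finally show ?case by simp
qed (use U in \<open>auto simp: W_def intro!: eq_matI\<close>)

sublocale torus_block n k "2 * q" W
proof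
  show "n > 0" "k = n + 2" "2 * q > 0" "W \<in> carrier_mat n n" using n k q W_carrier by auto
  show "det W = 1" using U n det_U by (simp add: W_def)
  show "W ^\<^sub>m (2 * q) = 1\<^sub>m n"
    using U_pow_one_iff[of "2 * q"] by (auto simp: W_pow_U intro!: eq_matI)
  fix i j
  have *: "i mod (2 * q) = j mod (2 * q)" if "i \<le> j" "W ^\<^sub>m i = W ^\<^sub>m j" for i j
  proof -
    have "W ^\<^sub>m (j - i) = 1\<^sub>m n"
      by (rule mat_pow_cancel[OF W_carrier \<open>W ^\<^sub>m (2 * q) = 1\<^sub>m n\<close> \<open>2 * q > 0\<close> that(2,1)])
    moreover define d where "d = j - i"
    ultimately have Wd: "W ^\<^sub>m d = 1\<^sub>m n" by simp
    have "W ^\<^sub>m (d * q) = 1\<^sub>m n" using W_carrier Wd by (simp add: pow_mat_mult)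
    then have "((- 1) ^ (d * q)) \<cdot>\<^sub>m 1\<^sub>m n = (1\<^sub>m n :: 'p mod_ring mat)"
      using U_pow_one_iff[of "d * q"] by (simp add: W_pow_U)
    then have "(((- 1) ^ (d * q)) \<cdot>\<^sub>m 1\<^sub>m n) $$ (0, 0) = (1\<^sub>m n :: 'p mod_ring mat) $$ (0, 0)" by simp
    then have "(- 1) ^ (d * q) = (1 :: 'p mod_ring)" using n by simp
    then have "even (d * q)" using minus_one_neq_one by (metis neg_one_odd_power)
    then have even: "even d" using q(1) by simp
    then have "U ^\<^sub>m d = 1\<^sub>m n" using Wd by (simp add: W_pow_U)
    then have "q dvd d" by (simp add: U_pow_one_iff)
    then have "2 * q dvd d" using even q(1) by (simp add: divides_mult)
    then show ?thesis using that(1) by (simp add: d_def mod_eq_if_dvd_diff)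
  qed
  then show "W ^\<^sub>m i = W ^\<^sub>m j \<Longrightarrow> i mod (2 * q) = j mod (2 * q)"
    by (metis nat_le_linear)
qed

lemma W_q: "W ^\<^sub>m q = (- 1) \<cdot>\<^sub>m 1\<^sub>m n"
  using U(2) q(1) by (simp add: W_pow_U)

lemma W_q1: "W ^\<^sub>m (Suc q) = U"
proof -
  have "U ^\<^sub>m Suc q = U" using U by simp
  then show ?thesis using q(1) unfolding W_pow_U by simp
qed

lemma W_even: "even i \<Longrightarrow> W ^\<^sub>m i = U ^\<^sub>m i"
  by (simp add: W_pow_U)

lemma bel_1: "bel 1 b i = bdiag (upper2 1 b 1) (W ^\<^sub>m i)"
  by (simp add: bel_def)

definition "u = bel 1 1 (Suc q)"
definition "z = bel 1 0 q"

lemma u_eq: "u = bdiag (upper2 1 1 1) U"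
  unfolding u_def bel_1 W_q1 ..

lemma uz_eq: "u * z = bel 1 1 1"
proof -
  have "u * z = bel 1 1 (Suc (2 * q))" by (simp add: u_def z_def bel_mult mult_2)
  also have "\<dots> = bel 1 1 (Suc (2 * q) mod (2 * q))" by (simp only: bel_mod)
  also have "Suc (2 * q) mod (2 * q) = 1" using q(2) by (simp add: mod_Suc)
  finally show ?thesis by simp
qed

lemma u_G: "u \<in> carrier G" and z_G: "z \<in> carrier G"
  by (simp_all add: u_def z_def bel_carrier)

text \<open>The elements that conjugate \<open>u\<close> into \<open>B\<close>. They turn out to be
  the same for \<open>u * z\<close>, so that the two values of the character differ only in
  sign.\<close>

definition M :: "'p mod_ring mat set" where
  "M = {bdiag (upper2 a b d) Q |a b d Q. Q \<in> carrier_mat n n \<and> a * d * det Q = 1 \<and> (\<exists>\<gamma>. U * Q = Q * U ^\<^sub>m \<gamma>)}"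

text \<open>Powers of \<open>u\<close> isolate the constraints one at a time: the
  \<open>p * q\<close>-th power removes the scalar, the \<open>p\<close>-th power forces block
  diagonal form, and \<open>u\<close> itself forces the shape of the blocks.\<close>

lemma conj_u_imp_M:
  assumes x: "x \<in> carrier G" and s: "s ^ k = 1" and eq: "u * x = x * bel s b i"
  shows "x \<in> M"
proof -
  have xk: "x \<in> carrier_mat k k" "det x = 1" using x by (auto simp: carrier_G)
  have pow: "u ^\<^sub>m j * x = x * bel (s ^ j) (of_nat j * b) (i * j)" for j
    using pow_mat_intertwine[OF _ _ xk(1) eq, of j] bel_carrier_mat by (simp add: u_def bel_pow)
  \<comment> \<open>Raising the relation to this power gives s^(pq) = s^q = 1, whence s = 1 since
    \<open>q\<close> is coprime to p - 1. It also gives the evenness of \<open>i\<close>.\<close>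
  have "u ^\<^sub>m (CARD('p) * q) = bel 1 0 (Suc q * (CARD('p) * q) mod (2 * q))"
    by (simp add: u_def bel_pow bel_mod)
  also have "Suc q * (CARD('p) * q) mod (2 * q) = 0"
  proof -
    obtain r where "Suc q = 2 * r" using q(1) by (metis even_Suc evenE)
    then show ?thesis by simp
  qed
  finally have upq: "u ^\<^sub>m (CARD('p) * q) = 1\<^sub>m k" by (simp add: bel_one)
  have sG: "bel (s ^ j) c l \<in> carrier G" for j c l
    using s by (simp add: bel_carrier) (metis power_commutes power_mult power_one mult.commute)
  have "x = x * bel (s ^ (CARD('p) * q)) 0 (i * (CARD('p) * q))"
    using pow[of "CARD('p) * q"] upq xk by simp
  then have "x \<otimes>\<^bsub>G\<^esub> \<one>\<^bsub>G\<^esub> = x \<otimes>\<^bsub>G\<^esub> bel (s ^ (CARD('p) * q)) 0 (i * (CARD('p) * q))"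
    using xk by simp
  then have "\<one>\<^bsub>G\<^esub> = bel (s ^ (CARD('p) * q)) 0 (i * (CARD('p) * q))"
    using x sG G.l_cancel G.one_closed by metis
  then have "bel 1 0 0 = bel (s ^ (CARD('p) * q)) 0 (i * (CARD('p) * q))"
    by (simp add: bel_one)
  then have spq: "s ^ (CARD('p) * q) = 1" and ipq: "2 * q dvd i * (CARD('p) * q)"
    using bel_eq_iff[of 1 0 0 "s ^ (CARD('p) * q)" 0 "i * (CARD('p) * q)"] by auto
  have s0: "s \<noteq> 0" using root_nonzero[OF s] .
  have "s ^ (CARD('p) * q) = s ^ q"
    using finite_field_power_card_eq_same[of s] by (simp add: power_mult)
  then have s1: "s = 1"
    using power_coprime_one[OF _ unit_power[OF s0] q(4)] spq q(2) by simp
  have "2 dvd i * CARD('p)" using ipq q(2) by (simp add: mult.assoc[symmetric])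
  then have even: "even i" using p by simp
  obtain A B C D where bl: "A \<in> carrier_mat 2 2" "B \<in> carrier_mat 2 n" "C \<in> carrier_mat n 2" "D \<in> carrier_mat n n"
    "x = four_block_mat A B C D"
    using block_decomposition[of x 2 n] xk(1) unfolding k by (metis add.commute)
  let ?V = "U ^\<^sub>m (i * CARD('p))" and ?U = "U ^\<^sub>m CARD('p)"
  \<comment> \<open>The \<open>p\<close>-th power kills the unipotent block, while
    \<open>U ^ p\<close> still has no eigenvalue 1 because \<open>q\<close> does not divide
    p.\<close>
  have "u ^\<^sub>m CARD('p) = bdiag (1\<^sub>m 2) ?U"
  proof -
    have "u ^\<^sub>m CARD('p) = bel 1 0 (Suc q * CARD('p))" by (simp add: u_def bel_pow)
    then show ?thesis using W_carrier unfolding bel_1 pow_mat_mult[OF W_carrier] W_q1 upper2_one by simp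
  qed
  moreover have "bel (s ^ CARD('p)) (of_nat CARD('p) * b) (i * CARD('p)) = bdiag (1\<^sub>m 2) ?V"
    using even by (simp add: s1 bel_1 W_even upper2_one)
  ultimately have "bdiag (1\<^sub>m 2) ?U * x = x * bdiag (1\<^sub>m 2) ?V" using pow[of "CARD('p)"] by simp
  then have "four_block_mat (1\<^sub>m 2 * A) (1\<^sub>m 2 * B) (?U * C) (?U * D) = four_block_mat (A * 1\<^sub>m 2) (B * ?V) (C * 1\<^sub>m 2) (D * ?V)"
    unfolding bl(5) by (simp only: bdiag_four_block_mult[OF one_carrier_mat U_pow bl(1-4)])
  note blocks = four_block_eq_iff[THEN iffD1, rotated 8, OF this
      mult_carrier_mat[OF one_carrier_mat bl(1)] mult_carrier_mat[OF one_carrier_mat bl(2)]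
      mult_carrier_mat[OF U_pow bl(3)] mult_carrier_mat[OF U_pow bl(4)]
      mult_carrier_mat[OF bl(1) one_carrier_mat] mult_carrier_mat[OF bl(2) U_pow]
      mult_carrier_mat[OF bl(3) one_carrier_mat] mult_carrier_mat[OF bl(4) U_pow]]
  have e: "B = B * ?V" "?U * C = C" "?U * D = D * ?V"
    using conjunct1[OF conjunct2[OF blocks]] conjunct1[OF conjunct2[OF conjunct2[OF blocks]]]
      conjunct2[OF conjunct2[OF conjunct2[OF blocks]]]
    by (simp_all only: left_mult_one_mat[OF bl(2)] right_mult_one_mat[OF bl(3)])
  have "\<not> q dvd CARD('p)" using q(2,3) by (metis coprime_absorb_left less_irrefl nat_dvd_1_iff_1)
  then have freeU: "det (?U - 1\<^sub>m n) \<noteq> 0" by (rule free)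
  have C0: "C = 0\<^sub>m n 2" by (rule fixed_left_zero[OF U_pow freeU bl(3) e(2)])
  \<comment> \<open>A trivial lower block on the right would make \<open>D\<close> fixed by
    \<open>?U\<close>, hence zero, and \<open>x\<close> singular.\<close>
  have nV: "\<not> q dvd i * CARD('p)"
  proof
    assume "q dvd i * CARD('p)"
    then have "?V = 1\<^sub>m n" by (simp add: U_pow_one_iff)
    then have "?U * D = D" using e(3) bl(4) by simp
    then have "D = 0\<^sub>m n n" by (rule fixed_left_zero[OF U_pow freeU bl(4)])
    then have "det x = 0"
      unfolding bl(5) using det_four_block_mat_lower_left_zero[OF bl(1,2) C0 bl(4)] n by simp
    then show False using xk by simp
  qed
  have B0: "B = 0\<^sub>m 2 n" by (rule fixed_right_zero[OF U_pow free[OF nV] bl(2) e(1)[symmetric]])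
  have xd: "x = bdiag A D" using bl B0 C0 by (simp add: bdiag_def)
  have "bdiag (upper2 1 1 1 * A) (U * D) = bdiag (A * upper2 1 b 1) (D * U ^\<^sub>m i)"
    using eq bl(1,4) U even unfolding xd u_eq s1 bel_1 by (simp add: bdiag_mult[of _ 2 _ n] W_even)
  note diag = bdiag_eq_iff[THEN iffD1, rotated 4, OF this mult_carrier_mat[OF upper2_carrier bl(1)]
      mult_carrier_mat[OF U(1) bl(4)] mult_carrier_mat[OF bl(1) upper2_carrier] mult_carrier_mat[OF bl(4) U_pow]]
  then have AD: "upper2 1 1 1 * A = A * upper2 1 b 1" "U * D = D * U ^\<^sub>m i" by blast+
  have idx: "(upper2 1 1 1 * A) $$ (r, c) = (A * upper2 1 b 1) $$ (r, c)" for r c by (simp only: AD(1))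
  have "A $$ (1, 0) = 0"
    using idx[of 0 0] bl(1) by (simp add: mat2_mult_index del: index_mult_mat)
  then have A: "A = upper2 (A $$ (0, 0)) (A $$ (0, 1)) (A $$ (1, 1))"
    using bl(1) by (subst mat2_eq_iff) auto
  have "det A * det D = 1" using xk(2) bl(1,4) unfolding xd by (simp add: bdiag_det[of _ 2 _ n])
  then have "A $$ (0, 0) * A $$ (1, 1) * det D = 1"
    by (subst (asm) A) (simp add: det_upper2)
  moreover have "x = bdiag (upper2 (A $$ (0, 0)) (A $$ (0, 1)) (A $$ (1, 1))) D"
    by (simp only: A[symmetric] xd)
  ultimately show ?thesis unfolding M_def using AD(2) bl(4) by blast
qed

lemma M_conj:
  assumes "x \<in> M"
  shows "x \<in> carrier G" "\<exists>b \<gamma>. b \<noteq> 0 \<and> even \<gamma> \<and> \<not> q dvd \<gamma> \<and> u * x = x * bel 1 b \<gamma> \<and> (u * z) * x = x * bel 1 b (\<gamma> + q)"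
proof -
  obtain a b d Q \<gamma> where x: "x = bdiag (upper2 a b d) Q" and Q: "Q \<in> carrier_mat n n" and ad: "a * d * det Q = 1"
    and \<gamma>: "U * Q = Q * U ^\<^sub>m \<gamma>"
    using assms by (auto simp: M_def)
  show "x \<in> carrier G"
    using Q ad by (simp add: x carrier_G bdiag_det[of _ 2 _ n] det_upper2)
  \<comment> \<open>An even exponent for which \<open>W ^ ?g\<close> is \<open>U ^ \<gamma>\<close>;
    its parity decides the sign of the character values.\<close>
  let ?g = "Suc q * \<gamma>"
  have Wg: "W ^\<^sub>m ?g = U ^\<^sub>m \<gamma>" unfolding pow_mat_mult[OF W_carrier] W_q1 ..
  have a0: "a \<noteq> 0" and d0: "d \<noteq> 0" and Q0: "det Q \<noteq> 0" using ad by auto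
  have "\<not> q dvd ?g"
  proof
    assume "q dvd ?g"
    moreover have "coprime q (Suc q)" by simp
    ultimately have "q dvd \<gamma>" by (simp add: coprime_dvd_mult_right_iff del: mult_Suc)
    then have "U ^\<^sub>m 1 * Q = Q" using \<gamma> U Q by (simp add: U_pow_one_iff[symmetric])
    then have "Q = 0\<^sub>m n n" using q(2) by (intro fixed_left_zero[OF U_pow free Q, of 1]) auto
    then show False using Q0 n by simp
  qed
  moreover have "even ?g" using q(1) by simp
  moreover have "u * x = x * bel 1 (d / a) ?g"
  proof -
    have "u * x = bdiag (upper2 a (b + d) d) (U * Q)"
      unfolding u_eq x using Q U by (simp add: bdiag_mult[of _ 2 _ n] upper2_mult)
    also have "\<dots> = x * bel 1 (d / a) ?g"
      unfolding bel_1 Wg x \<gamma> using Q a0 by (simp add: bdiag_mult[of _ 2 _ n] upper2_mult add.commute)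
    finally show ?thesis .
  qed
  moreover have "u * z * x = x * bel 1 (d / a) (?g + q)"
  proof -
    have W1: "W ^\<^sub>m 1 = (- 1) \<cdot>\<^sub>m U" using W_carrier by (simp add: W_def)
    have Wgq: "W ^\<^sub>m (?g + q) = (- 1) \<cdot>\<^sub>m (U ^\<^sub>m \<gamma>)"
      unfolding pow_mat_add[OF W_carrier] Wg W_q by (simp add: mult_smult_distrib[of _ n n _ n] right_mult_one_mat[OF U_pow])
    have "u * z * x = bdiag (upper2 a (b + d) d) ((- 1) \<cdot>\<^sub>m (U * Q))"
      unfolding uz_eq bel_1 W1 x using Q U by (simp add: bdiag_mult[of _ 2 _ n] upper2_mult mult_smult_assoc_mat[of _ n n _ n])
    also have "\<dots> = x * bel 1 (d / a) (?g + q)"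
      unfolding bel_1 Wgq x \<gamma> using Q a0
      by (simp add: bdiag_mult[of _ 2 _ n] upper2_mult add.commute mult_smult_distrib[of _ n n _ n])
    finally show ?thesis .
  qed
  moreover have "d / a \<noteq> 0" using a0 d0 by simp
  ultimately show "\<exists>b \<gamma>. b \<noteq> 0 \<and> even \<gamma> \<and> \<not> q dvd \<gamma> \<and> u * x = x * bel 1 b \<gamma> \<and> (u * z) * x = x * bel 1 b (\<gamma> + q)"
    by blast
qed

text \<open>\<open>u\<close> is a power of \<open>u * z\<close>: the exponent is 1 modulo p for the
  unipotent block and \<open>q + 1\<close> modulo \<open>2 * q\<close> for the power of
  \<open>W\<close>.\<close>

lemma conj_uz_imp_M:
  assumes x: "x \<in> carrier G" and s: "s ^ k = 1" and eq: "(u * z) * x = x * bel s b i"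
  shows "x \<in> M"
proof -
  have xk: "x \<in> carrier_mat k k" using x by (simp add: carrier_G)
  have "coprime CARD('p) (2 * q)" using p q(3) by (simp add: coprime_commute)
  then obtain e where e: "[e = 1] (mod CARD('p))" "[e = Suc q] (mod (2 * q))"
    using binary_chinese_remainder_nat by blast
  have "(u * z) ^\<^sub>m e = bel 1 (of_nat e) (e mod (2 * q))"
    unfolding uz_eq by (simp add: bel_pow bel_mod)
  also have "\<dots> = bel 1 1 (Suc q mod (2 * q))"
  proof -
    have "(of_nat e :: 'p mod_ring) = of_nat (e mod CARD('p))" using of_nat_mod_CHAR[of e, where ?'a = "'p mod_ring"] by simp
    also have "\<dots> = 1" using e(1) p_gt_2 by (simp add: cong_def)
    finally show ?thesis using e(2) by (simp add: cong_def)
  qed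
  also have "\<dots> = u" by (simp only: bel_mod u_def)
  finally have "u * x = x * bel s b i ^\<^sub>m e"
    using pow_mat_intertwine[OF _ _ xk eq, of e] by (simp add: uz_eq bel_carrier_mat)
  then have "u * x = x * bel (s ^ e) (of_nat e * b) (i * e)" by (simp only: bel_pow)
  moreover have "(s ^ e) ^ k = 1" using s by (metis mult.commute power_mult power_one)
  ultimately show ?thesis using conj_u_imp_M[OF x] by blast
qed

text \<open>The sign makes the value at \<open>W ^ q\<close>, that is at \<open>z\<close>, equal to
  -1, since \<open>q\<close> is odd. At \<open>U = W ^ (q + 1)\<close> the signs cancel, and the
  indices 1 to q - 1 give the nontrivial characters of \<open>U\<close>.\<close>

definition \<xi> :: "nat \<Rightarrow> complex" where
  "\<xi> j = - cis (2 * pi * real j / real q)"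

lemma xi_power: "\<xi> j ^ i = (- 1) ^ i * cis (2 * pi * real i / real q) ^ j"
  unfolding \<xi>_def power_minus[of "cis _"] Complex.DeMoivre by (simp add: mult_ac)

lemma root_power_q: "cis (2 * pi * real i / real q) ^ q = 1"
  using q(2) cis_multiple_2pi[of "real i"] unfolding Complex.DeMoivre by (simp add: mult_ac)

lemma xi_order: "\<xi> j ^ (2 * q) = 1"
proof -
  have "cis (2 * pi * real (2 * q) / real q) ^ j = 1"
    using q(2) cis_multiple_2pi[of 2] by (simp add: mult_ac)
  then show ?thesis unfolding xi_power by simp
qed

lemma xi_odd_power: "odd i \<Longrightarrow> \<xi> j ^ i = \<xi> (i * j mod q)"
proof -
  assume i: "odd i"
  have "cis (2 * pi * real (i * j) / real q) = cis (2 * pi * real (i * j mod q) / real q)"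
  proof -
    have "real (i * j) = real q * real (i * j div q) + real (i * j mod q)"
      by (metis mult_div_mod_eq of_nat_add of_nat_mult)
    then have "2 * pi * real (i * j) / real q = 2 * pi * real (i * j div q) + 2 * pi * real (i * j mod q) / real q"
      using q(2) by (simp add: field_simps)
    then have "cis (2 * pi * real (i * j) / real q) = cis (2 * pi * real (i * j div q)) * cis (2 * pi * real (i * j mod q) / real q)"
      by (simp only: cis_mult)
    then show ?thesis using cis_multiple_2pi[of "real (i * j div q)"] by simp
  qed
  then show ?thesis
    using i unfolding \<xi>_def power_minus_odd[OF i] Complex.DeMoivre by (simp add: mult_ac)
qed

text \<open>A full geometric sum over the \<open>q\<close>-th roots of unity without its term at
  \<open>j = 0\<close>.\<close>

lemma sum_xi: "(\<Sum>j\<in>{1..<q}. \<xi> j ^ i) = (- 1) ^ i * (if q dvd i then of_nat (q - 1) else - 1)"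
proof -
  let ?\<eta> = "cis (2 * pi * real i / real q)"
  have 1: "?\<eta> = 1 \<longleftrightarrow> q dvd i"
  proof
    assume "?\<eta> = 1"
    then have "cos (2 * pi * real i / real q) = 1" by (simp add: complex_eq_iff)
    then obtain m :: int where "2 * pi * real i / real q = real_of_int m * 2 * pi"
      unfolding cos_one_2pi_int by blast
    then have "real i = real_of_int m * real q" using q(2) by (simp add: field_simps)
    then have "int i = m * int q" by (metis of_int_eq_iff of_int_mult of_int_of_nat_eq)
    then show "q dvd i" by (metis dvd_triv_right int_dvd_int_iff)
  next
    assume "q dvd i"
    then obtain m where "i = q * m" by blast
    then show "?\<eta> = 1" using q(2) cis_multiple_2pi[of "real m"] by (simp add: mult_ac)
  qed
  have "(\<Sum>j<q. ?\<eta> ^ j) = (if q dvd i then of_nat q else 0)"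
    using 1 root_power_q[of i] by (auto simp: geometric_sum)
  moreover have "{..<q} = insert 0 {1..<q}" using q(2) by auto
  ultimately have "(\<Sum>j\<in>{1..<q}. ?\<eta> ^ j) = (if q dvd i then of_nat q else 0) - 1"
    by (simp add: algebra_simps)
  also have "\<dots> = (if q dvd i then of_nat (q - 1) else - 1)"
    using q(2) by (simp add: of_nat_diff)
  finally show ?thesis
    unfolding xi_power sum_distrib_left[symmetric] by simp
qed

definition tot :: "'p mod_ring mat \<Rightarrow> complex" where
  "tot g = (\<Sum>j\<in>{1..<q}. \<Sum>t\<in>UNIV - {0}. chr t (\<xi> j) g)"

lemma tot_bel:
  assumes "s ^ k = 1"
  shows "tot (bel s b i) = (if b = 0 then of_nat (CARD('p) - 1) else - 1) * ((- 1) ^ i * (if q dvd i then of_nat (q - 1) else - 1))"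
proof -
  have "tot (bel s b i) = (\<Sum>j\<in>{1..<q}. (\<Sum>t\<in>UNIV - {0}. add_char (t * b)) * \<xi> j ^ i)"
    by (simp add: tot_def chr_bel[OF assms xi_order] sum_distrib_right)
  also have "\<dots> = (\<Sum>t\<in>UNIV - {0}. add_char (t * b)) * (\<Sum>j\<in>{1..<q}. \<xi> j ^ i)"
    by (simp add: sum_distrib_left)
  finally show ?thesis by (simp only: sum_add_char sum_xi)
qed

lemma tot_outside: "x \<notin> B \<Longrightarrow> tot x = 0"
  by (simp add: tot_def chr_outside)

lemma tot_rational: "tot x \<in> \<rat>"
proof (cases "x \<in> B")
  case True
  then obtain s b i where "x = bel s b i" "s ^ k = 1" by (auto simp: B_def)
  then show ?thesis by (simp add: tot_bel)
qed (simp add: tot_outside)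

definition Tot :: "'p mod_ring mat \<Rightarrow> complex" where
  "Tot g = (\<Sum>x\<in>carrier G. tot (inv\<^bsub>G\<^esub> x \<otimes>\<^bsub>G\<^esub> g \<otimes>\<^bsub>G\<^esub> x))"

lemma Tot_ind_sum: "Tot g = (\<Sum>j\<in>{1..<q}. \<Sum>t\<in>UNIV - {0}. ind_sum t (\<xi> j) g)"
proof -
  have "Tot g = (\<Sum>j\<in>{1..<q}. \<Sum>x\<in>carrier G. \<Sum>t\<in>UNIV - {0}. chr t (\<xi> j) (inv\<^bsub>G\<^esub> x \<otimes>\<^bsub>G\<^esub> g \<otimes>\<^bsub>G\<^esub> x))"
    unfolding Tot_def tot_def by (rule sum.swap)
  also have "\<dots> = (\<Sum>j\<in>{1..<q}. \<Sum>t\<in>UNIV - {0}. ind_sum t (\<xi> j) g)"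
    unfolding ind_sum_def by (intro sum.cong refl sum.swap)
  finally show ?thesis .
qed

lemma Tot_rational: "Tot g \<in> \<rat>"
  unfolding Tot_def by (intro Rats_sum tot_rational)

lemma Tot_eq_card:
  assumes g: "g \<in> carrier G"
    and M: "\<And>x. x \<in> M \<Longrightarrow> \<exists>v\<in>carrier G. g * x = x * v \<and> tot v = c"
    and conv: "\<And>x s b i. x \<in> carrier G \<Longrightarrow> s ^ k = 1 \<Longrightarrow> g * x = x * bel s b i \<Longrightarrow> x \<in> M"
  shows "Tot g = of_nat (card M) * c"
  unfolding Tot_def by (rule conj_sum_eq_card[OF tot_outside g _ M conv]) (use M_conj(1) in blast)+

text \<open>At the conjugates of \<open>u\<close> in \<open>B\<close> the additive sum and the sum
  over \<open>\<xi>\<close> are both -1, so each element of \<open>M\<close> contributes 1. For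
  \<open>u * z\<close> the exponent of \<open>W\<close> grows by the odd number \<open>q\<close>,
  which flips the sign.\<close>

lemma Tot_u: "Tot u = of_nat (card M)"
proof -
  have "\<exists>v\<in>carrier G. u * x = x * v \<and> tot v = 1" if xM: "x \<in> M" for x
  proof -
    obtain b \<gamma> where "b \<noteq> 0" "even \<gamma>" "\<not> q dvd \<gamma>" "u * x = x * bel 1 b \<gamma>"
      using M_conj(2)[OF xM] by blast
    then show ?thesis by (intro bexI[of _ "bel 1 b \<gamma>"]) (simp_all add: tot_bel bel_carrier)
  qed
  then have "Tot u = of_nat (card M) * 1"
    by (intro Tot_eq_card u_G conj_u_imp_M) auto
  then show ?thesis by simp
qed

lemma Tot_uz: "Tot (u * z) = - of_nat (card M)"
proof -
  have "\<exists>v\<in>carrier G. u * z * x = x * v \<and> tot v = - 1" if xM: "x \<in> M" for x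
  proof -
    obtain b \<gamma> where b: "b \<noteq> 0" "even \<gamma>" "\<not> q dvd \<gamma>" "u * z * x = x * bel 1 b (\<gamma> + q)"
      using M_conj(2)[OF xM] by blast
    then have "odd (\<gamma> + q)" "\<not> q dvd \<gamma> + q" using q(1) by auto
    then show ?thesis using b by (intro bexI[of _ "bel 1 b (\<gamma> + q)"]) (simp_all add: tot_bel bel_carrier)
  qed
  then have "Tot (u * z) = of_nat (card M) * (- 1)"
    using u_G z_G G.m_closed[of u z] by (intro Tot_eq_card conj_uz_imp_M) auto
  then show ?thesis by simp
qed

end

section \<open>The normaliser of U and the 2-adic comparison\<close>

context field_block
begin

text \<open>\<open>Nrm 1\<close> is the centraliser of \<open>U\<close>; the nonempty sets
  \<open>Nrm \<gamma>\<close> are its cosets in the normaliser.\<close>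

definition Nrm :: "nat \<Rightarrow> 'p mod_ring mat set" where
  "Nrm \<gamma> = {Q \<in> carrier_mat n n. det Q \<noteq> 0 \<and> U * Q = Q * U ^\<^sub>m \<gamma>}"

text \<open>The normaliser modulo the centraliser, realised as exponents modulo
  \<open>q\<close>.\<close>

definition Gam :: "nat set" where
  "Gam = {\<gamma> \<in> {..<q}. Nrm \<gamma> \<noteq> {}}"

lemma Nrm_mult:
  assumes "Q \<in> Nrm g" "R \<in> Nrm h"
  shows "Q * R \<in> Nrm (g * h)"
proof -
  have c: "Q \<in> carrier_mat n n" "R \<in> carrier_mat n n" and eq: "U * Q = Q * U ^\<^sub>m g" "U * R = R * U ^\<^sub>m h"
    using assms by (auto simp: Nrm_def)
  have "U * (Q * R) = Q * U ^\<^sub>m g * R"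
    by (simp only: assoc_mult_mat[OF U(1) c, symmetric] eq(1))
  also have "\<dots> = Q * (U ^\<^sub>m g * R)" by (rule assoc_mult_mat[OF c(1) U_pow c(2)])
  also have "U ^\<^sub>m g * R = R * (U ^\<^sub>m h) ^\<^sub>m g"
    by (rule pow_mat_intertwine[OF U(1) U_pow c(2) eq(2)])
  also have "\<dots> = R * U ^\<^sub>m (g * h)"
    using pow_mat_mult[OF U(1), of h g] by (simp add: mult.commute)
  also have "Q * (R * U ^\<^sub>m (g * h)) = Q * R * U ^\<^sub>m (g * h)"
    by (rule assoc_mult_mat[OF c U_pow, symmetric])
  finally show ?thesis
    using assms c by (simp add: Nrm_def det_mult[OF c] mult_carrier_mat[OF c])
qed

lemma Nrm_mod: "Nrm (g mod q) = Nrm g"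
proof -
  have "U ^\<^sub>m (g mod q) = U ^\<^sub>m g" by (simp add: U_pow_eq_iff)
  then show ?thesis by (simp add: Nrm_def)
qed

lemma Nrm_inverse:
  assumes "Q \<in> Nrm g"
  obtains R h where "R \<in> Nrm h" "Q * R = 1\<^sub>m n" "R * Q = 1\<^sub>m n" "(g * h) mod q = 1"
proof -
  have c: "Q \<in> carrier_mat n n" "det Q \<noteq> 0" and eq: "U * Q = Q * U ^\<^sub>m g"
    using assms by (auto simp: Nrm_def)
  obtain R where R: "R \<in> carrier_mat n n" "Q * R = 1\<^sub>m n" "R * Q = 1\<^sub>m n" "det R = 1 / det Q"
    using inverse_mat_obtain[OF c] by metis
  \<comment> \<open>For a common divisor d, the power of \<open>U\<close> with exponent q/d fixes
    \<open>Q\<close>, so \<open>q\<close> divides q/d and d = 1.\<close>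
  have "coprime g q"
  proof (rule coprimeI)
    fix d assume d: "d dvd g" "d dvd q"
    obtain q' where q': "q = d * q'" using d(2) by blast
    have "U ^\<^sub>m q' * Q = Q * (U ^\<^sub>m g) ^\<^sub>m q'"
      by (rule pow_mat_intertwine[OF U(1) U_pow c(1) eq])
    also have "(U ^\<^sub>m g) ^\<^sub>m q' = 1\<^sub>m n"
      using d(1) q' by (auto simp: pow_mat_mult[OF U(1), symmetric] U_pow_one_iff)
    finally have "U ^\<^sub>m q' * Q = Q" using c(1) by simp
    have "q dvd q'"
    proof (rule ccontr)
      assume "\<not> q dvd q'"
      then have "Q = 0\<^sub>m n n"
        by (intro fixed_left_zero[OF U_pow free c(1) \<open>U ^\<^sub>m q' * Q = Q\<close>])
      then show False using c(2) n by simp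
    qed
    then have "d * q' dvd q'" using q' by simp
    moreover have "q' > 0" using q(2) q' by (auto intro: Nat.gr0I)
    ultimately show "is_unit d" by (auto dest: dvd_imp_le)
  qed
  then obtain h where "[g * h = 1] (mod q)"
    using cong_solve_coprime_nat by auto
  then have h: "(g * h) mod q = 1" using q(2) by (simp add: cong_def)
  have "U ^\<^sub>m h * Q = Q * (U ^\<^sub>m g) ^\<^sub>m h" by (rule pow_mat_intertwine[OF U(1) U_pow c(1) eq])
  also have "(U ^\<^sub>m g) ^\<^sub>m h = U"
    using U_pow_eq_iff[of "g * h" 1] h q(2) U(1) by (simp add: pow_mat_mult[OF U(1), symmetric])
  finally have hQ: "U ^\<^sub>m h * Q = Q * U" .
  have "U * R = R * Q * U * R" using R(3) left_mult_one_mat[OF U(1)] by simp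
  also have "\<dots> = R * (Q * U) * R" by (simp only: assoc_mult_mat[OF R(1) c(1) U(1)])
  also have "\<dots> = R * (U ^\<^sub>m h * Q) * R" by (simp only: hQ)
  also have "\<dots> = R * (U ^\<^sub>m h * Q * R)" by (rule assoc_mult_mat[OF R(1) mult_carrier_mat[OF U_pow c(1)] R(1)])
  also have "U ^\<^sub>m h * Q * R = U ^\<^sub>m h"
    by (simp only: assoc_mult_mat[OF U_pow c(1) R(1)] R(2) right_mult_one_mat[OF U_pow])
  finally have "R \<in> Nrm h" using R c(2) by (simp add: Nrm_def)
  then show ?thesis using R h that by blast
qed

lemma one_Nrm: "1\<^sub>m n \<in> Nrm 1"
  using U by (simp add: Nrm_def)

definition Gam_group :: "nat monoid" where
  "Gam_group = \<lparr>carrier = Gam, monoid.mult = (\<lambda>g h. (g * h) mod q), one = 1\<rparr>"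

lemma Gam_I: "Q \<in> Nrm g \<Longrightarrow> g mod q \<in> Gam"
  using q(2) Nrm_mod[of g] by (auto simp: Gam_def)

lemma group_Gam: "group Gam_group"
proof (rule groupI)
  fix g h assume "g \<in> carrier Gam_group" "h \<in> carrier Gam_group"
  then obtain Q R where "Q \<in> Nrm g" "R \<in> Nrm h" by (auto simp: Gam_group_def Gam_def)
  then show "g \<otimes>\<^bsub>Gam_group\<^esub> h \<in> carrier Gam_group"
    using Gam_I[OF Nrm_mult] by (simp add: Gam_group_def)
next
  show "\<one>\<^bsub>Gam_group\<^esub> \<in> carrier Gam_group"
    using Gam_I[OF one_Nrm] q(2) by (simp add: Gam_group_def)
next
  fix g assume g: "g \<in> carrier Gam_group"
  then show "\<one>\<^bsub>Gam_group\<^esub> \<otimes>\<^bsub>Gam_group\<^esub> g = g" by (simp add: Gam_group_def Gam_def)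
  obtain Q where "Q \<in> Nrm g" using g by (auto simp: Gam_group_def Gam_def)
  then obtain R h where "R \<in> Nrm h" "(g * h) mod q = 1" using Nrm_inverse by metis
  then show "\<exists>y\<in>carrier Gam_group. y \<otimes>\<^bsub>Gam_group\<^esub> g = \<one>\<^bsub>Gam_group\<^esub>"
    using Gam_I by (intro bexI[of _ "h mod q"]) (auto simp: Gam_group_def mult.commute mod_mult_right_eq)
qed (auto simp: Gam_group_def mod_mult_left_eq mod_mult_right_eq mult.assoc)

text \<open>By \<open>galois\<close> the involution is -1 modulo \<open>q\<close>, and -j = j modulo
  the odd \<open>q\<close> would make \<open>q\<close> divide \<open>j\<close>.\<close>

lemma Gam_involution:
  assumes "g \<in> Gam" "g \<noteq> 1" "(g * g) mod q = 1" "j \<in> {1..<q}"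
  shows "(g * j) mod q \<noteq> j"
proof
  assume fix_j: "(g * j) mod q = j"
  obtain Q where Q: "Q \<in> Nrm g" using assms(1) by (auto simp: Gam_def)
  have gq: "g < q" using assms(1) by (simp add: Gam_def)
  have "int (g * g) mod int q = 1" using assms(3) by (metis of_nat_1 of_nat_mod)
  then have "int q dvd int g * int g - 1"
    using q(2) by (metis mod_eq_dvd_iff of_nat_mult mod_pos_pos_trivial zero_le_one of_nat_1 of_nat_less_iff)
  then have "int q dvd int g - 1 \<or> int q dvd int g + 1"
    using galois[of Q g] Q by (auto simp: Nrm_def)
  then show False
  proof
    assume "int q dvd int g - 1"
    moreover have "g > 0" using assms(3) q(2) by (auto intro: Nat.gr0I)
    ultimately have "q dvd g - 1" by (metis Suc_leI int_dvd_int_iff of_nat_1 of_nat_diff One_nat_def)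
    then show False using gq assms(2) \<open>g > 0\<close> by (auto dest!: dvd_imp_le)
  next
    assume "int q dvd int g + 1"
    then have "q dvd g + 1" by (metis int_dvd_int_iff of_nat_1 of_nat_add)
    then have 1: "q dvd (g + 1) * j" by (rule dvd_mult2)
    have "q dvd g * j - j"
      using fix_j by (metis dvd_minus_mod)
    moreover have "g * j \<ge> j" using assms(3) q(2) by (cases g) auto
    moreover have "(g + 1) * j - (g * j - j) = 2 * j" using calculation(2) by (simp add: algebra_simps)
    ultimately have "q dvd 2 * j" using 1 by (metis dvd_diff_nat)
    then have "q dvd j" using q(1) by (simp add: coprime_dvd_mult_right_iff)
    then show False using assms(4) by (auto dest!: dvd_imp_le)
  qed
qed

definition Cent :: "'p mod_ring mat monoid" where
  "Cent = (GL n)\<lparr>carrier := Nrm 1\<rparr>"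

lemma finite_Nrm: "finite (Nrm g)"
  by (rule finite_subset[OF _ finite_carrier_mat[of n n]]) (auto simp: Nrm_def)

lemma group_Cent: "group Cent"
proof -
  interpret GL: group "GL n :: 'p mod_ring mat monoid" by (rule group_GL)
  have "subgroup (Nrm 1) (GL n)"
  proof (rule GL.subgroupI)
    show "Nrm 1 \<subseteq> carrier (GL n)" by (auto simp: Nrm_def GL_iff)
    show "Nrm 1 \<noteq> {}" using one_Nrm by blast
    fix Q assume Q: "Q \<in> Nrm 1"
    obtain R h where R: "R \<in> Nrm h" "Q * R = 1\<^sub>m n" "R * Q = 1\<^sub>m n" "(1 * h) mod q = 1"
      using Nrm_inverse[OF Q] by metis
    have "R \<in> Nrm 1" using R(1,4) Nrm_mod[of h] by simp
    moreover have "inv\<^bsub>GL n\<^esub> Q = R"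
      using R Q \<open>R \<in> Nrm 1\<close> by (intro GL.inv_equality) (auto simp: Nrm_def GL_iff)
    ultimately show "inv\<^bsub>GL n\<^esub> Q \<in> Nrm 1" by simp
  next
    fix Q R assume "Q \<in> Nrm 1" "R \<in> Nrm 1"
    then show "Q \<otimes>\<^bsub>GL n\<^esub> R \<in> Nrm 1" using Nrm_mult[of Q 1 R 1] by simp
  qed
  then show ?thesis unfolding Cent_def by (rule subgroup.subgroup_is_group) (rule group_GL)
qed

lemma Cent_simps [simp]:
  "carrier Cent = Nrm 1" "Q \<otimes>\<^bsub>Cent\<^esub> R = Q * R" "\<one>\<^bsub>Cent\<^esub> = 1\<^sub>m n"
  using mult_GL one_GL by (simp_all add: Cent_def)

text \<open>Right translation by one element of \<open>Nrm g\<close> is a bijection from the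
  centraliser.\<close>

lemma card_Nrm:
  assumes "g \<in> Gam"
  shows "card (Nrm g) = card (Nrm 1)"
proof -
  obtain Q where Q: "Q \<in> Nrm g" using assms by (auto simp: Gam_def)
  obtain R h where R: "R \<in> Nrm h" "Q * R = 1\<^sub>m n" "R * Q = 1\<^sub>m n" "(g * h) mod q = 1"
    using Nrm_inverse[OF Q] by metis
  have c: "Q \<in> carrier_mat n n" "R \<in> carrier_mat n n" using Q R(1) by (auto simp: Nrm_def)
  have "bij_betw (\<lambda>A. A * Q) (Nrm 1) (Nrm g)"
  proof (rule bij_betw_byWitness[where f' = "\<lambda>A. A * R"])
    show "\<forall>A\<in>Nrm 1. A * Q * R = A" "\<forall>A\<in>Nrm g. A * R * Q = A"
      using R c by (auto simp: Nrm_def assoc_mult_mat[of _ n n _ n _ n])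
    show "(\<lambda>A. A * Q) ` Nrm 1 \<subseteq> Nrm g" using Nrm_mult[OF _ Q, of _ 1] by auto
    show "(\<lambda>A. A * R) ` Nrm g \<subseteq> Nrm 1"
      using Nrm_mult[OF _ R(1), of _ g] Nrm_mod[of "g * h"] R(4) by auto
  qed
  then show ?thesis by (simp add: bij_betw_same_card)
qed

lemma card_N2: "card (\<Union>g\<in>Gam. Nrm g) = card (Nrm 1) * card Gam"
proof -
  have "card (\<Union>g\<in>Gam. Nrm g) = (\<Sum>g\<in>Gam. card (Nrm g))"
  proof (rule card_UN_disjoint)
    show "finite Gam" by (simp add: Gam_def)
    show "\<forall>i\<in>Gam. finite (Nrm i)" using finite_Nrm by blast
    show "\<forall>i\<in>Gam. \<forall>j\<in>Gam. i \<noteq> j \<longrightarrow> Nrm i \<inter> Nrm j = {}"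
    proof (intro ballI impI, rule ccontr)
      fix i j assume ij: "i \<in> Gam" "j \<in> Gam" "i \<noteq> j" "Nrm i \<inter> Nrm j \<noteq> {}"
      then obtain Q where "Q \<in> Nrm i" and Qj: "Q \<in> Nrm j" by blast
      then have Q: "Q \<in> carrier_mat n n" "det Q \<noteq> 0" and Qi: "U * Q = Q * U ^\<^sub>m i"
        unfolding Nrm_def by blast+
      have "U * Q = Q * U ^\<^sub>m j" using Qj unfolding Nrm_def by blast
      then have "Q * U ^\<^sub>m i = Q * U ^\<^sub>m j" by (simp only: Qi)
      obtain R where R: "R \<in> carrier_mat n n" "R * Q = 1\<^sub>m n" using inverse_mat_obtain[OF Q(1,2)] by metis
      have "R * (Q * U ^\<^sub>m i) = R * (Q * U ^\<^sub>m j)" by (simp only: \<open>Q * U ^\<^sub>m i = Q * U ^\<^sub>m j\<close>)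
      then have "U ^\<^sub>m i = U ^\<^sub>m j"
        by (simp only: assoc_mult_mat[OF R(1) Q(1) U_pow, symmetric] R(2) left_mult_one_mat[OF U_pow])
      then show False using ij by (simp add: U_pow_eq_iff Gam_def)
    qed
  qed
  then show ?thesis using card_Nrm by simp
qed

lemma M_eq_N2: "M = {bdiag (upper2 a b d) Q |a b d Q. Q \<in> (\<Union>g\<in>Gam. Nrm g) \<and> a * d * det Q = 1}"
proof -
  have "(Q \<in> carrier_mat n n \<and> (\<exists>\<gamma>. U * Q = Q * U ^\<^sub>m \<gamma>)) \<longleftrightarrow> Q \<in> (\<Union>g\<in>Gam. Nrm g)" if detQ: "det Q \<noteq> 0" for Q
  proof
    assume "Q \<in> carrier_mat n n \<and> (\<exists>\<gamma>. U * Q = Q * U ^\<^sub>m \<gamma>)"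
    then obtain \<gamma> where "Q \<in> Nrm \<gamma>" using detQ by (auto simp: Nrm_def)
    then show "Q \<in> (\<Union>g\<in>Gam. Nrm g)" using Gam_I Nrm_mod[of \<gamma>] by blast
  qed (auto simp: Nrm_def)
  then show ?thesis unfolding M_def by (metis (no_types, opaque_lifting) mult_zero_right zero_neq_one)
qed

text \<open>\<open>Q\<close>, \<open>b\<close> and the nonzero \<open>d\<close> are free, and the
  determinant fixes \<open>a\<close>. The factor p - 1 and the 2-part of \<open>card Gam\<close> are
  those by which the character gets divided.\<close>

lemma card_M: "card M = (CARD('p) - 1) * CARD('p) * (card (Nrm 1) * card Gam)"
proof -
  let ?N2 = "\<Union>g\<in>Gam. Nrm g"
  let ?D = "(UNIV - {0 :: 'p mod_ring}) \<times> (UNIV :: 'p mod_ring set) \<times> ?N2"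
  let ?f = "\<lambda>(d, b, Q). bdiag (upper2 (1 / (d * det Q)) b d) Q"
  have c: "Q \<in> carrier_mat n n" "det Q \<noteq> 0" if "Q \<in> ?N2" for Q using that by (auto simp: Nrm_def)
  have "bij_betw ?f ?D M"
  proof (rule bij_betw_imageI)
    show "inj_on ?f ?D"
    proof (rule inj_onI)
      fix x y assume xy: "x \<in> ?D" "y \<in> ?D" "?f x = ?f y"
      obtain d b Q where x: "x = (d, b, Q)" by (cases x)
      obtain d' b' Q' where y: "y = (d', b', Q')" by (cases y)
      have "Q \<in> carrier_mat n n" "Q' \<in> carrier_mat n n" using xy(1,2) c(1) by (auto simp: x y)
      then show "x = y"
        using xy(3) by (simp add: x y bdiag_eq_iff[of _ 2 _ n] upper2_eq_iff)
    qed
    show "?f ` ?D = M"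
    proof
      show "?f ` ?D \<subseteq> M"
      proof
        fix x assume "x \<in> ?f ` ?D"
        then obtain d b Q where dbQ: "d \<noteq> 0" "Q \<in> ?N2" "x = bdiag (upper2 (1 / (d * det Q)) b d) Q" by auto
        then have "1 / (d * det Q) * d * det Q = 1" using c(2)[OF dbQ(2)] by simp
        then show "x \<in> M" unfolding M_eq_N2 using dbQ(2,3) by blast
      qed
      show "M \<subseteq> ?f ` ?D"
      proof
        fix x assume "x \<in> M"
        then obtain a b d Q where x: "x = bdiag (upper2 a b d) Q" "Q \<in> ?N2" "a * d * det Q = 1"
          unfolding M_eq_N2 by blast
        then have "d \<noteq> 0" by auto
        moreover have "a = 1 / (d * det Q)"
          using x(3) by (auto simp: eq_divide_eq mult.assoc)
        ultimately have "d \<noteq> 0" "a = 1 / (d * det Q)" by auto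
        then show "x \<in> ?f ` ?D" using x by (intro image_eqI[of _ _ "(d, b, Q)"]) auto
      qed
    qed
  qed
  then have "card M = card ?D" by (simp add: bij_betw_same_card)
  also have "\<dots> = (CARD('p) - 1) * (CARD('p) * card ?N2)" by (simp only: card_cartesian_product) simp
  finally show ?thesis by (simp add: card_N2 mult_ac)
qed

lemma ind_sum_Gam:
  assumes "t \<noteq> 0" "t' \<noteq> 0" "\<gamma> \<in> Gam" and g: "g \<in> carrier G"
  shows "ind_sum t' (\<xi> ((\<gamma> * j) mod q)) g = ind_sum t (\<xi> j) g"
proof -
  obtain Q where Q: "Q \<in> carrier_mat n n" "det Q \<noteq> 0" "U * Q = Q * U ^\<^sub>m \<gamma>"
    using assms(3) by (auto simp: Gam_def Nrm_def)
  obtain Q0 where Q0: "Q0 \<in> carrier_mat n n" "U * Q0 = Q0 * U" "det Q0 \<noteq> 0" "\<not> (\<exists>x. det Q0 = x ^ 2)"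
    using nonsquare by blast
  \<comment> \<open>An odd representative of \<open>\<gamma>\<close> modulo \<open>q\<close>: since
    \<open>W = -U\<close>, only an odd exponent turns the relation for \<open>U\<close> into one for
    \<open>W\<close>.\<close>
  define g' where "g' = (if odd \<gamma> then \<gamma> else \<gamma> + q)"
  have odd: "odd g'" using q(1) by (simp add: g'_def)
  have "U ^\<^sub>m g' = U ^\<^sub>m \<gamma>" by (simp add: U_pow_eq_iff g'_def)
  then have "W ^\<^sub>m g' = (- 1) \<cdot>\<^sub>m (U ^\<^sub>m \<gamma>)" using odd by (simp add: W_pow_U)
  then have WQ: "W * Q = Q * W ^\<^sub>m g'"
    using Q U by (simp add: W_def mult_smult_assoc_mat[of _ n n _ n] mult_smult_distrib[of _ n n _ n])
  have WQ0: "W * Q0 = Q0 * W"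
    using Q0 U by (simp add: W_def mult_smult_assoc_mat[of _ n n _ n] mult_smult_distrib[of _ n n _ n])
  have "ind_sum (t * (t' / t)) (\<xi> j ^ g') g = ind_sum t (\<xi> j) g"
    by (rule ind_sum_conj[OF Q(1,2) WQ Q0(1) WQ0 Q0(3,4) two_nonzero _ xi_order g]) (use assms(1,2) in simp)
  moreover have "\<xi> j ^ g' = \<xi> ((\<gamma> * j) mod q)"
    unfolding xi_odd_power[OF odd] by (simp add: g'_def algebra_simps)
  ultimately show ?thesis using assms(1) by simp
qed

text \<open>A class consists of all nonzero additive parameters together with one orbit of
  \<open>Gam\<close> on the indices of \<open>\<xi>\<close>. Involutions of \<open>Gam\<close> fix
  no index, so every orbit size is divisible by 2^e.\<close>

lemma exists_character:
  assumes H: "group H" and h: "h \<in> hom G H" "h ` carrier G = carrier H"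
    and ker: "\<And>x. x \<in> kernel G H h \<Longrightarrow> \<exists>c. x = c \<cdot>\<^sub>m 1\<^sub>m k"
    and e: "2 ^ e dvd card Gam"
  shows "\<exists>\<chi>\<in>Char_Q H. \<forall>g\<in>carrier G. of_nat ((CARD('p) - 1) * 2 ^ e * card B) * \<chi> (h g) = Tot g"
proof -
  interpret h: group_hom G H h by (intro group_hom.intro G.group_axioms H group_hom_axioms.intro h(1))
  interpret Gam: group Gam_group by (rule group_Gam)
  define f where "f = (\<lambda>g j. (g * j) mod q)"
  define orb where "orb = (\<lambda>j. {f g j |g. g \<in> carrier Gam_group})"
  define E where "E = {1..<q}"
  have car: "carrier Gam_group = Gam" by (simp add: Gam_group_def)
  have closed: "f g j \<in> E" if g: "g \<in> carrier Gam_group" and j: "j \<in> E" for g j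
  proof -
    obtain Q where "Q \<in> Nrm g" using g by (auto simp: Gam_group_def Gam_def)
    then obtain g' where g': "(g * g') mod q = 1" using Nrm_inverse by metis
    have "(g * j) mod q \<noteq> 0"
    proof
      assume "(g * j) mod q = 0"
      then have "((g * j) mod q * g') mod q = 0" by simp
      moreover have "((g * j) mod q * g') mod q = ((g * g') mod q * j) mod q"
        unfolding mod_mult_left_eq by (simp only: mult_ac)
      ultimately have "((g * g') mod q * j) mod q = 0" by simp
      then show False using j g' by (simp add: E_def)
    qed
    then show ?thesis using q(2) by (auto simp: f_def E_def Suc_le_eq)
  qed
  have mult: "f (g \<otimes>\<^bsub>Gam_group\<^esub> g') j = f g (f g' j)" for g g' j
    by (simp add: f_def Gam_group_def mod_mult_left_eq mod_mult_right_eq mult.assoc)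
  have one: "f \<one>\<^bsub>Gam_group\<^esub> j = j" if "j \<in> E" for j
    using that by (simp add: f_def Gam_group_def E_def)
  have orb_E: "orb j \<subseteq> E" if "j \<in> E" for j
    using closed that by (auto simp: orb_def)
  have orb_dvd: "2 ^ e dvd card (orb j)" if j: "j \<in> E" for j
    unfolding orb_def
  proof (rule Gam.two_power_dvd_card_orbit[where E = E])
    show "finite (carrier Gam_group)" "finite E" by (simp_all add: car Gam_def E_def)
    show "2 ^ e dvd Coset.order Gam_group" using e by (simp add: Coset.order_def car)
    show "f g x \<noteq> x" if "g \<in> carrier Gam_group" "g \<noteq> \<one>\<^bsub>Gam_group\<^esub>" "g \<otimes>\<^bsub>Gam_group\<^esub> g = \<one>\<^bsub>Gam_group\<^esub>" "x \<in> E" for g x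
      using that Gam_involution[of g x] by (simp add: f_def Gam_group_def E_def)
  qed (use closed mult one j in auto)
  define T where "T = (UNIV - {0 :: 'p mod_ring})"
  define cls where "cls = (\<lambda>C. T \<times> C) ` (orb ` E)"
  define \<theta> where "\<theta> = (\<lambda>(t, j). chr t (\<xi> j))"
  have T1: "1 \<in> T" by (simp add: T_def)
  have ind: "(\<Sum>x\<in>carrier G. \<theta> (t, j) (inv\<^bsub>G\<^esub> x \<otimes>\<^bsub>G\<^esub> g \<otimes>\<^bsub>G\<^esub> x)) = ind_sum t (\<xi> j) g" for t j g
    by (simp add: \<theta>_def ind_sum_def)
  have Tot: "(\<Sum>C\<in>cls. \<Sum>i\<in>C. \<Sum>x\<in>carrier G. \<theta> i (inv\<^bsub>G\<^esub> x \<otimes>\<^bsub>G\<^esub> g \<otimes>\<^bsub>G\<^esub> x)) = Tot g" for g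
  proof -
    have inj: "inj_on (\<lambda>C. T \<times> C) (orb ` E)"
      using T1 by (auto simp: inj_on_def)
    have "(\<Sum>C\<in>cls. \<Sum>i\<in>C. \<Sum>x\<in>carrier G. \<theta> i (inv\<^bsub>G\<^esub> x \<otimes>\<^bsub>G\<^esub> g \<otimes>\<^bsub>G\<^esub> x))
        = (\<Sum>C\<in>orb ` E. \<Sum>i\<in>T \<times> C. \<Sum>x\<in>carrier G. \<theta> i (inv\<^bsub>G\<^esub> x \<otimes>\<^bsub>G\<^esub> g \<otimes>\<^bsub>G\<^esub> x))"
      unfolding cls_def by (subst sum.reindex[OF inj]) simp
    also have "\<dots> = (\<Sum>C\<in>orb ` E. \<Sum>t\<in>T. \<Sum>j\<in>C. ind_sum t (\<xi> j) g)"
      proof (intro sum.cong refl)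
      fix C
      have "(\<Sum>i\<in>T \<times> C. F i) = (\<Sum>t\<in>T. \<Sum>j\<in>C. F (t, j))" for F :: "'p mod_ring \<times> nat \<Rightarrow> complex"
        by (simp add: sum.cartesian_product)
      then show "(\<Sum>i\<in>T \<times> C. \<Sum>x\<in>carrier G. \<theta> i (inv\<^bsub>G\<^esub> x \<otimes>\<^bsub>G\<^esub> g \<otimes>\<^bsub>G\<^esub> x)) = (\<Sum>t\<in>T. \<Sum>j\<in>C. ind_sum t (\<xi> j) g)"
        by (simp only: ind)
    qed
    also have "\<dots> = (\<Sum>C\<in>orb ` E. \<Sum>j\<in>C. \<Sum>t\<in>T. ind_sum t (\<xi> j) g)"
      by (intro sum.cong refl sum.swap)
    also have "\<dots> = (\<Sum>j\<in>E. \<Sum>t\<in>T. ind_sum t (\<xi> j) g)"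
      unfolding orb_def
      by (rule Gam.orbits_partition[symmetric]) (use closed mult one in \<open>auto simp: E_def\<close>)
    finally show ?thesis by (simp add: Tot_ind_sum E_def T_def)
  qed
  have "\<exists>\<chi>\<in>Char_Q H. \<forall>g\<in>carrier G. of_nat (((CARD('p) - 1) * 2 ^ e) * card B) * \<chi> (h g) =
      (\<Sum>C\<in>cls. \<Sum>i\<in>C. \<Sum>x\<in>carrier G. \<theta> i (inv\<^bsub>G\<^esub> x \<otimes>\<^bsub>G\<^esub> g \<otimes>\<^bsub>G\<^esub> x))"
  proof (rule h.rational_induced_combination[where J = "T \<times> E"])
    show "h ` carrier G = carrier H" "finite (carrier G)" "subgroup B G"
      using h(2) finite_SL subgroup_B by auto
    show "\<theta> j x = 0" if "j \<in> T \<times> E" "x \<in> carrier G" "x \<notin> B" for j x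
      using that by (auto simp: \<theta>_def chr_outside)
    show "\<theta> j (x \<otimes>\<^bsub>G\<^esub> y) = \<theta> j x * \<theta> j y" if "j \<in> T \<times> E" "x \<in> B" "y \<in> B" for j x y
      using that by (auto simp: \<theta>_def chr_mult[OF xi_order])
    show "kernel G H h \<subseteq> B"
      using ker chr_scalar(1)[OF _ _ xi_order] by (auto simp: kernel_def)
    show "\<theta> j x = 1" if "j \<in> T \<times> E" "x \<in> kernel G H h" for j x
    proof -
      obtain c where "x = c \<cdot>\<^sub>m 1\<^sub>m k" using ker \<open>x \<in> kernel G H h\<close> by blast
      moreover have "x \<in> carrier G" using \<open>x \<in> kernel G H h\<close> by (simp add: kernel_def)
      ultimately show ?thesis using chr_scalar(2)[OF _ _ xi_order] by (simp add: \<theta>_def case_prod_unfold)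
    qed
    show "C \<subseteq> T \<times> E \<and> C \<noteq> {} \<and> (CARD('p) - 1) * 2 ^ e dvd card C" if C: "C \<in> cls" for C
    proof -
      obtain j where j: "j \<in> E" "C = T \<times> orb j" using C by (auto simp: cls_def)
      have "j \<in> orb j" using one[OF j(1)] Gam.one_closed unfolding orb_def by (metis (mono_tags, lifting) mem_Collect_eq)
      moreover have "card C = (CARD('p) - 1) * card (orb j)"
        by (simp add: j(2) card_cartesian_product T_def card_Diff_singleton)
      ultimately show ?thesis using orb_E[OF j(1)] orb_dvd[OF j(1)] T1 j(2) by auto
    qed
    show "(\<Sum>x\<in>carrier G. \<theta> i (inv\<^bsub>G\<^esub> x \<otimes>\<^bsub>G\<^esub> g \<otimes>\<^bsub>G\<^esub> x)) = (\<Sum>x\<in>carrier G. \<theta> j (inv\<^bsub>G\<^esub> x \<otimes>\<^bsub>G\<^esub> g \<otimes>\<^bsub>G\<^esub> x))"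
      if C: "C \<in> cls" and i: "i \<in> C" and j: "j \<in> C" and g: "g \<in> carrier G" for C i j g
    proof -
      obtain l where l: "l \<in> E" "C = T \<times> orb l" using C by (auto simp: cls_def)
      have "ind_sum t (\<xi> r) g = ind_sum 1 (\<xi> l) g" if tr: "(t, r) \<in> C" for t r
      proof -
        obtain \<gamma> where "\<gamma> \<in> Gam" "r = (\<gamma> * l) mod q" "t \<noteq> 0"
          using tr l(2) by (auto simp: orb_def f_def car T_def)
        then show ?thesis using ind_sum_Gam[of 1 t \<gamma> g l] g by simp
      qed
      moreover obtain t r t' r' where "i = (t, r)" "j = (t', r')" by (cases i, cases j) auto
      ultimately show ?thesis using i j by (simp only: ind)
    qed
    show "(\<Sum>C\<in>cls. \<Sum>j\<in>C. \<Sum>x\<in>carrier G. \<theta> j (inv\<^bsub>G\<^esub> x \<otimes>\<^bsub>G\<^esub> g \<otimes>\<^bsub>G\<^esub> x)) \<in> \<rat>" for g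
      unfolding Tot by (rule Tot_rational)
    show "(CARD('p) - 1) * 2 ^ e > 0" using p_gt_2 by simp
  qed
  then show ?thesis unfolding Tot by (simp add: mult_ac)
qed

text \<open>With 2^v and 2^e the exact 2-parts of the centraliser and of \<open>Gam\<close>,
  everything cancels from the comparison except odd numbers and the number of scalars.\<close>

theorem two_power_dvd_group_exponent:
  assumes H: "group H" and h: "h \<in> hom G H" "h ` carrier G = carrier H"
    and ker: "\<And>x. x \<in> kernel G H h \<Longrightarrow> \<exists>c. x = c \<cdot>\<^sub>m 1\<^sub>m k"
    and m: "2 ^ m dvd card {s :: 'p mod_ring. s ^ k = 1}"
  shows "2 ^ m dvd group_exponent (C_hat H)"
proof -
  interpret h: group_hom G H h by (intro group_hom.intro G.group_axioms H group_hom_axioms.intro h(1))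
  let ?c = "card (Nrm 1)" and ?g = "card Gam"
  have "?c > 0" using one_Nrm finite_Nrm by (auto simp: card_gt_0_iff)
  then obtain v c' where c: "?c = 2 ^ v * c'" "odd c'" using odd_part by blast
  have "?g > 0" using Gam_I[OF one_Nrm] by (auto simp: card_gt_0_iff Gam_def)
  then obtain e g' where g: "?g = 2 ^ e * g'" "odd g'" using odd_part by blast
  obtain \<chi> where \<chi>: "\<chi> \<in> Char_Q H"
    "\<And>g. g \<in> carrier G \<Longrightarrow> of_nat ((CARD('p) - 1) * 2 ^ e * card B) * \<chi> (h g) = Tot g"
    using exists_character[OF H h ker, of e] g(1) by auto
  \<comment> \<open>The entry \<open>1 / det Q\<close> brings the centraliser into
    \<open>SL\<close>. The price is that \<open>\<tau> Q\<close> only normalises the group generated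
    by \<open>u\<close>.\<close>
  define \<tau> where "\<tau> = (\<lambda>Q. bdiag (upper2 (1 / det Q) 0 1) Q :: 'p mod_ring mat)"
  let ?zP = "(- 1) \<cdot>\<^sub>m 1\<^sub>m n :: 'p mod_ring mat"
  let ?a = "(CARD('p) - 1) * 2 ^ e * card B"
  have det_zP: "det ?zP = 1" using n(2) by simp
  have zP: "?zP \<in> Nrm 1"
    using U det_zP by (simp add: Nrm_def mult_smult_assoc_mat[of _ n n _ n] mult_smult_distrib[of _ n n _ n])
  show ?thesis
  proof (rule h.two_power_dvd_exponent[where P = Cent and \<tau> = \<tau> and zP = ?zP and z = z and u = u and l = "CARD('p) * q"
        and \<chi> = \<chi> and a = ?a and b = "2 * int (card M)" and v = v])
    show "h ` carrier G = carrier H" "finite (carrier G)" using h(2) finite_SL by auto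
    show "group Cent" "finite (carrier Cent)" "2 ^ v dvd Coset.order Cent"
      using group_Cent finite_Nrm c(1) by (simp_all add: Coset.order_def)
    show "\<tau> \<in> hom Cent G"
    proof (rule homI)
      fix Q R assume QR: "Q \<in> carrier Cent" "R \<in> carrier Cent"
      then have QR': "Q \<in> carrier_mat n n" "R \<in> carrier_mat n n" by (auto simp: Nrm_def)
      show "\<tau> (Q \<otimes>\<^bsub>Cent\<^esub> R) = \<tau> Q \<otimes>\<^bsub>G\<^esub> \<tau> R"
        using QR' by (simp add: \<tau>_def bdiag_mult[of _ 2 _ n] upper2_mult det_mult[of _ n])
    qed (auto simp: \<tau>_def carrier_G Nrm_def bdiag_det[of _ 2 _ n] det_upper2)
    show "?zP \<in> carrier Cent" using zP by simp
    show "\<tau> ?zP = z" using det_zP by (simp add: \<tau>_def z_def bel_1 W_q)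
    show "Q = \<one>\<^bsub>Cent\<^esub> \<or> Q = ?zP" if "Q \<in> carrier Cent" "Q \<otimes>\<^bsub>Cent\<^esub> Q = \<one>\<^bsub>Cent\<^esub>" for Q
      using that involution[of Q] U by (simp add: Nrm_def)
    show "Q \<otimes>\<^bsub>Cent\<^esub> ?zP = ?zP \<otimes>\<^bsub>Cent\<^esub> Q" if "Q \<in> carrier Cent" for Q
      using that by (auto simp: Nrm_def mult_smult_assoc_mat[of _ n n _ n] mult_smult_distrib[of _ n n _ n])
    show "?zP \<otimes>\<^bsub>Cent\<^esub> ?zP = \<one>\<^bsub>Cent\<^esub>"
      by (simp add: mult_smult_assoc_mat[of _ n n _ n] mult_smult_distrib[of _ n n _ n])
    show "u \<in> carrier G" by (rule u_G)
    show "u \<otimes>\<^bsub>G\<^esub> z = z \<otimes>\<^bsub>G\<^esub> u" by (simp add: u_def z_def bel_mult add.commute)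
    show "odd (CARD('p) * q)" using p q(1) by simp
    show "u [^]\<^bsub>G\<^esub> (CARD('p) * q) = \<one>\<^bsub>G\<^esub>"
    proof -
      have "u ^\<^sub>m (CARD('p) * q) = bel 1 0 (Suc q * (CARD('p) * q) mod (2 * q))"
        by (simp add: u_def bel_pow bel_mod)
      moreover obtain r where "Suc q = 2 * r" using q(1) by (metis even_Suc evenE)
      ultimately show ?thesis by (simp add: SL_pow[OF u_G] bel_one)
    qed
    show "\<exists>i::nat. u \<otimes>\<^bsub>G\<^esub> \<tau> Q = \<tau> Q \<otimes>\<^bsub>G\<^esub> u [^]\<^bsub>G\<^esub> i" if Q: "Q \<in> carrier Cent" for Q
    proof -
      have Q': "Q \<in> carrier_mat n n" "det Q \<noteq> 0" "U * Q = Q * U" using Q U by (auto simp: Nrm_def)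
      obtain j where j: "det Q = of_nat j" using surj_of_nat_mod_ring by blast
      \<comment> \<open>Conjugation by \<open>\<tau> Q\<close> scales the unipotent parameter by
        \<open>det Q\<close> and fixes \<open>U\<close>; the Chinese remainder theorem finds a power
        of \<open>u\<close> doing both.\<close>
      obtain i where i: "[i = j] (mod CARD('p))" "[i = 1] (mod q)"
        using binary_chinese_remainder_nat[of "CARD('p)" q] q(3) by (auto simp: coprime_commute)
      have "(of_nat i :: 'p mod_ring) = of_nat (i mod CARD('p))" using of_nat_mod_CHAR[of i, where ?'a = "'p mod_ring"] by simp
      also have "\<dots> = of_nat (j mod CARD('p))" using i(1) by (simp add: cong_def)
      also have "\<dots> = det Q" using of_nat_mod_CHAR[of j, where ?'a = "'p mod_ring"] j by simp
      finally have ij: "of_nat i = det Q" .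
      have "W ^\<^sub>m (Suc q * i) = U ^\<^sub>m i" unfolding pow_mat_mult[OF W_carrier] W_q1 ..
      also have "\<dots> = U ^\<^sub>m 1" using i(2) unfolding U_pow_eq_iff by (simp add: cong_def)
      also have "\<dots> = U" using U by simp
      finally have "u ^\<^sub>m i = bdiag (upper2 1 (det Q) 1) U"
        unfolding u_def bel_pow ij by (simp add: bel_1 del: mult_Suc pow_mat.simps)
      then have "u * \<tau> Q = \<tau> Q * u ^\<^sub>m i"
        using Q' U by (simp add: u_eq \<tau>_def bdiag_mult[of _ 2 _ n] upper2_mult)
      then show ?thesis by (auto simp: SL_pow[OF u_G])
    qed
    show "\<chi> \<in> Char_Q H" by (rule \<chi>(1))
    have uz: "u \<otimes>\<^bsub>G\<^esub> z \<in> carrier G" using u_G z_G by (rule G.m_closed)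
    show "of_nat ?a * (\<chi> (h u) - \<chi> (h (u \<otimes>\<^bsub>G\<^esub> z))) = of_int (2 * int (card M))"
      unfolding right_diff_distrib \<chi>(2)[OF u_G] \<chi>(2)[OF uz] by (simp add: Tot_u Tot_uz)
    show "2 ^ m dvd N" if eq: "int N * (2 * int (card M)) = 2 ^ v * l * int ?a" for N l
    proof -
      obtain w where w: "card {s :: 'p mod_ring. s ^ k = 1} = 2 ^ m * w" using m by blast
      \<comment> \<open>The common factor of both sides. What remains is \<open>N\<close> times an
        odd number on the left and a multiple of the number of scalars on the right.\<close>
      let ?K = "(int CARD('p) - 1) * int CARD('p) * 2 * 2 ^ v * 2 ^ e"
      have p1: "int (CARD('p) - 1) = int CARD('p) - 1" using p_gt_2 by (simp add: of_nat_diff)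
      have "?K * (int N * int (c' * g')) = ?K * (l * int (2 ^ m * w * q))"
        using eq unfolding card_M c(1) g(1) card_B w by (simp add: p1 mult_ac)
      moreover have "?K \<noteq> 0" using p_gt_2 by simp
      ultimately have "int N * int (c' * g') = l * int (2 ^ m * w * q)" by (metis mult_cancel_left)
      then have "(2 ^ m :: int) dvd int N * int (c' * g')" by simp
      moreover have "coprime ((2 :: int) ^ m) (int (c' * g'))" using c(2) g(2) by simp
      ultimately have "(2 ^ m :: int) dvd int N" by (simp add: coprime_dvd_mult_left_iff)
      then show ?thesis by (metis int_dvd_int_iff of_nat_numeral of_nat_power)
    qed
  qed
qed

end

section \<open>The case $k=4$ and $p\equiv 3$ modulo 4\<close>

lemma det_mat2:
  assumes "A \<in> carrier_mat 2 2"
  shows "det A = A $$ (0, 0) * A $$ (1, 1) - A $$ (0, 1) * (A $$ (1, 0) :: 'a :: comm_ring_1)"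
proof -
  have "det A = (\<Sum>j<2. A $$ (0, j) * cofactor A 0 j)"
    by (rule laplace_expansion_row[OF assms]) simp
  moreover have "cofactor A 0 0 = A $$ (1, 1)" "cofactor A 0 1 = - A $$ (1, 0)"
    using assms unfolding cofactor_def by (subst det_single; simp add: mat_delete_def)+
  ultimately show ?thesis by (simp add: numeral_2_eq_2 lessThan_Suc)
qed

definition mat2 :: "'a \<Rightarrow> 'a \<Rightarrow> 'a \<Rightarrow> 'a \<Rightarrow> 'a mat" where
  "mat2 a b c d = mat 2 2 (\<lambda>(i, j). if i = 0 then (if j = 0 then a else b) else (if j = 0 then c else d))"

lemma mat2_carrier [simp]: "mat2 a b c d \<in> carrier_mat 2 2"
  by (simp add: mat2_def)

lemma mat2_index [simp]:
  "mat2 a b c d $$ (0, 0) = a" "mat2 a b c d $$ (0, Suc 0) = b"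
  "mat2 a b c d $$ (Suc 0, 0) = c" "mat2 a b c d $$ (Suc 0, Suc 0) = d"
  by (simp_all add: mat2_def)

lemma mat2_cases:
  assumes "A \<in> carrier_mat 2 2"
  obtains a b c d where "A = mat2 a b c d"
proof
  show "A = mat2 (A $$ (0, 0)) (A $$ (0, 1)) (A $$ (1, 0)) (A $$ (1, 1))"
    using assms by (subst mat2_eq_iff) auto
qed

lemma mat2_inject: "mat2 a b c d = mat2 a' b' c' d' \<longleftrightarrow> a = a' \<and> b = b' \<and> c = c' \<and> d = d'"
  by (subst mat2_eq_iff) auto

lemma mat2_mult: "mat2 a b c d * mat2 a' b' c' d' =
    mat2 (a * a' + b * c') (a * b' + b * d') (c * a' + d * c') (c * b' + d * (d' :: 'a :: comm_ring_1))"
  by (subst mat2_eq_iff[OF mult_carrier_mat[OF mat2_carrier mat2_carrier] mat2_carrier])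
     (simp add: mat2_mult_index del: index_mult_mat)

lemma mat2_det: "det (mat2 a b c d) = a * d - b * (c :: 'a :: comm_ring_1)"
  by (simp add: det_mat2[OF mat2_carrier])

lemma upper2_mat2: "upper2 a b d = mat2 a b 0 d"
  by (simp add: upper2_def mat2_def)

lemma one_mat2: "1\<^sub>m 2 = mat2 1 0 0 1"
  by (subst mat2_eq_iff) auto

lemma smult_mat2: "s \<cdot>\<^sub>m mat2 a b c d = mat2 (s * a) (s * b) (s * c) (s * d)"
  by (rule eq_matI) (auto simp: mat2_def less_2_cases')

lemma zero_mat2: "0\<^sub>m 2 2 = mat2 0 0 0 0"
  by (subst mat2_eq_iff) auto

text \<open>The square being 1 makes trace times off-diagonal entries vanish, and trace 0 would give
  determinant -1.\<close>

lemma SL2_involution: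
  assumes "Q \<in> carrier_mat 2 2" "det Q = (1 :: 'a :: field)" "Q * Q = 1\<^sub>m 2" "(2 :: 'a) \<noteq> 0"
  shows "Q = 1\<^sub>m 2 \<or> Q = (- 1) \<cdot>\<^sub>m 1\<^sub>m 2"
proof -
  obtain a b c d where Q: "Q = mat2 a b c d" using mat2_cases[OF assms(1)] .
  have e: "a * a + b * c = 1" "a * b + b * d = 0" "c * a + d * c = 0" "c * b + d * d = 1"
    using assms(3) by (simp_all add: Q mat2_mult one_mat2 mat2_inject)
  have det: "a * d - b * c = 1" using assms(2) by (simp add: Q mat2_det)
  have "a + d \<noteq> 0"
  proof
    assume "a + d = 0"
    then have "d = - a" by (simp add: add_eq_0_iff)
    then have "- (a * a + b * c) = 1" using det by (simp add: algebra_simps)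
    then have "(1 :: 'a) + 1 = 0" unfolding e(1) by (metis add.right_inverse)
    then show False using assms(4) by simp
  qed
  moreover have "b * (a + d) = 0" "c * (a + d) = 0" using e(2,3) by (simp_all add: algebra_simps)
  ultimately have bc: "b = 0" "c = 0" by auto
  then have aa: "a * a = 1" "a * d = 1" using e det by auto
  then have "a \<noteq> 0" by auto
  then have "d = a" using aa by (metis mult_left_cancel)
  moreover have "a = 1 \<or> a = - 1" using aa(1) by (simp add: square_eq_1_iff)
  ultimately show ?thesis using bc by (auto simp: Q one_mat2 smult_mat2)
qed

text \<open>Here p + 1 has no odd part, so no torus element of odd order is at hand. A unipotent
  \<open>u\<close> commutes with the whole lower \<open>SL\<close> of degree 2, whose only
  involution is -1, and the characters of order 4 of \<open>W\<close> supply the sign at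
  \<open>z\<close>.\<close>

locale three_mod_four =
  fixes W :: "'p::prime_card mod_ring mat"
  assumes p: "CARD('p) mod 4 = 3" and W_eq: "W = mat2 0 (- 1) 1 0"
begin

lemma p_gt_2: "CARD('p) > 2"
  using p by (cases "CARD('p) \<le> 2") (auto simp: le_Suc_eq numeral_2_eq_2)

lemma two_nonzero: "(2 :: 'p mod_ring) \<noteq> 0"
proof
  assume "(2 :: 'p mod_ring) = 0"
  then have "(of_nat 2 :: 'p mod_ring) = 0" by simp
  then have "CARD('p) dvd 2" by (rule of_nat_0_mod_ring_dvd)
  then show False using p_gt_2 by (auto dest: dvd_imp_le)
qed

lemma minus_eq_iff: "- x = x \<longleftrightarrow> x = (0 :: 'p mod_ring)"
proof
  assume "- x = x"
  then have "2 * x = 0" by (metis add.right_inverse mult_2)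
  then show "x = 0" using two_nonzero by simp
qed simp

text \<open>A square root x of -1 would satisfy both x^p = x and x^p = (-1)^((p-1)/2) x =
  -x.\<close>

lemma minus_one_nonsquare: "\<not> (\<exists>x. (- 1 :: 'p mod_ring) = x ^ 2)"
proof
  assume "\<exists>x. (- 1 :: 'p mod_ring) = x ^ 2"
  then obtain x :: "'p mod_ring" where x: "x ^ 2 = - 1" by metis
  then have "x \<noteq> 0" by auto
  obtain r where r: "CARD('p) = 4 * r + 3" using p by (metis mult_div_mod_eq)
  have "x ^ CARD('p) = x" using finite_field_power_card_eq_same[of x] by simp
  moreover have "x ^ CARD('p) = (x ^ 2) ^ (2 * r + 1) * x"
  proof -
    have "CARD('p) = 2 * (2 * r + 1) + 1" using r by simp
    then show ?thesis by (simp only: power_add power_mult power_one_right)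
  qed
  ultimately have "- x = x" by (simp add: x)
  then show False using minus_eq_iff[of x] \<open>x \<noteq> 0\<close> by simp
qed

text \<open>Otherwise adding 1 would preserve squares and, by induction, every residue including -1
  would be a square. The number \<open>x ^ 2 + 1\<close> is the determinant of \<open>x + W\<close>,
  which commutes with \<open>W\<close>.\<close>

lemma exists_nonsquare: "\<exists>x :: 'p mod_ring. x ^ 2 + 1 \<noteq> 0 \<and> \<not> (\<exists>y. x ^ 2 + 1 = y ^ 2)"
proof (rule ccontr)
  assume *: "\<not> ?thesis"
  have "\<exists>y. x ^ 2 + 1 = y ^ 2" for x :: "'p mod_ring"
  proof (cases "x ^ 2 + 1 = 0")
    case True
    then show ?thesis by (intro exI[of _ 0]) simp
  qed (use * in blast)
  then have "\<exists>y :: 'p mod_ring. of_nat m = y ^ 2" for m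
  proof (induction m)
    case 0
    show ?case by (intro exI[of _ 0]) simp
  next
    case (Suc m)
    then obtain y :: "'p mod_ring" where "of_nat m = y ^ 2" by blast
    then have "of_nat (Suc m) = y ^ 2 + 1" by simp
    then show ?case using Suc.prems by metis
  qed
  moreover obtain m where "(- 1 :: 'p mod_ring) = of_nat m" using surj_of_nat_mod_ring by blast
  ultimately show False using minus_one_nonsquare by metis
qed

lemma W_sq: "W ^\<^sub>m 2 = (- 1) \<cdot>\<^sub>m 1\<^sub>m 2"
proof -
  have "W ^\<^sub>m 2 = W * W" by (simp add: W_eq numeral_2_eq_2)
  then show ?thesis by (simp add: W_eq mat2_mult one_mat2 smult_mat2)
qed

lemma W_4: "W ^\<^sub>m 4 = 1\<^sub>m 2"
proof -
  have "W ^\<^sub>m 4 = W ^\<^sub>m 2 * W ^\<^sub>m 2" using pow_mat_add[of W 2 2 2] by (simp add: W_eq)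
  then show ?thesis by (simp add: W_sq one_mat2 smult_mat2 mat2_mult)
qed

sublocale torus_block 2 4 4 W
proof
  show "W \<in> carrier_mat 2 2" "det W = 1" by (simp_all add: W_eq mat2_det)
  show "W ^\<^sub>m 4 = 1\<^sub>m 2" by (rule W_4)
  have one: "W ^\<^sub>m 1 \<noteq> 1\<^sub>m 2"
    by (simp add: W_eq one_mat2 mat2_inject left_mult_one_mat[OF mat2_carrier])
  have two: "W ^\<^sub>m 2 \<noteq> 1\<^sub>m 2"
    using minus_eq_iff[of 1] by (simp add: W_sq) (simp add: one_mat2 smult_mat2 mat2_inject)
  have *: "i mod 4 = j mod 4" if "i \<le> j" "W ^\<^sub>m i = W ^\<^sub>m j" for i j
  proof -
    have Wc: "W \<in> carrier_mat 2 2" by (simp add: W_eq)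
    define d where "d = j - i"
    have Wd: "W ^\<^sub>m d = 1\<^sub>m 2"
      unfolding d_def by (rule mat_pow_cancel[OF Wc W_4 _ that(2,1)]) simp
    have "odd d \<or> d mod 4 = 2 \<or> 4 dvd d" by presburger
    moreover have "even d"
    proof (rule ccontr)
      assume "odd d"
      then obtain r where r: "d = 2 * r + 1" by (rule oddE)
      have "W ^\<^sub>m (d * 2) = 1\<^sub>m 2" using Wd Wc by (simp only: pow_mat_mult) simp
      also have "d * 2 = 4 * r + 2" by (simp add: r)
      also have "W ^\<^sub>m (4 * r + 2) = W ^\<^sub>m 2"
        using Wc by (simp only: pow_mat_add pow_mat_mult W_4) (simp add: W_sq)
      finally show False using two by simp
    qed
    moreover have "d mod 4 \<noteq> 2"
    proof
      assume "d mod 4 = 2"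
      then obtain r where r: "d = 4 * r + 2" by (metis mult_div_mod_eq)
      have "W ^\<^sub>m d = W ^\<^sub>m 2"
        using Wc unfolding r by (simp only: pow_mat_add pow_mat_mult W_4) (simp add: W_sq)
      then show False using two Wd by simp
    qed
    ultimately have "4 dvd d" by blast
    then show ?thesis using that(1) unfolding d_def by presburger
  qed
  then show "W ^\<^sub>m i = W ^\<^sub>m j \<Longrightarrow> i mod 4 = j mod 4" for i j
    by (metis nat_le_linear)
qed simp_all

definition "u = bel 1 1 0"
definition "z = bel 1 0 2"

lemma bel_1: "bel 1 b i = bdiag (upper2 1 b 1) (W ^\<^sub>m i)"
  by (simp add: bel_def)

lemma u_eq: "u = bdiag (upper2 1 1 1) (1\<^sub>m 2)"
  using W by (simp add: u_def bel_1)

lemma z_eq: "z = bdiag (1\<^sub>m 2) ((- 1) \<cdot>\<^sub>m 1\<^sub>m 2)"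
  by (simp add: z_def bel_1 upper2_one W_sq)

lemma u_G: "u \<in> carrier G" and z_G: "z \<in> carrier G"
  by (simp_all add: u_def z_def bel_carrier)

lemma uz_eq: "u * z = bel 1 1 2"
  by (simp add: u_def z_def bel_mult numeral_2_eq_2)

text \<open>The elements that conjugate \<open>u\<close> into \<open>B\<close>. The lower block of
  \<open>u\<close> is trivial, so some off-diagonal entries survive, in contrast to
  \<open>Muz\<close>, which plays this role for \<open>u * z\<close>.\<close>

definition Mu :: "'p mod_ring mat set" where
  "Mu = {four_block_mat (mat2 a b 0 d) (mat2 r s 0 0) (mat2 0 c 0 e) Q |a b d r s c e Q. Q \<in> carrier_mat 2 2 \<and> a * d * det Q = 1}"

definition Muz :: "'p mod_ring mat set" where
  "Muz = {bdiag (mat2 a b 0 d) Q |a b d Q. Q \<in> carrier_mat 2 2 \<and> a * d * det Q = 1}"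

text \<open>A column operation with the nonzero \<open>a\<close> clears the upper right block; it
  leaves \<open>Q\<close> alone because the first column of the lower left block is zero.\<close>

lemma det_Mu:
  assumes "Q \<in> carrier_mat 2 2" "(a :: 'p mod_ring) \<noteq> 0"
  shows "det (four_block_mat (mat2 a b 0 d) (mat2 r s 0 0) (mat2 0 c 0 e) Q) = a * d * det Q"
proof -
  let ?A = "mat2 a b 0 d" and ?C = "mat2 0 c 0 e" and ?R = "mat2 (r / a) (s / a) 0 0"
  have "four_block_mat ?A (0\<^sub>m 2 2) ?C Q * four_block_mat (1\<^sub>m 2) ?R (0\<^sub>m 2 2) (1\<^sub>m 2)
      = four_block_mat (?A * 1\<^sub>m 2 + 0\<^sub>m 2 2 * 0\<^sub>m 2 2) (?A * ?R + 0\<^sub>m 2 2 * 1\<^sub>m 2) (?C * 1\<^sub>m 2 + Q * 0\<^sub>m 2 2) (?C * ?R + Q * 1\<^sub>m 2)"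
    by (rule mult_four_block_mat[where ?nr1.0 = 2 and ?n1.0 = 2 and ?n2.0 = 2 and ?nr2.0 = 2 and ?nc1.0 = 2 and ?nc2.0 = 2])
       (use assms(1) in auto)
  also have "\<dots> = four_block_mat ?A (mat2 r s 0 0) ?C Q"
  proof (rule cong_four_block_mat)
    show "?A * ?R + 0\<^sub>m 2 2 * 1\<^sub>m 2 = mat2 r s 0 0"
      using assms(2) by (simp add: mat2_mult right_mult_one_mat[OF mat2_carrier] right_add_zero_mat[OF mat2_carrier] left_mult_zero_mat)
    have "?C * ?R = 0\<^sub>m 2 2" by (simp add: mat2_mult zero_mat2)
    then show "?C * ?R + Q * 1\<^sub>m 2 = Q" using assms(1) by simp
  qed (use assms(1) in \<open>simp_all add: right_mult_one_mat[OF mat2_carrier] right_add_zero_mat[OF mat2_carrier]\<close>)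
  finally have "det (four_block_mat ?A (mat2 r s 0 0) ?C Q)
      = det (four_block_mat ?A (0\<^sub>m 2 2) ?C Q) * det (four_block_mat (1\<^sub>m 2) ?R (0\<^sub>m 2 2) (1\<^sub>m 2))"
    using assms(1) by (metis det_mult four_block_carrier_mat mat2_carrier one_carrier_mat)
  moreover have "det (four_block_mat ?A (0\<^sub>m 2 2) ?C Q) = det ?A * det Q"
    by (rule det_four_block_mat_upper_right_zero[of _ 2 _ 2]) (use assms(1) in auto)
  moreover have "det (four_block_mat (1\<^sub>m 2) ?R (0\<^sub>m 2 2) (1\<^sub>m 2)) = det (1\<^sub>m 2) * det (1\<^sub>m 2)"
    by (rule det_four_block_mat_lower_left_zero[of _ 2 _ 2]) auto
  ultimately show ?thesis by (simp add: mat2_det)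
qed

text \<open>\<open>u ^ p = 1\<close> forces \<open>s = 1\<close> and 4 to divide \<open>i\<close>,
  so the conjugate is again unipotent with parameter \<open>b\<close>. Comparing blocks then gives
  the shape of \<open>x\<close>.\<close>

lemma conj_u_imp_Mu:
  assumes x: "x \<in> carrier G" and s: "s ^ 4 = 1" and eq: "u * x = x * bel s b i"
  shows "x \<in> Mu"
proof -
  have xk: "x \<in> carrier_mat 4 4" "det x = 1" using x by (auto simp: carrier_G)
  have s0: "s \<noteq> 0" using root_nonzero s by simp
  have sp: "s ^ CARD('p) = s" using finite_field_power_card_eq_same[of s] by simp
  have vG: "bel s b i \<in> carrier G" using s by (simp add: bel_carrier)
  have "u ^\<^sub>m CARD('p) * x = x * bel s b i ^\<^sub>m CARD('p)"
    by (rule pow_mat_intertwine[OF _ _ xk(1) eq]) (simp_all add: u_def bel_carrier_mat)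
  then have "x \<otimes>\<^bsub>G\<^esub> \<one>\<^bsub>G\<^esub> = x \<otimes>\<^bsub>G\<^esub> bel s 0 (i * CARD('p))"
    using xk by (simp add: u_def bel_pow sp bel_one)
  moreover have "bel s 0 (i * CARD('p)) \<in> carrier G" using s by (simp add: bel_carrier)
  ultimately have "\<one>\<^bsub>G\<^esub> = bel s 0 (i * CARD('p))" using x G.l_cancel G.one_closed by metis
  then have "bel 1 0 0 = bel s 0 (i * CARD('p))" by (simp add: bel_one)
  then have s1: "s = 1" and "(i * CARD('p)) mod 4 = 0"
    using bel_eq_iff[of 1 0 0 s 0 "i * CARD('p)"] by auto
  then have "4 dvd i * CARD('p)" by (simp add: mod_eq_0_iff_dvd)
  moreover have "coprime 4 CARD('p)"
  proof -
    have "odd CARD('p)" using p by presburger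
    then have "coprime (2 ^ 2) CARD('p)" by (simp only: coprime_power_left_iff coprime_left_2_iff_odd) simp
    then show ?thesis by simp
  qed
  ultimately have "4 dvd i" by (simp add: coprime_dvd_mult_left_iff)
  then have v: "bel s b i = bdiag (upper2 1 b 1) (1\<^sub>m 2)"
    using bel_mod[of 1 b i] W by (simp add: s1 bel_1 mod_eq_0_iff_dvd[THEN iffD2])
  have b0: "b \<noteq> 0"
  proof
    assume "b = 0"
    then have "bel s b i = \<one>\<^bsub>G\<^esub>" using v by (simp add: upper2_one bdiag_one)
    then have "u * x = 1\<^sub>m 4 * x" using eq xk by simp
    then have "u \<otimes>\<^bsub>G\<^esub> x = \<one>\<^bsub>G\<^esub> \<otimes>\<^bsub>G\<^esub> x" by simp
    then have "u = \<one>\<^bsub>G\<^esub>" by (rule G.r_cancel[OF _ u_G G.one_closed x])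
    then have "bel 1 1 0 = bel 1 0 0" by (simp add: u_def bel_one)
    then show False by (simp add: bel_eq_iff)
  qed
  obtain A B C D where bl: "A \<in> carrier_mat 2 2" "B \<in> carrier_mat 2 2" "C \<in> carrier_mat 2 2" "D \<in> carrier_mat 2 2"
    "x = four_block_mat A B C D"
  proof -
    have "x \<in> carrier_mat (2 + 2) (2 + 2)" using xk(1) by simp
    from block_decomposition[OF this] show thesis using that by blast
  qed
  have "four_block_mat (upper2 1 1 1 * A) (upper2 1 1 1 * B) (1\<^sub>m 2 * C) (1\<^sub>m 2 * D)
      = four_block_mat (A * upper2 1 b 1) (B * 1\<^sub>m 2) (C * upper2 1 b 1) (D * 1\<^sub>m 2)"
    using eq unfolding v u_eq bl(5)
    by (simp only: bdiag_four_block_mult[OF upper2_carrier one_carrier_mat bl(1-4)])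
  note blocks = four_block_eq_iff[THEN iffD1, rotated 8, OF this
      mult_carrier_mat[OF upper2_carrier bl(1)] mult_carrier_mat[OF upper2_carrier bl(2)]
      mult_carrier_mat[OF one_carrier_mat bl(3)] mult_carrier_mat[OF one_carrier_mat bl(4)]
      mult_carrier_mat[OF bl(1) upper2_carrier] mult_carrier_mat[OF bl(2) one_carrier_mat]
      mult_carrier_mat[OF bl(3) upper2_carrier] mult_carrier_mat[OF bl(4) one_carrier_mat]]
  have e: "upper2 1 1 1 * A = A * upper2 1 b 1" "upper2 1 1 1 * B = B" "C = C * upper2 1 b 1"
    using conjunct1[OF blocks] conjunct1[OF conjunct2[OF blocks]] conjunct1[OF conjunct2[OF conjunct2[OF blocks]]]
    by (simp_all only: left_mult_one_mat[OF bl(3)] right_mult_one_mat[OF bl(2)])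
  obtain a1 a2 a3 a4 where A: "A = mat2 a1 a2 a3 a4" using mat2_cases[OF bl(1)] .
  obtain b1 b2 b3 b4 where B: "B = mat2 b1 b2 b3 b4" using mat2_cases[OF bl(2)] .
  obtain c1 c2 c3 c4 where C: "C = mat2 c1 c2 c3 c4" using mat2_cases[OF bl(3)] .
  have a: "a3 = 0" "a4 = a1 * b" and bb: "b3 = 0" "b4 = 0" and cc: "c1 = 0" "c3 = 0"
    using e b0 by (auto simp: A B C upper2_mat2 mat2_mult mat2_inject)
  have xM: "x = four_block_mat (mat2 a1 a2 0 a4) (mat2 b1 b2 0 0) (mat2 0 c2 0 c4) D"
    by (simp add: bl(5) A B C a(1) bb cc)
  \<comment> \<open>Otherwise also a4 = a1 b = 0, and the second row of \<open>x\<close>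
    vanishes.\<close>
  have "a1 \<noteq> 0"
  proof
    assume a10: "a1 = 0"
    have "row x 1 = 0\<^sub>v 4"
      using bl(4) a10 a(2) unfolding xM by (intro eq_vecI) (auto simp: mat2_def)
    have "det x = 0"
    proof -
      have "det x = (\<Sum>j<4. x $$ (1, j) * cofactor x 1 j)"
        by (rule laplace_expansion_row[OF xk(1)]) simp
      moreover have "x $$ (1, j) = 0" if "j < 4" for j
        using \<open>row x 1 = 0\<^sub>v 4\<close> that xk(1) by (metis carrier_matD index_row(1) index_zero_vec(1) one_less_numeral_iff semiring_norm(76))
      ultimately show ?thesis by simp
    qed
    then show False using xk(2) by simp
  qed
  then have "a1 * a4 * det D = 1" using det_Mu[OF bl(4)] xk(2) unfolding xM by simp
  then show ?thesis unfolding Mu_def using xM bl(4) by blast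
qed

text \<open>Both \<open>u\<close> and \<open>z\<close> are powers of \<open>u * z\<close>, with
  exponents p + 1 and p. The first puts \<open>x\<close> into \<open>Mu\<close>; the second, where 1
  and -1 meet, removes the off-diagonal blocks.\<close>

lemma conj_uz_imp_Muz:
  assumes x: "x \<in> carrier G" and s: "s ^ 4 = 1" and eq: "(u * z) * x = x * bel s b i"
  shows "x \<in> Muz"
proof -
  have xk: "x \<in> carrier_mat 4 4" "det x = 1" using x by (auto simp: carrier_G)
  have sp: "s ^ CARD('p) = s" using finite_field_power_card_eq_same[of s] by simp
  have pow: "(u * z) ^\<^sub>m j * x = x * bel (s ^ j) (of_nat j * b) (i * j)" for j
    using pow_mat_intertwine[OF _ _ xk(1) eq, of j] bel_carrier_mat by (simp add: uz_eq bel_pow)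
  have "(u * z) ^\<^sub>m Suc CARD('p) = bel 1 1 ((2 * Suc CARD('p)) mod 4)"
    unfolding uz_eq bel_pow bel_mod by simp
  also have "(2 * Suc CARD('p)) mod 4 = 0" using p by presburger
  finally have "u * x = x * bel (s ^ Suc CARD('p)) (of_nat (Suc CARD('p)) * b) (i * Suc CARD('p))"
    using pow[of "Suc CARD('p)"] by (simp only: u_def)
  moreover have "(s ^ Suc CARD('p)) ^ 4 = 1" using s by (metis mult.commute power_mult power_one)
  ultimately have "x \<in> Mu" using conj_u_imp_Mu[OF x] by blast
  then obtain a b' d r t c e Q where xM: "x = four_block_mat (mat2 a b' 0 d) (mat2 r t 0 0) (mat2 0 c 0 e) Q"
    and Q: "Q \<in> carrier_mat 2 2" and ad: "a * d * det Q = 1" by (auto simp: Mu_def)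
  let ?V = "W ^\<^sub>m (i * CARD('p))"
  have "(u * z) ^\<^sub>m CARD('p) = bel 1 0 ((2 * CARD('p)) mod 4)"
    unfolding uz_eq bel_pow bel_mod by simp
  also have "(2 * CARD('p)) mod 4 = 2" using p by presburger
  finally have "z * x = x * bel s 0 (i * CARD('p))"
    using pow[of "CARD('p)"] by (simp add: z_def sp)
  moreover have "bel s 0 (i * CARD('p)) = bdiag (mat2 s 0 0 s) (s \<cdot>\<^sub>m ?V)"
    by (simp add: bel_def upper2_mat2)
  ultimately have zx: "bdiag (1\<^sub>m 2) (mat2 (- 1) 0 0 (- 1)) * x = x * bdiag (mat2 s 0 0 s) (s \<cdot>\<^sub>m ?V)"
    by (simp add: z_eq one_mat2 smult_mat2)
  obtain q1 q2 q3 q4 where Q': "Q = mat2 q1 q2 q3 q4" using mat2_cases[OF Q] .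
  obtain v1 v2 v3 v4 where V: "?V = mat2 v1 v2 v3 v4" using mat2_cases[OF W_pow] .
  have blk: "mat2 a b' 0 d = mat2 a b' 0 d * mat2 s 0 0 s"
    "mat2 r t 0 0 = mat2 r t 0 0 * (s \<cdot>\<^sub>m ?V)"
    "mat2 (- 1) 0 0 (- 1) * mat2 0 c 0 e = mat2 0 c 0 e * mat2 s 0 0 s"
    "mat2 (- 1) 0 0 (- 1) * Q = Q * (s \<cdot>\<^sub>m ?V)"
  proof -
    have "four_block_mat (1\<^sub>m 2 * mat2 a b' 0 d) (1\<^sub>m 2 * mat2 r t 0 0) (mat2 (- 1) 0 0 (- 1) * mat2 0 c 0 e) (mat2 (- 1) 0 0 (- 1) * Q)
      = four_block_mat (mat2 a b' 0 d * mat2 s 0 0 s) (mat2 r t 0 0 * (s \<cdot>\<^sub>m ?V)) (mat2 0 c 0 e * mat2 s 0 0 s) (Q * (s \<cdot>\<^sub>m ?V))"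
      using zx unfolding xM
      by (simp only: bdiag_four_block_mult[OF one_carrier_mat mat2_carrier mat2_carrier mat2_carrier mat2_carrier Q]
          bdiag_four_block_mult[OF mat2_carrier smult_W_pow mat2_carrier mat2_carrier mat2_carrier Q])
    note blocks = four_block_eq_iff[THEN iffD1, rotated 8, OF this
      mult_carrier_mat[OF one_carrier_mat mat2_carrier] mult_carrier_mat[OF one_carrier_mat mat2_carrier]
      mult_carrier_mat[OF mat2_carrier mat2_carrier] mult_carrier_mat[OF mat2_carrier Q]
      mult_carrier_mat[OF mat2_carrier mat2_carrier] mult_carrier_mat[OF mat2_carrier smult_W_pow]
      mult_carrier_mat[OF mat2_carrier mat2_carrier] mult_carrier_mat[OF Q smult_W_pow]]
    show "mat2 a b' 0 d = mat2 a b' 0 d * mat2 s 0 0 s" "mat2 r t 0 0 = mat2 r t 0 0 * (s \<cdot>\<^sub>m ?V)"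
      "mat2 (- 1) 0 0 (- 1) * mat2 0 c 0 e = mat2 0 c 0 e * mat2 s 0 0 s" "mat2 (- 1) 0 0 (- 1) * Q = Q * (s \<cdot>\<^sub>m ?V)"
      using conjunct1[OF blocks] conjunct1[OF conjunct2[OF blocks]] conjunct1[OF conjunct2[OF conjunct2[OF blocks]]]
        conjunct2[OF conjunct2[OF conjunct2[OF blocks]]]
      by (simp_all only: left_mult_one_mat[OF mat2_carrier])
  qed
  have a0: "a \<noteq> 0" and Q0: "det Q \<noteq> 0" using ad by auto
  have s1: "s = 1" using blk(1) a0 by (simp add: mat2_mult mat2_inject)
  have c0: "c = 0" "e = 0" using blk(3) minus_eq_iff by (auto simp: s1 mat2_mult mat2_inject)
  obtain R where R: "R \<in> carrier_mat 2 2" "R * Q = 1\<^sub>m 2" using inverse_mat_obtain[OF Q Q0] by metis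
  have "Q * ?V = Q * mat2 (- 1) 0 0 (- 1)"
    using blk(4) by (simp add: s1 Q' mat2_mult)
  then have "R * (Q * ?V) = R * (Q * mat2 (- 1) 0 0 (- 1))" by simp
  then have Vm: "?V = mat2 (- 1) 0 0 (- 1)"
    by (simp only: assoc_mult_mat[OF R(1) Q W_pow, symmetric] assoc_mult_mat[OF R(1) Q mat2_carrier, symmetric] R(2)
        left_mult_one_mat[OF W_pow] left_mult_one_mat[OF mat2_carrier])
  have "r = 0" "t = 0" using blk(2) minus_eq_iff by (auto simp: s1 Vm mat2_mult mat2_inject)
  then have "x = bdiag (mat2 a b' 0 d) Q"
    using Q unfolding xM by (simp add: bdiag_def c0 zero_mat2 carrier_matD[OF mat2_carrier])
  then show ?thesis unfolding Muz_def using Q ad by blast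
qed

lemma Mu_conj:
  assumes "x \<in> Mu"
  shows "x \<in> carrier G" "\<exists>b. b \<noteq> 0 \<and> u * x = x * bel 1 b 0"
proof -
  obtain a b d r s c e Q where x: "x = four_block_mat (mat2 a b 0 d) (mat2 r s 0 0) (mat2 0 c 0 e) Q"
    and Q: "Q \<in> carrier_mat 2 2" and ad: "a * d * det Q = 1" using assms by (auto simp: Mu_def)
  have a0: "a \<noteq> 0" "d \<noteq> 0" using ad by auto
  have "x \<in> carrier_mat (2 + 2) (2 + 2)" unfolding x using Q by (intro four_block_carrier_mat) auto
  then show "x \<in> carrier G" using det_Mu[OF Q a0(1)] ad unfolding x carrier_G by simp
  have v: "bel 1 (d / a) 0 = bdiag (upper2 1 (d / a) 1) (1\<^sub>m 2)" using W by (simp add: bel_1)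
  have "u * x = x * bel 1 (d / a) 0"
    unfolding v u_eq x
    unfolding bdiag_four_block_mult[OF upper2_carrier one_carrier_mat mat2_carrier mat2_carrier mat2_carrier Q]
  proof (rule cong_four_block_mat)
    show "upper2 1 1 1 * mat2 a b 0 d = mat2 a b 0 d * upper2 1 (d / a) 1"
      using a0 by (simp add: upper2_mat2 mat2_mult mat2_inject add.commute)
    show "upper2 1 1 1 * mat2 r s 0 0 = mat2 r s 0 0 * 1\<^sub>m 2" "1\<^sub>m 2 * mat2 0 c 0 e = mat2 0 c 0 e * upper2 1 (d / a) 1"
      by (simp_all add: upper2_mat2 one_mat2 mat2_mult)
  qed (use Q in simp)
  then show "\<exists>b. b \<noteq> 0 \<and> u * x = x * bel 1 b 0" using a0 by (intro exI[of _ "d / a"]) simp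
qed

lemma Muz_conj:
  assumes "x \<in> Muz"
  shows "x \<in> carrier G" "\<exists>b. b \<noteq> 0 \<and> u * z * x = x * bel 1 b 2"
proof -
  obtain a b d Q where x: "x = bdiag (mat2 a b 0 d) Q"
    and Q: "Q \<in> carrier_mat 2 2" and ad: "a * d * det Q = 1" using assms by (auto simp: Muz_def)
  have a0: "a \<noteq> 0" "d \<noteq> 0" using ad by auto
  have "x \<in> carrier_mat (2 + 2) (2 + 2)" unfolding x using Q by (intro bdiag_carrier) auto
  then show "x \<in> carrier G" using ad Q by (simp add: x carrier_G bdiag_det[of _ 2 _ 2] mat2_det)
  have "upper2 1 1 1 * mat2 a b 0 d = mat2 a b 0 d * upper2 1 (d / a) 1"
    using a0 by (simp add: upper2_mat2 mat2_mult mat2_inject add.commute)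
  moreover have "W ^\<^sub>m 2 * Q = Q * W ^\<^sub>m 2"
    using Q by (simp add: W_sq mult_smult_assoc_mat[of _ 2 2 _ 2] mult_smult_distrib[of _ 2 2 _ 2])
  ultimately have "u * z * x = x * bel 1 (d / a) 2"
    unfolding uz_eq bel_1 x
    by (simp only: bdiag_mult[OF upper2_carrier W_pow mat2_carrier Q] bdiag_mult[OF mat2_carrier Q upper2_carrier W_pow])
  then show "\<exists>b. b \<noteq> 0 \<and> u * z * x = x * bel 1 b 2" using a0 by (intro exI[of _ "d / a"]) simp
qed

lemma i_order: "(\<i> ^ j) ^ 4 = 1"
proof -
  have "\<i> ^ 4 = (\<i> ^ 2) ^ 2" by (simp only: power_mult[symmetric]) simp
  then have "\<i> ^ 4 = 1" by simp
  moreover have "(\<i> ^ j) ^ 4 = (\<i> ^ 4) ^ j" by (simp only: power_mult[symmetric] mult.commute)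
  ultimately show ?thesis by simp
qed

text \<open>The exponents 1 and 3 give \<open>\<i>\<close> and its conjugate, the values at
  \<open>W\<close> of its two faithful characters; their power sums are integers.\<close>

lemma sum_i: "(\<Sum>j\<in>{1, 3}. (\<i> ^ j) ^ l) = (if even l then 2 * (- 1) ^ (l div 2) else 0)"
proof -
  have *: "(\<i> ^ 2) ^ r = (- 1) ^ r" for r by simp
  have "(\<Sum>j\<in>{1, 3}. (\<i> ^ j) ^ l) = \<i> ^ l + (\<i> ^ l) ^ 3"
    by (simp add: power_mult[symmetric] mult.commute)
  also have "(\<i> ^ l) ^ 3 = \<i> ^ l * (\<i> ^ 2) ^ l"
    by (simp only: power_mult[symmetric] power_add[symmetric]) (simp add: algebra_simps)
  also have "\<i> ^ l + \<dots> = \<i> ^ l * (1 + (\<i> ^ 2) ^ l)" by (simp only: distrib_left mult_1_right)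
  also have "\<dots> = \<i> ^ l * (1 + (- 1) ^ l)" unfolding * ..
  finally show ?thesis by (auto elim!: evenE simp: power_mult)
qed

definition tot :: "'p mod_ring mat \<Rightarrow> complex" where
  "tot g = (\<Sum>t\<in>UNIV - {0}. \<Sum>j\<in>{1, 3}. chr t (\<i> ^ j) g)"

lemma tot_bel:
  assumes "s ^ 4 = 1"
  shows "tot (bel s b l) = (if b = 0 then of_nat (CARD('p) - 1) else - 1) * (if even l then 2 * (- 1) ^ (l div 2) else 0)"
proof -
  have "tot (bel s b l) = (\<Sum>t\<in>UNIV - {0}. \<Sum>j\<in>{1, 3}. add_char (t * b) * (\<i> ^ j) ^ l)"
    unfolding tot_def by (intro sum.cong refl chr_bel assms i_order)
  also have "\<dots> = (\<Sum>t\<in>UNIV - {0}. add_char (t * b)) * (\<Sum>j\<in>{1, 3}. (\<i> ^ j) ^ l)"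
    unfolding sum_product ..
  finally show ?thesis by (simp only: sum_add_char sum_i)
qed

lemma tot_outside: "x \<notin> B \<Longrightarrow> tot x = 0"
  by (simp add: tot_def chr_outside)

lemma tot_rational: "tot x \<in> \<rat>"
proof (cases "x \<in> B")
  case True
  then obtain s b l where "x = bel s b l" "s ^ 4 = 1" by (auto simp: B_def)
  then show ?thesis by (simp add: tot_bel)
qed (simp add: tot_outside)

definition Tot :: "'p mod_ring mat \<Rightarrow> complex" where
  "Tot g = (\<Sum>x\<in>carrier G. tot (inv\<^bsub>G\<^esub> x \<otimes>\<^bsub>G\<^esub> g \<otimes>\<^bsub>G\<^esub> x))"

lemma Tot_ind_sum: "Tot g = (\<Sum>t\<in>UNIV - {0}. \<Sum>j\<in>{1, 3}. ind_sum t (\<i> ^ j) g)"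
proof -
  have "Tot g = (\<Sum>t\<in>UNIV - {0}. \<Sum>x\<in>carrier G. \<Sum>j\<in>{1, 3}. chr t (\<i> ^ j) (inv\<^bsub>G\<^esub> x \<otimes>\<^bsub>G\<^esub> g \<otimes>\<^bsub>G\<^esub> x))"
    unfolding Tot_def tot_def by (rule sum.swap)
  also have "\<dots> = (\<Sum>t\<in>UNIV - {0}. \<Sum>j\<in>{1, 3}. ind_sum t (\<i> ^ j) g)"
    unfolding ind_sum_def by (intro sum.cong refl sum.swap)
  finally show ?thesis .
qed

text \<open>The additive sum is -1, and the sum over the two fourth roots is 2 at the identity. At
  \<open>z\<close> the latter is -2, so the values at \<open>u\<close> and \<open>u * z\<close> have
  opposite signs.\<close>

lemma Tot_u: "Tot u = of_nat (card Mu) * (- 2)"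
  unfolding Tot_def
proof (rule conj_sum_eq_card)
  fix x assume "x \<in> Mu"
  then obtain b where b: "b \<noteq> 0" "u * x = x * bel 1 b 0" using Mu_conj by blast
  then show "\<exists>v\<in>carrier G. u * x = x * v \<and> tot v = - 2"
    by (intro bexI[of _ "bel 1 b 0"]) (simp_all add: tot_bel bel_carrier)
qed (use tot_outside u_G Mu_conj(1) conj_u_imp_Mu in auto)

lemma Tot_uz: "Tot (u * z) = of_nat (card Muz) * 2"
  unfolding Tot_def
proof (rule conj_sum_eq_card)
  fix x assume "x \<in> Muz"
  then obtain b where b: "b \<noteq> 0" "u * z * x = x * bel 1 b 2" using Muz_conj by blast
  then show "\<exists>v\<in>carrier G. u * z * x = x * v \<and> tot v = 2"
    by (intro bexI[of _ "bel 1 b 2"]) (simp_all add: tot_bel bel_carrier)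
next
  show "u * z \<in> carrier G" using G.m_closed[OF u_G z_G] by simp
qed (use tot_outside Muz_conj(1) conj_uz_imp_Muz in auto)

lemma ind_sum_eq:
  assumes "t \<noteq> 0" "j \<in> {1, 3}" and g: "g \<in> carrier G"
  shows "ind_sum t (\<i> ^ j) g = ind_sum 1 \<i> g"
proof -
  obtain x :: "'p mod_ring" where x: "x ^ 2 + 1 \<noteq> 0" "\<not> (\<exists>y. x ^ 2 + 1 = y ^ 2)"
    using exists_nonsquare by blast
  have W3: "W ^\<^sub>m 3 = mat2 0 1 (- 1) 0"
  proof -
    have "W ^\<^sub>m 3 = W ^\<^sub>m 2 * W" by (simp add: numeral_3_eq_3 numeral_2_eq_2)
    also have "\<dots> = mat2 0 1 (- 1) 0" unfolding W_sq by (simp add: one_mat2 smult_mat2 W_eq mat2_mult)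
    finally show ?thesis .
  qed
  have "\<exists>Q. Q \<in> carrier_mat 2 2 \<and> det Q \<noteq> 0 \<and> W * Q = Q * W ^\<^sub>m j"
  proof (cases "j = 1")
    case True
    then show ?thesis using W by (intro exI[of _ "1\<^sub>m 2"]) simp
  next
    case False
    then have "j = 3" using assms(2) by simp
    \<comment> \<open>A reflection inverts the rotation \<open>W\<close>, and its inverse is its
      cube.\<close>
    moreover have "W * mat2 1 0 0 (- 1) = mat2 1 0 0 (- 1) * mat2 0 1 (- 1) 0" by (simp add: W_eq mat2_mult)
    ultimately have "W * mat2 1 0 0 (- 1) = mat2 1 0 0 (- 1) * W ^\<^sub>m j" by (simp add: W3)
    then show ?thesis by (intro exI[of _ "mat2 1 0 0 (- 1)"]) (simp add: mat2_det)
  qed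
  then obtain Q where Q: "Q \<in> carrier_mat 2 2" "det Q \<noteq> 0" "W * Q = Q * W ^\<^sub>m j" by blast
  \<comment> \<open>This matrix is \<open>x + W\<close>, the centralising element of nonsquare
    determinant.\<close>
  have det: "det (mat2 x (- 1) 1 x) = x ^ 2 + 1" by (simp add: mat2_det power2_eq_square)
  have "ind_sum (1 * t) (\<i> ^ j) g = ind_sum 1 \<i> g"
  proof (rule ind_sum_conj[OF Q mat2_carrier _ _ _ two_nonzero assms(1) _ g])
    show "W * mat2 x (- 1) 1 x = mat2 x (- 1) 1 x * W" by (simp add: W_eq mat2_mult)
    show "\<i> ^ 4 = 1" using i_order[of 1] by simp
  qed (use x det in auto)
  then show ?thesis by simp
qed

text \<open>All the linear characters are conjugate in \<open>G\<close>, so one class of size 2(p -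
  1) suffices.\<close>

lemma exists_character:
  assumes H: "group H" and h: "h \<in> hom G H" "h ` carrier G = carrier H"
    and ker: "\<And>x. x \<in> kernel G H h \<Longrightarrow> \<exists>c. x = c \<cdot>\<^sub>m 1\<^sub>m 4"
  shows "\<exists>\<chi>\<in>Char_Q H. \<forall>g\<in>carrier G. of_nat (2 * (CARD('p) - 1) * card B) * \<chi> (h g) = Tot g"
proof -
  interpret h: group_hom G H h by (intro group_hom.intro G.group_axioms H group_hom_axioms.intro h(1))
  define J where "J = (UNIV - {0 :: 'p mod_ring}) \<times> {1 :: nat, 3}"
  define \<theta> where "\<theta> = (\<lambda>(t, j). chr t (\<i> ^ j))"
  have ind: "(\<Sum>x\<in>carrier G. \<theta> (t, j) (inv\<^bsub>G\<^esub> x \<otimes>\<^bsub>G\<^esub> g \<otimes>\<^bsub>G\<^esub> x)) = ind_sum t (\<i> ^ j) g" for t j g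
    by (simp add: \<theta>_def ind_sum_def)
  have sumJ: "(\<Sum>i\<in>J. F i) = (\<Sum>t\<in>UNIV - {0}. \<Sum>j\<in>{1, 3}. F (t, j))" for F :: "'p mod_ring \<times> nat \<Rightarrow> complex"
    unfolding J_def by (simp only: sum.cartesian_product) (simp add: case_prod_unfold)
  have Tot: "(\<Sum>C\<in>{J}. \<Sum>i\<in>C. \<Sum>x\<in>carrier G. \<theta> i (inv\<^bsub>G\<^esub> x \<otimes>\<^bsub>G\<^esub> g \<otimes>\<^bsub>G\<^esub> x)) = Tot g" for g
    unfolding Tot_ind_sum ind[symmetric]
    using sumJ[of "\<lambda>i. \<Sum>x\<in>carrier G. \<theta> i (inv\<^bsub>G\<^esub> x \<otimes>\<^bsub>G\<^esub> g \<otimes>\<^bsub>G\<^esub> x)"] by simp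
  have "\<exists>\<chi>\<in>Char_Q H. \<forall>g\<in>carrier G. of_nat (2 * (CARD('p) - 1) * card B) * \<chi> (h g) =
      (\<Sum>C\<in>{J}. \<Sum>i\<in>C. \<Sum>x\<in>carrier G. \<theta> i (inv\<^bsub>G\<^esub> x \<otimes>\<^bsub>G\<^esub> g \<otimes>\<^bsub>G\<^esub> x))"
  proof (rule h.rational_induced_combination[where J = J])
    show "h ` carrier G = carrier H" "finite (carrier G)" "subgroup B G"
      using h(2) finite_SL subgroup_B by auto
    show "\<theta> j x = 0" if "j \<in> J" "x \<in> carrier G" "x \<notin> B" for j x
      using that by (simp add: \<theta>_def case_prod_unfold chr_outside)
    show "\<theta> j (x \<otimes>\<^bsub>G\<^esub> y) = \<theta> j x * \<theta> j y" if "j \<in> J" "x \<in> B" "y \<in> B" for j x y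
      using that chr_mult[OF i_order] by (simp add: \<theta>_def case_prod_unfold)
    show "kernel G H h \<subseteq> B"
      using ker chr_scalar(1)[OF _ _ i_order] by (auto simp: kernel_def)
    show "\<theta> j x = 1" if "j \<in> J" "x \<in> kernel G H h" for j x
    proof -
      obtain c where "x = c \<cdot>\<^sub>m 1\<^sub>m 4" using ker \<open>x \<in> kernel G H h\<close> by blast
      moreover have "x \<in> carrier G" using \<open>x \<in> kernel G H h\<close> by (simp add: kernel_def)
      ultimately show ?thesis using chr_scalar(2)[OF _ _ i_order] by (simp add: \<theta>_def case_prod_unfold)
    qed
    show "C \<subseteq> J \<and> C \<noteq> {} \<and> 2 * (CARD('p) - 1) dvd card C" if "C \<in> {J}" for C
    proof -
      have "card J = (CARD('p) - 1) * 2" by (simp add: J_def card_cartesian_product card_Diff_singleton)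
      moreover have "(1, 1) \<in> J" by (simp add: J_def)
      ultimately show ?thesis using that by auto
    qed
    show "(\<Sum>x\<in>carrier G. \<theta> i (inv\<^bsub>G\<^esub> x \<otimes>\<^bsub>G\<^esub> g \<otimes>\<^bsub>G\<^esub> x)) = (\<Sum>x\<in>carrier G. \<theta> j (inv\<^bsub>G\<^esub> x \<otimes>\<^bsub>G\<^esub> g \<otimes>\<^bsub>G\<^esub> x))"
      if C: "C \<in> {J}" and i: "i \<in> C" and j: "j \<in> C" and g: "g \<in> carrier G" for C i j g
    proof -
      obtain t r t' r' where ij: "i = (t, r)" "j = (t', r')" by (cases i, cases j) auto
      then have "t \<noteq> 0" "r \<in> {1, 3}" "t' \<noteq> 0" "r' \<in> {1, 3}" using C i j by (auto simp: J_def)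
      then show ?thesis unfolding ij ind using ind_sum_eq[OF _ _ g] by metis
    qed
    show "(\<Sum>C\<in>{J}. \<Sum>j\<in>C. \<Sum>x\<in>carrier G. \<theta> j (inv\<^bsub>G\<^esub> x \<otimes>\<^bsub>G\<^esub> g \<otimes>\<^bsub>G\<^esub> x)) \<in> \<rat>" for g
      unfolding Tot Tot_def by (intro Rats_sum tot_rational)
    show "2 * (CARD('p) - 1) > 0" using p_gt_2 by simp
  qed
  then show ?thesis unfolding Tot .
qed

text \<open>The two sets differ only in the four off-diagonal entries, which are free in
  \<open>Mu\<close> and zero in \<open>Muz\<close>. The ratio p^4 matters later through p^4 +
  1.\<close>

lemma card_Mu: "card Mu = (CARD('p) - 1) ^ 2 * CARD('p) ^ 5 * card (carrier (SL 2 :: 'p mod_ring mat monoid))"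
  and card_Muz: "card Muz = (CARD('p) - 1) ^ 2 * CARD('p) * card (carrier (SL 2 :: 'p mod_ring mat monoid))"
proof -
  let ?S = "carrier (SL 2 :: 'p mod_ring mat monoid)" and ?T = "UNIV - {0 :: 'p mod_ring}"
  let ?N = "\<lambda>a. mat2 a 0 0 1 :: 'p mod_ring mat"
  \<comment> \<open>The factor diag(1/(ad), 1) normalises the lower block, so that \<open>Q\<close>
    ranges over \<open>SL\<close> of degree 2.\<close>
  define f where "f = (\<lambda>(((a, d, b), Q), (r, s, c, e)).
    four_block_mat (mat2 a b 0 d) (mat2 r s 0 0) (mat2 0 c 0 e) (?N (1 / (a * d)) * (Q :: 'p mod_ring mat)))"
  let ?D = "(?T \<times> ?T \<times> (UNIV :: 'p mod_ring set)) \<times> ?S"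
  have NN: "?N a * (?N b * Q) = ?N (a * b) * Q" if "Q \<in> carrier_mat 2 2" for a b Q
    by (subst assoc_mult_mat[OF mat2_carrier mat2_carrier that, symmetric]) (simp add: mat2_mult)
  have N1: "?N 1 * Q = Q" if "Q \<in> carrier_mat 2 2" for Q
    using that by (simp add: one_mat2[symmetric])
  have detN: "det (?N a * Q) = a * det Q" if "Q \<in> carrier_mat 2 2" for a Q
    by (simp add: det_mult[OF mat2_carrier that] mat2_det)
  have inj: "inj_on f (?D \<times> UNIV)"
  proof (rule inj_onI)
    fix x y assume xy: "x \<in> ?D \<times> UNIV" "y \<in> ?D \<times> UNIV" "f x = f y"
    obtain a d b Q r s c e where x: "x = (((a, d, b), Q), (r, s, c, e))" by (metis prod.exhaust)
    obtain a' d' b' Q' r' s' c' e' where y: "y = (((a', d', b'), Q'), (r', s', c', e'))" by (metis prod.exhaust)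
    have Q: "Q \<in> carrier_mat 2 2" "Q' \<in> carrier_mat 2 2" and a: "a \<noteq> 0" "d \<noteq> 0"
      using xy(1,2) by (auto simp: x y SL_iff)
    have "mat2 a b 0 d = mat2 a' b' 0 d' \<and> mat2 r s 0 0 = mat2 r' s' 0 0 \<and> mat2 0 c 0 e = mat2 0 c' 0 e'
        \<and> ?N (1 / (a * d)) * Q = ?N (1 / (a' * d')) * Q'"
      using xy(3) unfolding x y f_def prod.case
      by (subst four_block_eq_iff[symmetric, of _ 2 _ 2]) (use Q in \<open>auto intro: mult_carrier_mat[OF mat2_carrier]\<close>)
    then have e: "a = a'" "b = b'" "d = d'" "r = r'" "s = s'" "c = c'" "e = e'"
      "?N (1 / (a * d)) * Q = ?N (1 / (a * d)) * Q'" by (auto simp: mat2_inject)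
    then have "?N (a * d) * (?N (1 / (a * d)) * Q) = ?N (a * d) * (?N (1 / (a * d)) * Q')" by simp
    then have "Q = Q'" using a by (simp add: NN Q N1)
    then show "x = y" by (simp add: x y e)
  qed
  have repr: "\<exists>Q'\<in>?S. Q = ?N (1 / (a * d)) * Q'" if Q: "Q \<in> carrier_mat 2 2" "a * d * det Q = 1" for a d Q
  proof
    have ad: "a * d \<noteq> 0" using Q(2) by auto
    show "Q = ?N (1 / (a * d)) * (?N (a * d) * Q)" using Q(1) ad by (simp add: NN N1)
    show "?N (a * d) * Q \<in> ?S" using Q by (auto simp: SL_iff detN intro: mult_carrier_mat[OF mat2_carrier])
  qed
  have NQ: "?N (1 / (a * d)) * Q \<in> carrier_mat 2 2" "a * d * det (?N (1 / (a * d)) * Q) = 1"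
    if "Q \<in> ?S" "a \<noteq> 0" "d \<noteq> 0" for a d Q
    using that by (auto simp: SL_iff detN intro: mult_carrier_mat[OF mat2_carrier])
  have Mu_f: "Mu = f ` (?D \<times> UNIV)"
  proof
    show "Mu \<subseteq> f ` (?D \<times> UNIV)"
    proof
      fix x assume "x \<in> Mu"
      then obtain a b d r s c e Q where x: "x = four_block_mat (mat2 a b 0 d) (mat2 r s 0 0) (mat2 0 c 0 e) Q"
        and Q: "Q \<in> carrier_mat 2 2" and ad: "a * d * det Q = 1" by (auto simp: Mu_def)
      obtain Q' where "Q' \<in> ?S" "Q = ?N (1 / (a * d)) * Q'" using repr[OF Q ad] by blast
      moreover have "a \<noteq> 0" "d \<noteq> 0" using ad by auto
      ultimately show "x \<in> f ` (?D \<times> UNIV)"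
        by (intro image_eqI[of _ _ "(((a, d, b), Q'), (r, s, c, e))"]) (auto simp: f_def x)
    qed
    show "f ` (?D \<times> UNIV) \<subseteq> Mu"
    proof
      fix x assume "x \<in> f ` (?D \<times> UNIV)"
      then obtain w where w: "w \<in> ?D \<times> UNIV" "x = f w" by blast
      obtain a d b Q r s c e where w': "w = (((a, d, b), Q), (r, s, c, e))" by (metis prod.exhaust)
      have "Q \<in> ?S" "a \<noteq> 0" "d \<noteq> 0" using w(1) by (auto simp: w')
      from NQ[OF this] show "x \<in> Mu" unfolding w(2) w' f_def prod.case Mu_def by blast
    qed
  qed
  have bd: "bdiag (mat2 a b 0 d) Q = four_block_mat (mat2 a b 0 d) (mat2 0 0 0 0) (mat2 0 0 0 0) Q"
    if "Q \<in> carrier_mat 2 2" for a b d Q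
    using that by (simp add: bdiag_def zero_mat2 carrier_matD[OF mat2_carrier])
  have Muz_f: "Muz = f ` (?D \<times> {(0, 0, 0, 0)})"
  proof
    show "Muz \<subseteq> f ` (?D \<times> {(0, 0, 0, 0)})"
    proof
      fix x assume "x \<in> Muz"
      then obtain a b d Q where x: "x = bdiag (mat2 a b 0 d) Q"
        and Q: "Q \<in> carrier_mat 2 2" and ad: "a * d * det Q = 1" by (auto simp: Muz_def)
      obtain Q' where "Q' \<in> ?S" "Q = ?N (1 / (a * d)) * Q'" using repr[OF Q ad] by blast
      moreover have "a \<noteq> 0" "d \<noteq> 0" using ad by auto
      ultimately show "x \<in> f ` (?D \<times> {(0, 0, 0, 0)})"
        using Q by (intro image_eqI[of _ _ "(((a, d, b), Q'), (0, 0, 0, 0))"]) (auto simp: f_def x bd)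
    qed
    show "f ` (?D \<times> {(0, 0, 0, 0)}) \<subseteq> Muz"
    proof
      fix x assume "x \<in> f ` (?D \<times> {(0, 0, 0, 0)})"
      then obtain w where w: "w \<in> ?D" "x = f (w, (0, 0, 0, 0))" by blast
      obtain a d b Q where w': "w = ((a, d, b), Q)" by (metis prod.exhaust)
      have "Q \<in> ?S" "a \<noteq> 0" "d \<noteq> 0" using w(1) by (auto simp: w')
      from NQ[OF this] show "x \<in> Muz"
        unfolding w(2) w' f_def prod.case Muz_def using bd by (metis (mono_tags, lifting) mem_Collect_eq)
    qed
  qed
  have cD: "card ?D = (CARD('p) - 1) ^ 2 * CARD('p) * card ?S"
    by (simp add: card_cartesian_product card_Diff_singleton power2_eq_square)
  have "CARD('p mod_ring \<times> 'p mod_ring \<times> 'p mod_ring \<times> 'p mod_ring) = CARD('p) ^ 4"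
    by (simp add: power4_eq_xxxx)
  then have "card Mu = card ?D * CARD('p) ^ 4"
    unfolding Mu_f card_image[OF inj] by (simp only: card_cartesian_product)
  then show "card Mu = (CARD('p) - 1) ^ 2 * CARD('p) ^ 5 * card ?S"
    unfolding cD by (simp add: eval_nat_numeral)
  have "card Muz = card (?D \<times> {(0 :: 'p mod_ring, 0 :: 'p mod_ring, 0 :: 'p mod_ring, 0 :: 'p mod_ring)})"
    unfolding Muz_f by (intro card_image inj_on_subset[OF inj]) auto
  then show "card Muz = (CARD('p) - 1) ^ 2 * CARD('p) * card ?S"
    unfolding card_cartesian_product[of ?D] cD by simp
qed

theorem two_dvd_group_exponent:
  assumes H: "group H" and h: "h \<in> hom G H" "h ` carrier G = carrier H"
    and ker: "\<And>x. x \<in> kernel G H h \<Longrightarrow> \<exists>c. x = c \<cdot>\<^sub>m 1\<^sub>m 4"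
    and roots: "2 dvd card {s :: 'p mod_ring. s ^ 4 = 1}"
  shows "2 ^ 1 dvd group_exponent (C_hat H)"
proof -
  interpret h: group_hom G H h by (intro group_hom.intro G.group_axioms H group_hom_axioms.intro h(1))
  let ?P = "SL 2 :: 'p mod_ring mat monoid"
  let ?zP = "(- 1) \<cdot>\<^sub>m 1\<^sub>m 2 :: 'p mod_ring mat"
  let ?a = "2 * (CARD('p) - 1) * card B"
  let ?b = "- 2 * int (card Mu) - 2 * int (card Muz)"
  have one_P: "1\<^sub>m 2 \<in> carrier ?P" by (simp add: SL_iff)
  then have "card (carrier ?P) > 0" using finite_SL by (auto simp: card_gt_0_iff)
  then obtain v o' where vo: "card (carrier ?P) = 2 ^ v * o'" "odd o'" using odd_part by blast
  obtain \<chi> where \<chi>: "\<chi> \<in> Char_Q H" "\<And>g. g \<in> carrier G \<Longrightarrow> of_nat ?a * \<chi> (h g) = Tot g"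
    using exists_character[OF H h ker] by blast
  have zP: "?zP \<in> carrier ?P" by (simp add: SL_iff one_mat2 smult_mat2 mat2_det)
  show ?thesis
  proof (rule h.two_power_dvd_exponent[where P = ?P and \<tau> = "bdiag (1\<^sub>m 2)" and zP = ?zP and z = z and u = u
        and l = "CARD('p)" and \<chi> = \<chi> and a = ?a and b = ?b and v = v])
    show "h ` carrier G = carrier H" "finite (carrier G)" using h(2) finite_SL by auto
    show "group ?P" "finite (carrier ?P)" "2 ^ v dvd Coset.order ?P"
      using group_SL finite_SL vo(1) by (simp_all add: Coset.order_def)
    show "bdiag (1\<^sub>m 2) \<in> hom ?P G"
    proof (rule homI)
      show "bdiag (1\<^sub>m 2) Q \<in> carrier G" if "Q \<in> carrier ?P" for Q
        using that by (simp add: SL_iff bdiag_det[of _ 2 _ 2])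
      show "bdiag (1\<^sub>m 2) (Q \<otimes>\<^bsub>?P\<^esub> R) = bdiag (1\<^sub>m 2) Q \<otimes>\<^bsub>G\<^esub> bdiag (1\<^sub>m 2) R"
        if "Q \<in> carrier ?P" "R \<in> carrier ?P" for Q R
        using that by (simp add: SL_iff bdiag_mult[of _ 2 _ 2])
    qed
    show "?zP \<in> carrier ?P" by (rule zP)
    show "bdiag (1\<^sub>m 2) ?zP = z" by (simp add: z_eq)
    show "Q = \<one>\<^bsub>?P\<^esub> \<or> Q = ?zP" if "Q \<in> carrier ?P" "Q \<otimes>\<^bsub>?P\<^esub> Q = \<one>\<^bsub>?P\<^esub>" for Q
      using that SL2_involution[of Q] two_nonzero by (simp add: SL_iff)
    show "Q \<otimes>\<^bsub>?P\<^esub> ?zP = ?zP \<otimes>\<^bsub>?P\<^esub> Q" if "Q \<in> carrier ?P" for Q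
      using that by (auto simp: SL_iff mult_smult_assoc_mat[of _ 2 2 _ 2] mult_smult_distrib[of _ 2 2 _ 2])
    show "?zP \<otimes>\<^bsub>?P\<^esub> ?zP = \<one>\<^bsub>?P\<^esub>"
      by (simp add: one_mat2 smult_mat2 mat2_mult)
    show "u \<in> carrier G" by (rule u_G)
    show "u \<otimes>\<^bsub>G\<^esub> z = z \<otimes>\<^bsub>G\<^esub> u" by (simp add: u_def z_def bel_mult add.commute)
    show "odd (CARD('p))" using p by presburger
    show "u [^]\<^bsub>G\<^esub> CARD('p) = \<one>\<^bsub>G\<^esub>"
      unfolding SL_pow[OF u_G] by (simp add: u_def bel_pow bel_one)
    show "\<exists>i::nat. u \<otimes>\<^bsub>G\<^esub> bdiag (1\<^sub>m 2) Q = bdiag (1\<^sub>m 2) Q \<otimes>\<^bsub>G\<^esub> u [^]\<^bsub>G\<^esub> i" if Q: "Q \<in> carrier ?P" for Q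
    proof -
      have Q': "Q \<in> carrier_mat 2 2" using Q by (simp add: SL_iff)
      have "u * bdiag (1\<^sub>m 2) Q = bdiag (1\<^sub>m 2) Q * u"
        by (simp add: u_eq bdiag_mult[of _ 2 _ 2] Q' right_mult_one_mat[OF upper2_carrier] left_mult_one_mat[OF upper2_carrier]
            left_mult_one_mat[OF Q'] right_mult_one_mat[OF Q'])
      moreover have "u \<in> carrier_mat 4 4" using u_G by (simp add: carrier_G)
      ultimately show ?thesis by (intro exI[of _ 1]) simp
    qed
    show "\<chi> \<in> Char_Q H" by (rule \<chi>(1))
    have uz: "u \<otimes>\<^bsub>G\<^esub> z \<in> carrier G" using u_G z_G by (rule G.m_closed)
    show "of_nat ?a * (\<chi> (h u) - \<chi> (h (u \<otimes>\<^bsub>G\<^esub> z))) = of_int ?b"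
      unfolding right_diff_distrib \<chi>(2)[OF u_G] \<chi>(2)[OF uz] by (simp add: Tot_u Tot_uz)
    show "2 ^ 1 dvd N" if eq: "int N * ?b = 2 ^ v * l * int ?a" for N l
    proof -
      obtain w where w: "card {s :: 'p mod_ring. s ^ 4 = 1} = 2 * w" using roots by blast
      \<comment> \<open>Here p being 3 modulo 4 enters: (p - 1)/2 is odd.\<close>
      obtain r where r: "CARD('p) = 2 * r + 1" and r_odd: "odd r"
      proof
        show "CARD('p) = 2 * (CARD('p) div 2) + 1" "odd (CARD('p) div 2)" using p by presburger+
      qed
      have r0: "r > 0" using r_odd by (cases r) auto
      let ?p = "int CARD('p)"
      have p1: "CARD('p) - 1 = 2 * r" using r by simp
      have "odd ?p" using r by simp
      then have "odd (?p ^ 2)" by simp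
      then obtain y where y: "?p ^ 2 = 2 * y + 1" by (rule oddE)
      have "?p ^ 4 = (?p ^ 2) ^ 2" by (simp only: power_mult[symmetric]) simp
      \<comment> \<open>p^4 + 1 is 2 modulo 4; it comes from adding the sizes of \<open>Mu\<close>
        and \<open>Muz\<close> and contributes exactly one factor 2.\<close>
      then have p4: "?p ^ 4 + 1 = 2 * (2 * (y * y + y) + 1)" unfolding y by (simp add: power2_eq_square algebra_simps)
      have p5: "?p ^ 5 = ?p ^ 4 * ?p" by (simp add: eval_nat_numeral)
      define w' where "w' = int N * int o' * (2 * (y * y + y) + 1)"
      let ?K = "16 * int r * ?p * 2 ^ v"
      have "int N * ?b = - (int N * (2 * ((2 * int r) ^ 2 * ?p * (2 ^ v * int o')) * (?p ^ 4 + 1)))"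
        unfolding card_Mu card_Muz vo(1) p1 by (simp add: p5 algebra_simps)
      also have "\<dots> = ?K * - (int r * w')"
        unfolding p4 w'_def by (simp add: power2_eq_square algebra_simps)
      finally have "?K * - (int r * w') = 2 ^ v * l * int ?a" using eq by simp
      also have "\<dots> = ?K * (2 * l * int w)"
        unfolding card_B w p1 by simp
      finally have "?K * - (int r * w') = ?K * (2 * l * int w)" .
      moreover have "?K \<noteq> 0" using r0 by simp
      ultimately have "- (int r * w') = 2 * l * int w" by (metis mult_cancel_left)
      then have "even (- (int r * w'))" by simp
      then show ?thesis using r_odd vo(2) by (simp add: w'_def)
    qed
  qed
qed

end

section \<open>The number of scalars, and the conclusion for SL and PSL\<close>

text \<open>As nonzero elements have order dividing p - 1, Bezout reduces the exponent
  \<open>k\<close> to the gcd g. In the closure X^g - 1 has g distinct roots, and all of them lie in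
  the prime field since g divides p - 1.\<close>

lemma card_roots_of_unity_mod_ring:
  assumes k: "k > 0"
  shows "card {s :: 'p::prime_card mod_ring. s ^ k = 1} = gcd k (CARD('p) - 1)"
proof -
  let ?q = "CARD('p) - 1" and ?g = "gcd k (CARD('p) - 1)"
  have p1: "CARD('p) > 1" using prime_gt_1_nat[OF prime_card[where ?'a = 'p]] .
  have power_q: "s ^ ?q = 1" if s: "s \<noteq> 0" for s :: "'p mod_ring"
  proof -
    have "s ^ ?q * s = s ^ CARD('p)" using p1 by (simp add: power_Suc2[symmetric] del: power_Suc2)
    also have "\<dots> = 1 * s" using finite_field_power_card_eq_same[of s] by simp
    finally show ?thesis using s by (metis mult_right_cancel)
  qed
  have iff: "s ^ k = 1 \<longleftrightarrow> s ^ ?g = 1" for s :: "'p mod_ring"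
  proof
    assume s: "s ^ k = 1"
    then have s0: "s \<noteq> 0" using k by (auto simp: power_0_left)
    obtain x y where "k * x = ?q * y + ?g" using bezout_nat[of k ?q] k by auto
    then have "s ^ (k * x) = s ^ (?q * y + ?g)" by (rule arg_cong)
    then show "s ^ ?g = 1" using s power_q[OF s0] by (simp only: power_add power_mult power_one mult_1_left)
  next
    assume s: "s ^ ?g = 1"
    obtain r where "k = ?g * r" using gcd_dvd1[of k ?q] by (rule dvdE)
    then have "s ^ k = (s ^ ?g) ^ r" by (simp only: power_mult[symmetric])
    then show "s ^ k = 1" using s by simp
  qed
  \<comment> \<open>The degenerate instance with \<open>\<alpha> = 1\<close>: here
    \<open>L_coords\<close> says that the fixed points of Frobenius are the image of the prime
    field.\<close>
  interpret root_mult 1 1 "1 :: 'p mod_ring alg_closure"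
    by unfold_locales auto
  let ?R = "{x :: 'p mod_ring alg_closure. x ^ ?g = 1}"
  have g0: "?g > 0" using k by simp
  have "?g \<le> ?q" using p1 by (intro dvd_imp_le) auto
  have "of_nat ?g \<noteq> (0 :: 'p mod_ring alg_closure)"
  proof
    assume "of_nat ?g = (0 :: 'p mod_ring alg_closure)"
    then have "CARD('p) dvd ?g" by (simp only: of_nat_eq_0_iff_char_dvd CHAR_ac)
    then show False using dvd_imp_le[OF _ g0, of "CARD('p)"] \<open>?g \<le> ?q\<close> p1 by linarith
  qed
  then have "card ?R = ?g" by (rule card_roots_of_unity[OF g0])
  moreover have "?R = to_ac ` {s :: 'p mod_ring. s ^ k = 1}"
  proof
    show "?R \<subseteq> to_ac ` {s :: 'p mod_ring. s ^ k = 1}"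
    proof
      fix x assume x: "x \<in> ?R"
      obtain r where r: "?q = ?g * r" using gcd_dvd2[of k ?q] by (rule dvdE)
      have "x ^ ?q = (x ^ ?g) ^ r" unfolding power_mult[symmetric] r[symmetric] ..
      then have "x ^ ?q = 1" using x by simp
      moreover have "x ^ ?q * x = x ^ CARD('p)" using p1 by (simp add: power_Suc2[symmetric] del: power_Suc2)
      ultimately have "x ^ (CARD('p) ^ 1) = x" by simp
      then obtain c where "evl c 1 = x" using L_coords[of x] by blast
      then have "x = to_ac (c 0)" unfolding evl_def by simp
      moreover then have "c 0 ^ k = 1" using x unfolding iff by (metis (mono_tags) mem_Collect_eq to_ac_1 to_ac_eq_iff to_ac_power)
      ultimately show "x \<in> to_ac ` {s :: 'p mod_ring. s ^ k = 1}" by blast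
    qed
    show "to_ac ` {s :: 'p mod_ring. s ^ k = 1} \<subseteq> ?R"
      unfolding iff by (auto simp: to_ac_power[symmetric] simp del: to_ac_power)
  qed
  moreover have "inj_on to_ac {s :: 'p mod_ring. s ^ k = 1}" by (simp add: inj_on_def)
  ultimately show ?thesis by (metis card_image)
qed

text \<open>The dichotomy is whether p^(n/2) + 1 is a power of 2.\<close>

theorem two_power_dvd_exponent_C_hat_quotient:
  fixes h :: "'p::prime_card mod_ring mat \<Rightarrow> 'h"
  assumes k: "k \<ge> 4" and m: "2 ^ m dvd k" "2 ^ m dvd CARD('p) - 1"
    and H: "group H" and hom: "h \<in> hom (SL k) H" "h ` carrier (SL k) = carrier H"
    and ker: "\<And>x. x \<in> kernel (SL k) H h \<Longrightarrow> \<exists>c. x = c \<cdot>\<^sub>m 1\<^sub>m k"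
  shows "2 ^ m dvd group_exponent (C_hat H)"
proof (cases "m = 0")
  case False
  let ?p = "CARD('p)"
  have p1: "?p > 1" using prime_gt_1_nat[OF prime_card[where ?'a = 'p]] .
  have roots: "2 ^ m dvd card {s :: 'p mod_ring. s ^ k = 1}"
    using k m by (subst card_roots_of_unity_mod_ring) auto
  have two: "(2 :: nat) dvd 2 ^ m" using False by simp
  then have "2 dvd k" "2 dvd ?p - 1" using m dvd_trans by blast+
  then have k_even: "even k" and p_odd: "odd ?p" using p1 by auto
  define n where "n = k - 2"
  define i where "i = n div 2"
  have n: "n > 0" "even n" "k = n + 2" using k k_even by (auto simp: n_def)
  have i: "i > 0" "2 * i = n" using n k by (auto simp: i_def)
  obtain x q where xq: "?p ^ i + 1 = 2 ^ x * q" "odd q" using odd_part[of "?p ^ i + 1"] by auto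
  show ?thesis
  proof (cases "q = 1")
    case True
    then have "i = 1 \<and> 4 dvd ?p + 1" using power_plus_one_two_power[OF p1 p_odd i(1)] xq(1) by simp
    then have k4: "k = 4" and p4: "?p mod 4 = 3" using i n by (simp, presburger)
    \<comment> \<open>4 divides p + 1, so it cannot divide p - 1.\<close>
    have "m = 1"
    proof (rule ccontr)
      assume "m \<noteq> 1"
      then have "(2::nat) ^ 2 dvd 2 ^ m" using False by (intro le_imp_power_dvd) simp
      then have "2 ^ 2 dvd ?p - 1" using m(2) by (rule dvd_trans)
      then have "4 dvd ?p - 1" by simp
      then show False using p4 by presburger
    qed
    interpret three_mod_four "mat2 0 (- 1) 1 0 :: 'p mod_ring mat"
      by unfold_locales (use p4 in simp_all)
    have "2 ^ 1 dvd group_exponent (C_hat H)"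
      by (rule two_dvd_group_exponent[OF H]) (use hom ker roots k4 \<open>m = 1\<close> in simp_all)
    then show ?thesis by (simp add: \<open>m = 1\<close>)
  next
    case False
    then have q1: "q > 1" using xq(2) by (cases q) auto
    interpret plus_one ?p i q x
      by unfold_locales (use p1 p_odd i xq q1 in auto)
    have "q dvd ?p ^ n - 1" using q_dvd_iff[of n] i(2) by simp
    then obtain \<alpha> :: "'p mod_ring alg_closure" where \<alpha>: "\<And>j. \<alpha> ^ j = 1 \<longleftrightarrow> q dvd j"
      using exists_root_of_unity[OF n(1)] by blast
    interpret R: root_mult n q \<alpha>
      by unfold_locales (use n(1) \<alpha> q_dvd_iff i(2) in auto)
    interpret field_block n k q "R.mmat \<alpha>"
    proof
      show "int q dvd int \<gamma> - 1 \<or> int q dvd int \<gamma> + 1"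
        if Q: "Q \<in> carrier_mat n n" "det Q \<noteq> 0" "R.mmat \<alpha> * Q = Q * R.mmat \<alpha> ^\<^sub>m \<gamma>"
          and sq: "int q dvd int \<gamma> * int \<gamma> - 1" for Q \<gamma>
      proof -
        obtain j where "j < n" "int q dvd int \<gamma> - int (?p ^ j)" using R.U_galois[OF Q] by blast
        then show ?thesis using square_root_of_one[of j \<gamma>] sq i(2) by simp
      qed
      show "coprime q ?p" using coprime_p_q by (simp add: coprime_commute)
    qed (fact n p_odd xq(2) q1 coprime_q_p_minus_1 R.U_carrier R.U_pow_q R.U_fixed_point_free
        R.U_involution R.U_nonsquare_det[OF p_odd])+
    show ?thesis by (rule two_power_dvd_group_exponent[OF H hom ker roots])
  qed
qed simp

lemma scalar_matrices_normal:
  "{A \<in> carrier (SL k). \<exists>c. A = c \<cdot>\<^sub>m 1\<^sub>m k} \<lhd> (SL k :: 'a::field mat monoid)"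
  (is "?Z \<lhd> ?G")
proof -
  interpret G: group ?G by (rule group_SL)
  have comm: "A * Z = Z * A" if "A \<in> carrier ?G" "Z \<in> ?Z" for A Z
    using that by (auto simp: SL_iff mult_smult_assoc_mat[of _ k k _ k] mult_smult_distrib[of _ k k _ k])
  have sub: "subgroup ?Z ?G"
  proof (rule G.subgroupI)
    have "1\<^sub>m k = 1 \<cdot>\<^sub>m (1\<^sub>m k :: 'a mat)" by simp
    then show "?Z \<noteq> {}" using SL_iff[of "1\<^sub>m k :: 'a mat" k] by fastforce
    fix Z assume Z: "Z \<in> ?Z"
    then obtain c where c: "Z = c \<cdot>\<^sub>m 1\<^sub>m k" and ZG: "Z \<in> carrier ?G" by blast
    have dc: "c ^ k = 1" using ZG by (simp add: SL_iff c)
    show "inv\<^bsub>?G\<^esub> Z \<in> ?Z"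
    \<comment> \<open>The empty matrix is \<open>c\<close> times the identity for every
      \<open>c\<close>, even for 0; only for positive \<open>k\<close> can \<open>c\<close> be
      inverted.\<close>
    proof (cases "k = 0")
      case True
      have "inv\<^bsub>?G\<^esub> Z \<in> carrier ?G" using ZG by simp
      moreover then have "inv\<^bsub>?G\<^esub> Z = 1 \<cdot>\<^sub>m 1\<^sub>m k" by (intro eq_matI) (auto simp: SL_iff True)
      ultimately show ?thesis by blast
    next
      case False
      then have c0: "c \<noteq> 0" using dc by (auto simp: power_0_left)
      let ?Y = "inverse c \<cdot>\<^sub>m 1\<^sub>m k :: 'a mat"
      have Y: "?Y \<in> carrier ?G" using dc by (simp add: SL_iff power_inverse)
      moreover have "?Y * Z = 1\<^sub>m k"
        using c0 by (simp add: c mult_smult_assoc_mat[of _ k k _ k])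
      ultimately have "inv\<^bsub>?G\<^esub> Z = ?Y" using ZG by (intro G.inv_equality) simp_all
      then show ?thesis using Y by auto
    qed
  next
    fix Y Z assume "Y \<in> ?Z" "Z \<in> ?Z"
    then obtain c d where "Y = c \<cdot>\<^sub>m 1\<^sub>m k" "Z = d \<cdot>\<^sub>m 1\<^sub>m k" "Y \<in> carrier ?G" "Z \<in> carrier ?G" by blast
    moreover then have "Y * Z = (c * d) \<cdot>\<^sub>m 1\<^sub>m k" by (simp add: mult_smult_assoc_mat[of _ k k _ k])
    moreover have "Y \<otimes>\<^bsub>?G\<^esub> Z \<in> carrier ?G" using calculation by (intro G.m_closed)
    ultimately show "Y \<otimes>\<^bsub>?G\<^esub> Z \<in> ?Z" by auto
  qed auto
  show ?thesis
    unfolding G.normal_inv_iff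
  proof (intro conjI sub ballI)
    fix A Z assume A: "A \<in> carrier ?G" and Z: "Z \<in> ?Z"
    have ZG: "Z \<in> carrier ?G" using Z by blast
    have "A \<otimes>\<^bsub>?G\<^esub> Z \<otimes>\<^bsub>?G\<^esub> inv\<^bsub>?G\<^esub> A = Z \<otimes>\<^bsub>?G\<^esub> A \<otimes>\<^bsub>?G\<^esub> inv\<^bsub>?G\<^esub> A" using comm[OF A Z] by simp
    also have "\<dots> = Z" using A ZG by (simp only: G.m_assoc G.inv_closed G.r_inv G.r_one)
    finally show "A \<otimes>\<^bsub>?G\<^esub> Z \<otimes>\<^bsub>?G\<^esub> inv\<^bsub>?G\<^esub> A \<in> ?Z" using Z by (simp only:)
  qed
qed

hide_const (open) Divisibility.prime

theorem theorem6p1: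
  fixes k p :: nat
  assumes "k \<ge> 4"
    and "prime p"
    and "CARD('p::prime_card) = p"
  shows "2 ^ min (multiplicity 2 k) (multiplicity 2 (p - 1))
           dvd group_exponent (C_hat (PSL k :: 'p mod_ring mat set monoid)) \<and>
         2 ^ min (multiplicity 2 k) (multiplicity 2 (p - 1))
           dvd group_exponent (C_hat (SL k :: 'p mod_ring mat monoid))"
proof -
  let ?m = "min (multiplicity 2 k) (multiplicity 2 (p - 1))" and ?G = "SL k :: 'p mod_ring mat monoid"
  let ?Z = "{A \<in> carrier ?G. \<exists>c. A = c \<cdot>\<^sub>m 1\<^sub>m k}"
  interpret G: group ?G by (rule group_SL)
  have N: "?Z \<lhd> ?G" by (rule scalar_matrices_normal)
  have m: "2 ^ ?m dvd k" "2 ^ ?m dvd CARD('p) - 1"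
    unfolding assms(3) by (rule multiplicity_dvd', simp)+
  have "2 ^ ?m dvd group_exponent (C_hat ?G)"
  proof (rule two_power_dvd_exponent_C_hat_quotient[OF assms(1) m G.group_axioms, where h = "\<lambda>x. x"])
    show "(\<lambda>x. x) \<in> hom ?G ?G" unfolding hom_def by blast
    show "(\<lambda>x. x) ` carrier ?G = carrier ?G" by (rule image_ident)
    fix x assume "x \<in> kernel ?G ?G (\<lambda>x. x)"
    then have "x = 1 \<cdot>\<^sub>m 1\<^sub>m k" by (simp add: kernel_def)
    then show "\<exists>c. x = c \<cdot>\<^sub>m 1\<^sub>m k" by blast
  qed
  moreover have "2 ^ ?m dvd group_exponent (C_hat (?G Mod ?Z))"
  proof (rule two_power_dvd_exponent_C_hat_quotient[OF assms(1) m normal.factorgroup_is_group[OF N] normal.r_coset_hom_Mod[OF N]])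
    show "(\<lambda>a. ?Z #>\<^bsub>?G\<^esub> a) ` carrier ?G = carrier (?G Mod ?Z)"
      unfolding FactGroup_def RCOSETS_def by auto
    fix x assume x: "x \<in> kernel ?G (?G Mod ?Z) (\<lambda>a. ?Z #>\<^bsub>?G\<^esub> a)"
    then have "?Z #>\<^bsub>?G\<^esub> x = ?Z" "x \<in> carrier ?G" unfolding kernel_def FactGroup_def by simp_all
    then have "x \<in> ?Z" using normal_imp_subgroup[OF N] G.coset_join1 by blast
    then show "\<exists>c. x = c \<cdot>\<^sub>m 1\<^sub>m k" by blast
  qed
  ultimately show ?thesis by (simp add: PSL_def)
qed

end
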